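(* Let $0<\alpha<1$ and $s<-\frac12$. For given $(\phi,\psi)\in H^s(\mathbb{R})\times H^s(\mathbb{R})$, there exists no time $T=T(\|(\phi,\psi)\|_{H^s\times H^s})>0$ such that the map that takes the initial data $(\phi,\psi)$ to the solution $(v,w)\in C([0,T];H^s(\mathbb{R}))\times C([0,T];H^s(\mathbb{R}))$ of the initial value problem $$\begin{cases}\partial_t v+\partial_x^3 v+\partial_x(vw^2)=0, & v(x,0)=\phi(x),\\ \partial_t w+\alpha\,\partial_x^3 w+\partial_x(v^2w)=0, & w(x,0)=\psi(x),\end{cases}$$ is $C^3$ at the origin.
   Context: Here $(x,t)\in\mathbb{R}\times\mathbb{R}$, and $\|f\|_{H^s}=\|\langle\xi\rangle^s\widehat f(\xi)\|_{L^2_\xi}$ with $\langle\xi\rangle=1+|\xi|$. Solutions are understood in the sense of the integral equations $$v(t)=U(t)\phi-\int_0^tU(t-t')\partial_x(vw^2)(t')\,dt',\qquad w(t)=U^\alpha(t)\psi-\int_0^tU^\alpha(t-t')\partial_x(v^2w)(t')\,dt',$$ where $\widehat{U(t)f}(\xi)=e^{it\xi^3}\widehat f(\xi)$ and $\widehat{U^\alpha(t)f}(\xi)=e^{it\alpha\xi^3}\widehat f(\xi)$. The data-to-solution map is regarded as a map from a neighbourhood of $(0,0)$ in $H^s(\mathbb{R})\times H^s(\mathbb{R})$ to $C([0,T];H^s(\mathbb{R}))\times C([0,T];H^s(\mathbb{R}))$, the zero data being sent to the zero solution; "$C^3$ at the origin" refers to (Fréchet) $C^3$ regularity of this map at $(0,0)$.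 *)

theory Defs
  imports "HOL-Analysis.Analysis"
begin

section \<open>The Hilbert space L2 of the real line\<close>

definition sq_int :: "(real \<Rightarrow> complex) \<Rightarrow> bool" where
  "sq_int f \<longleftrightarrow> f \<in> borel_measurable lborel \<and> integrable lborel (\<lambda>x. (cmod (f x))\<^sup>2)"

lemma sq_int_zero: "sq_int (\<lambda>_. 0)"
  by (simp add: sq_int_def)

lemma sq_int_add:
  assumes "sq_int f" "sq_int g"
  shows "sq_int (\<lambda>x. f x + g x)"
proof -
  have [measurable]: "f \<in> borel_measurable borel" "g \<in> borel_measurable borel"
    using assms by (auto simp: sq_int_def)
  have "integrable lborel (\<lambda>x. 2 * (cmod (f x))\<^sup>2 + 2 * (cmod (g x))\<^sup>2)"
    using assms by (auto simp: sq_int_def)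
  then have "integrable lborel (\<lambda>x. (cmod (f x + g x))\<^sup>2)"
  proof (rule Bochner_Integration.integrable_bound)
    show "AE x in lborel. norm ((cmod (f x + g x))\<^sup>2)
        \<le> norm (2 * (cmod (f x))\<^sup>2 + 2 * (cmod (g x))\<^sup>2)"
    proof (rule AE_I2)
      fix x
      have "(cmod (f x + g x))\<^sup>2 \<le> (cmod (f x) + cmod (g x))\<^sup>2"
        by (intro power_mono norm_triangle_ineq) auto
      also have "\<dots> \<le> 2 * (cmod (f x))\<^sup>2 + 2 * (cmod (g x))\<^sup>2"
        using zero_le_power2[of "cmod (f x) - cmod (g x)"]
        by (simp add: power2_sum power2_diff)
      finally show "norm ((cmod (f x + g x))\<^sup>2)
        \<le> norm (2 * (cmod (f x))\<^sup>2 + 2 * (cmod (g x))\<^sup>2)"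
        by simp
    qed
  qed simp
  then show ?thesis by (simp add: sq_int_def)
qed

lemma sq_int_scaleR: "sq_int f \<Longrightarrow> sq_int (\<lambda>x. c *\<^sub>R f x)"
  by (auto simp: sq_int_def power_mult_distrib norm_mult)

lemma sq_int_uminus: "sq_int f \<Longrightarrow> sq_int (\<lambda>x. - f x)"
  by (auto simp: sq_int_def)

lemma sq_int_diff: "sq_int f \<Longrightarrow> sq_int g \<Longrightarrow> sq_int (\<lambda>x. f x - g x)"
  using sq_int_add[of f "\<lambda>x. - g x"] sq_int_uminus[of g] by simp

lemma sq_int_inner:
  assumes "sq_int f" "sq_int g"
  shows "integrable lborel (\<lambda>x. f x \<bullet> g x)"
proof -
  have "integrable lborel (\<lambda>x. ((cmod (f x + g x))\<^sup>2 - (cmod (f x))\<^sup>2 - (cmod (g x))\<^sup>2) / 2)"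
    using assms sq_int_add[OF assms] by (auto simp: sq_int_def)
  also have "(\<lambda>x. ((cmod (f x + g x))\<^sup>2 - (cmod (f x))\<^sup>2 - (cmod (g x))\<^sup>2) / 2)
      = (\<lambda>x. f x \<bullet> g x)"
    by (rule ext) (simp add: power2_norm_eq_inner inner_add_left inner_add_right inner_commute)
  finally show ?thesis .
qed

quotient_type L2 = "real \<Rightarrow> complex" / partial:
  "\<lambda>f g. sq_int f \<and> sq_int g \<and> (AE x in lborel. f x = g x)"
proof (rule part_equivpI)
  show "\<exists>f. sq_int f \<and> sq_int f \<and> (AE x in lborel. f x = f x)"
    using sq_int_zero by auto
  show "symp (\<lambda>f g. sq_int f \<and> sq_int g \<and> (AE x in lborel. f x = g x))"
    by (auto simp: symp_def elim: AE_mp)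
  show "transp (\<lambda>f g. sq_int f \<and> sq_int g \<and> (AE x in lborel. f x = g x))"
    unfolding transp_def by (safe; eventually_elim) auto
qed

instantiation L2 :: real_inner
begin

lift_definition zero_L2 :: L2 is "\<lambda>_. 0"
  by (simp add: sq_int_zero)

lift_definition plus_L2 :: "L2 \<Rightarrow> L2 \<Rightarrow> L2" is "\<lambda>f g x. f x + g x"
  by (auto intro: sq_int_add elim: eventually_elim2)

lift_definition uminus_L2 :: "L2 \<Rightarrow> L2" is "\<lambda>f x. - f x"
  by (auto intro: sq_int_uminus)

lift_definition minus_L2 :: "L2 \<Rightarrow> L2 \<Rightarrow> L2" is "\<lambda>f g x. f x - g x"
  by (auto intro: sq_int_diff elim: eventually_elim2)

lift_definition scaleR_L2 :: "real \<Rightarrow> L2 \<Rightarrow> L2" is "\<lambda>c f x. c *\<^sub>R f x"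
  by (auto intro: sq_int_scaleR elim: eventually_mono)

lift_definition inner_L2 :: "L2 \<Rightarrow> L2 \<Rightarrow> real" is "\<lambda>f g. LINT x|lborel. f x \<bullet> g x"
proof -
  fix f f' g g' :: "real \<Rightarrow> complex"
  assume 1: "sq_int f \<and> sq_int f' \<and> (AE x in lborel. f x = f' x)"
    and 2: "sq_int g \<and> sq_int g' \<and> (AE x in lborel. g x = g' x)"
  have "integrable lborel (\<lambda>x. f x \<bullet> g x)" "integrable lborel (\<lambda>x. f' x \<bullet> g' x)"
    using 1 2 sq_int_inner by blast+
  then have "(\<lambda>x. f x \<bullet> g x) \<in> borel_measurable lborel" "(\<lambda>x. f' x \<bullet> g' x) \<in> borel_measurable lborel"
    using borel_measurable_integrable by blast+
  moreover have "AE x in lborel. f x \<bullet> g x = f' x \<bullet> g' x"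
    using 1 2 by (auto elim: eventually_elim2)
  ultimately show "(LINT x|lborel. f x \<bullet> g x) = (LINT x|lborel. f' x \<bullet> g' x)"
    by (rule integral_cong_AE)
qed

definition norm_L2 :: "L2 \<Rightarrow> real" where "norm_L2 u = sqrt (inner u u)"
definition sgn_L2 :: "L2 \<Rightarrow> L2" where "sgn_L2 u = scaleR (inverse (norm u)) u"
definition dist_L2 :: "L2 \<Rightarrow> L2 \<Rightarrow> real" where "dist_L2 u v = norm (u - v)"
definition uniformity_L2 :: "(L2 \<times> L2) filter" where
  "uniformity_L2 = (INF e\<in>{0 <..}. principal {(x, y). dist x y < e})"
definition open_L2 :: "L2 set \<Rightarrow> bool" where
  "open_L2 S = (\<forall>x\<in>S. \<forall>\<^sub>F (x', y) in uniformity. x' = x \<longrightarrow> y \<in> S)"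

instance
proof
  fix u v w :: L2 and a b :: real
  show "u + v + w = u + (v + w)"
    by transfer (auto intro!: sq_int_add simp: add.assoc)
  show "u + v = v + u"
    by transfer (auto intro!: sq_int_add simp: add.commute)
  show "0 + u = u"
    by transfer auto
  show "- u + u = 0"
    by transfer (auto intro: sq_int_zero)
  show "u - v = u + - v"
    by transfer (auto intro!: sq_int_add sq_int_diff sq_int_uminus)
  show "a *\<^sub>R (u + v) = a *\<^sub>R u + a *\<^sub>R v"
    by transfer (auto intro!: sq_int_add sq_int_scaleR simp: scaleR_add_right simp del: scaleR_conv_of_real)
  show "(a + b) *\<^sub>R u = a *\<^sub>R u + b *\<^sub>R u"
    by transfer (auto intro!: sq_int_add sq_int_scaleR simp: scaleR_add_left simp del: scaleR_conv_of_real)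
  show "a *\<^sub>R b *\<^sub>R u = (a * b) *\<^sub>R u"
    by transfer (auto intro!: sq_int_scaleR)
  show "1 *\<^sub>R u = u"
    by transfer auto
  show "dist u v = norm (u - v)"
    by (rule dist_L2_def)
  show "sgn u = scaleR (inverse (norm u)) u"
    by (rule sgn_L2_def)
  show "(uniformity :: (L2 \<times> L2) filter) = (INF e\<in>{0 <..}. principal {(x, y). dist x y < e})"
    by (rule uniformity_L2_def)
  show "open U = (\<forall>x\<in>U. \<forall>\<^sub>F (x', y) in uniformity. x' = x \<longrightarrow> y \<in> U)" for U :: "L2 set"
    by (rule open_L2_def)
  show "inner u v = inner v u"
    by transfer (simp add: inner_commute)
  show "inner (u + v) w = inner u w + inner v w"
    by transfer (auto simp: inner_add_left sq_int_inner)
  show "inner (a *\<^sub>R u) v = a * inner u v"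
    by transfer (simp del: scaleR_conv_of_real)
  show "0 \<le> inner u u"
    by transfer simp
  show "inner u u = 0 \<longleftrightarrow> u = 0"
  proof (transfer, goal_cases)
    case (1 u)
    have "integrable lborel (\<lambda>x. u x \<bullet> u x)"
      using 1 by (auto intro: sq_int_inner)
    then have "(LINT x|lborel. u x \<bullet> u x) = 0 \<longleftrightarrow> (AE x in lborel. u x \<bullet> u x = 0)"
      by (intro integral_nonneg_eq_0_iff_AE) auto
    then show ?case using 1 by (auto simp: sq_int_zero)
  qed
  show "norm u = sqrt (inner u u)"
    by (rule norm_L2_def)
qed

end


section \<open>Sobolev spaces on the Fourier side\<close>

text \<open>
  Tempered distributions are not available, and for negative \<open>s\<close> the elements of \<open>H\<^sup>s\<close> are not
  functions. An element \<open>f\<close> of \<open>H\<^sup>s\<close> is therefore given by its Fourier transform, a function that is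
  square integrable against the weight \<open>(1 + \<bar>\<xi>\<bar>) powr (2 * s)\<close>, and the map sending \<open>f\<close> to the
  class of \<open>(1 + \<bar>\<xi>\<bar>) powr s * (F f) \<xi>\<close> is by definition of the norm an isometry of \<open>H\<^sup>s\<close> onto
  \<open>L2\<close>. A point of \<open>H\<^sup>s\<close> is identified with its image in \<open>L2\<close>, so that \<open>H\<^sup>s\<close> becomes a normed
  vector space type: in the definitions below, a \<open>u :: L2\<close> stands for the distribution
  with Fourier transform \<open>(1 + \<bar>\<xi>\<bar>) powr (- s) * u \<xi>\<close>.
\<close>

definition weight :: "real \<Rightarrow> (real \<Rightarrow> complex) \<Rightarrow> real \<Rightarrow> complex" where
  "weight s g \<xi> = of_real ((1 + \<bar>\<xi>\<bar>) powr s) * g \<xi>"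

definition in_Hs :: "real \<Rightarrow> (real \<Rightarrow> complex) \<Rightarrow> bool" where
  "in_Hs s g \<longleftrightarrow> sq_int (weight s g)"

definition Hs_of :: "real \<Rightarrow> (real \<Rightarrow> complex) \<Rightarrow> L2" where
  "Hs_of s g = abs_L2 (weight s g)"

lemma norm_Hs_of:
  assumes "in_Hs s g"
  shows "norm (Hs_of s g) = sqrt (LINT \<xi>|lborel. ((1 + \<bar>\<xi>\<bar>) powr s * cmod (g \<xi>))\<^sup>2)"
proof -
  have "inner (Hs_of s g) (Hs_of s g) = (LINT \<xi>|lborel. weight s g \<xi> \<bullet> weight s g \<xi>)"
    unfolding Hs_of_def by (rule inner_L2.abs_eq) (use assms in \<open>simp_all add: in_Hs_def\<close>)
  also have "(\<lambda>\<xi>. weight s g \<xi> \<bullet> weight s g \<xi>) = (\<lambda>\<xi>. ((1 + \<bar>\<xi>\<bar>) powr s * cmod (g \<xi>))\<^sup>2)"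
    by (simp only: dot_square_norm weight_def norm_mult norm_of_real abs_of_nonneg[OF powr_ge_zero])
  finally show ?thesis
    by (simp only: norm_L2_def)
qed

text \<open>
  The weight is even and real, so a distribution is real-valued, i.e. its Fourier transform is
  Hermitian, iff its representative in \<open>L2\<close> is Hermitian.
\<close>

definition real_valued :: "L2 set" where
  "real_valued = {u. AE \<xi> in lborel. rep_L2 u (- \<xi>) = cnj (rep_L2 u \<xi>)}"

text \<open>
  \<open>C([0,T]; H\<^sup>s)\<close>, embedded isometrically into the bounded continuous functions on the whole line by
  extending a curve to be constant on either side of \<open>[0,T]\<close>.
\<close>

definition curves :: "real \<Rightarrow> (real \<Rightarrow>\<^sub>C L2) set" where
  "curves T = {u :: real \<Rightarrow>\<^sub>C L2. \<forall>t. u t = u (clamp 0 T t)}"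


section \<open>Solutions of the system\<close>

definition fourier :: "(real \<Rightarrow> complex) \<Rightarrow> real \<Rightarrow> complex" where
  "fourier f \<xi> = (LINT x|lborel. cis (- (x * \<xi>)) * f x)"

definition inv_fourier :: "(real \<Rightarrow> complex) \<Rightarrow> real \<Rightarrow> complex" where
  "inv_fourier g x = of_real (1 / (2 * pi)) * (LINT \<xi>|lborel. cis (x * \<xi>) * g \<xi>)"

text \<open>
  \<open>p t\<close> is the Fourier transform of a function of class \<open>H\<^sup>\<infinity>\<close>, with time continuity in every
  \<open>H\<^sup>\<sigma>\<close>. In particular \<open>p t\<close> is integrable and \<open>inv_fourier (p t)\<close> is an absolutely convergent integral.
\<close>

definition smooth_curve :: "real \<Rightarrow> (real \<Rightarrow> real \<Rightarrow> complex) \<Rightarrow> bool" where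
  "smooth_curve T p \<longleftrightarrow>
     (\<forall>\<sigma>. (\<forall>t\<in>{0..T}. in_Hs \<sigma> (p t)) \<and> continuous_on {0..T} (\<lambda>t. Hs_of \<sigma> (p t)))"

text \<open>
  The Fourier transform of the integral equation
  \<open>u(t) = U\<^sup>a(t) u(0) - \<integral>\<^sub>0\<^sup>t U\<^sup>a(t - t') \<partial>\<^sub>x N(t') dt'\<close>, where \<open>p t\<close> is the transform of \<open>u(t)\<close> and
  the nonlinearity \<open>N\<close> is given in physical space.
\<close>

definition integral_eq ::
    "real \<Rightarrow> real \<Rightarrow> (real \<Rightarrow> real \<Rightarrow> complex) \<Rightarrow> (real \<Rightarrow> real \<Rightarrow> complex) \<Rightarrow> bool" where
  "integral_eq a T p N \<longleftrightarrow>
     (\<forall>t\<in>{0..T}. AE \<xi> in lborel.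
        p t \<xi> = cis (t * a * \<xi> ^ 3) * p 0 \<xi>
          - integral {0..t} (\<lambda>t'. cis ((t - t') * a * \<xi> ^ 3) * (\<i> * of_real \<xi> * fourier (N t') \<xi>)))"

definition smooth_solution ::
    "real \<Rightarrow> real \<Rightarrow> (real \<Rightarrow> real \<Rightarrow> complex) \<Rightarrow> (real \<Rightarrow> real \<Rightarrow> complex) \<Rightarrow> bool" where
  "smooth_solution \<alpha> T p q \<longleftrightarrow>
     smooth_curve T p \<and> smooth_curve T q \<and>
     (let v = (\<lambda>t. inv_fourier (p t)); w = (\<lambda>t. inv_fourier (q t)) in
        integral_eq 1 T p (\<lambda>t x. v t x * (w t x)\<^sup>2) \<and>
        integral_eq \<alpha> T q (\<lambda>t x. (v t x)\<^sup>2 * w t x))"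

text \<open>
  For \<open>s < - 1 / 2\<close> the products \<open>v w\<^sup>2\<close> and \<open>v\<^sup>2 w\<close> of elements of \<open>H\<^sup>s\<close> have no meaning, so the integral
  equations can be written down for regular solutions only. Following Kappeler and Topalov, a curve
  in \<open>H\<^sup>s \<times> H\<^sup>s\<close> is the solution with datum \<open>(\<phi>, \<psi>)\<close> if it is the limit in \<open>C([0,T]; H\<^sup>s)\<close> of every
  sequence of smooth solutions whose data tend to \<open>(\<phi>, \<psi>)\<close> in \<open>H\<^sup>s\<close>, and such sequences exist.
  The constant sequences show that on the datum of a smooth solution it is that smooth solution.
  The set \<open>X\<close> of admissible data serves to treat real-valued and complex-valued data.
\<close>

definition smooth_approx ::
    "L2 set \<Rightarrow> real \<Rightarrow> real \<Rightarrow> real \<Rightarrow> L2 \<Rightarrow> L2 \<Rightarrow>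
     (nat \<Rightarrow> real \<Rightarrow> real \<Rightarrow> complex) \<Rightarrow> (nat \<Rightarrow> real \<Rightarrow> real \<Rightarrow> complex) \<Rightarrow> bool" where
  "smooth_approx X s \<alpha> T \<phi> \<psi> p q \<longleftrightarrow>
     (\<forall>n. smooth_solution \<alpha> T (p n) (q n) \<and> Hs_of s (p n 0) \<in> X \<and> Hs_of s (q n 0) \<in> X) \<and>
     (\<lambda>n. Hs_of s (p n 0)) \<longlonglongrightarrow> \<phi> \<and> (\<lambda>n. Hs_of s (q n 0)) \<longlonglongrightarrow> \<psi>"

definition is_solution ::
    "L2 set \<Rightarrow> real \<Rightarrow> real \<Rightarrow> real \<Rightarrow> L2 \<times> L2 \<Rightarrow> (real \<Rightarrow>\<^sub>C L2) \<times> (real \<Rightarrow>\<^sub>C L2) \<Rightarrow> bool" where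
  "is_solution X s \<alpha> T = (\<lambda>(\<phi>, \<psi>) (v, w).
     v \<in> curves T \<and> w \<in> curves T \<and>
     (\<exists>p q. smooth_approx X s \<alpha> T \<phi> \<psi> p q) \<and>
     (\<forall>p q. smooth_approx X s \<alpha> T \<phi> \<psi> p q \<longrightarrow>
        uniform_limit {0..T} (\<lambda>n t. Hs_of s (p n t)) v sequentially \<and>
        uniform_limit {0..T} (\<lambda>n t. Hs_of s (q n t)) w sequentially))"


section \<open>Regularity of the data-to-solution map\<close>

text \<open>
  \<open>f\<close>, restricted to the linear subspace \<open>A\<close>, is three times Frechet differentiable near \<open>z\<close> with
  third derivative continuous at \<open>z\<close>. This is implied by \<open>f\<close> being of class \<open>C\<^sup>3\<close> in a neighbourhood.
\<close>

definition C3_at_within ::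
    "('a::real_normed_vector \<Rightarrow> 'b::real_normed_vector) \<Rightarrow> 'a \<Rightarrow> 'a set \<Rightarrow> bool" where
  "C3_at_within f z A \<longleftrightarrow>
     (\<exists>V (D1 :: 'a \<Rightarrow> 'a \<Rightarrow>\<^sub>L 'b)
         (D2 :: 'a \<Rightarrow> 'a \<Rightarrow>\<^sub>L 'a \<Rightarrow>\<^sub>L 'b)
         (D3 :: 'a \<Rightarrow> 'a \<Rightarrow>\<^sub>L 'a \<Rightarrow>\<^sub>L 'a \<Rightarrow>\<^sub>L 'b).
        open V \<and> z \<in> V \<and>
        (\<forall>y\<in>V \<inter> A.
           (f has_derivative blinfun_apply (D1 y)) (at y within A) \<and>
           (D1 has_derivative blinfun_apply (D2 y)) (at y within A) \<and>
           (D2 has_derivative blinfun_apply (D3 y)) (at y within A)) \<and>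
        continuous (at z within A) D3)"

text \<open>
  \<open>S\<close> is the data-to-solution map on the part of a neighbourhood \<open>U\<close> of the origin that lies in
  \<open>X \<times> X\<close>; its values elsewhere are irrelevant.
\<close>

definition data_to_solution_map ::
    "L2 set \<Rightarrow> real \<Rightarrow> real \<Rightarrow> real \<Rightarrow> (L2 \<times> L2) set \<Rightarrow>
     (L2 \<times> L2 \<Rightarrow> (real \<Rightarrow>\<^sub>C L2) \<times> (real \<Rightarrow>\<^sub>C L2)) \<Rightarrow> bool" where
  "data_to_solution_map X s \<alpha> T U S \<longleftrightarrow>
     open U \<and> 0 \<in> U \<and> S 0 = 0 \<and> (\<forall>z\<in>U \<inter> X \<times> X. is_solution X s \<alpha> T z (S z))"

end

theory Submission
  imports Defs "HOL-Probability.Characteristic_Functions" "HOL-Probability.Sinc_Integral"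
begin

text \<open>
  On Fourier transforms with exponential decay the integral equations can be solved by a contraction,
  on any given time interval if the data are small enough: this is the Cauchy-Kovalevskaya argument,
  in which the loss of a derivative is absorbed by a shrinking exponential weight. Hence for such data
  \<open>h\<close> the map satisfies \<open>S (\<delta> h) = \<delta> L h + \<delta>\<^sup>3 M h + O(\<delta>\<^sup>5)\<close>, where \<open>M\<close> is the first Picard iterate, and
  \<open>C\<^sup>3\<close> regularity at the origin would bound \<open>M h\<close> by the third power of the norm of \<open>h\<close>.

  Let the transforms of \<open>\<phi>\<close> and \<open>\<psi>\<close> be tents of width \<open>\<gamma> ~ N\<^sup>-\<^sup>2\<close> at the frequencies \<open>\<plusminus> N\<close> and
  \<open>\<plusminus> 2 N\<close>. The interactions of \<open>N\<close>, \<open>2 N\<close> and \<open>- 2 N\<close> are resonant for every \<open>\<alpha>\<close>, and on this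
  width the phases do not oscillate up to time \<open>T\<close>. The component of \<open>M h\<close> near the frequency \<open>N\<close> then
  has size \<open>N\<^sup>1\<^sup>+\<^sup>s \<gamma>\<^sup>5\<^sup>/\<^sup>2\<close>, while the third power of the norm of \<open>h\<close> has size \<open>N\<^sup>3\<^sup>s \<gamma>\<^sup>3\<^sup>/\<^sup>2\<close>. The quotient
  \<open>N\<^sup>-\<^sup>1\<^sup>-\<^sup>2\<^sup>s\<close> is unbounded for \<open>s < - 1 / 2\<close>.
\<close>

section \<open>Cubic fixed points and \<open>C\<^sup>3\<close> maps\<close>

text \<open>The map \<open>S\<close> is known only where \<open>is_solution\<close> pins it down, so
  the argument needs genuine smooth solutions on the whole of [0,T] for a prescribed
  \<open>T\<close>; small analytic data supply them by a contraction alone. The expansion in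
  \<delta> is derived for each datum separately, with constants that grow exponentially in the
  frequency. This does no harm: the bound for the cubic coefficient involves only the third
  derivative at the origin, and the other constants disappear as \<delta> \<rightarrow> 0. Tents at
  N and 2N, and not both at N, isolate the resonance. With both at N, the triple (- N, N, N) would
  also reach the output N, and its resonance function 2 (1 - \<alpha>) N^3 is large. With 2N, the
  frequency of \<open>v\<close> must match the output and the two frequencies of \<open>w\<close>
  must cancel, whatever \<alpha> is. Since the tents are nonnegative, interactions with a small
  phase all push in the same direction, and a part of the frequency domain already yields the lower
  bound.\<close>

definition bdd_trilinear :: "real \<Rightarrow> ('a::real_normed_vector \<Rightarrow> 'a \<Rightarrow> 'a \<Rightarrow> 'b::real_normed_vector) \<Rightarrow> bool" where
  "bdd_trilinear M N \<longleftrightarrow>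
     (\<forall>v w. linear (\<lambda>u. N u v w)) \<and> (\<forall>u w. linear (\<lambda>v. N u v w)) \<and> (\<forall>u v. linear (\<lambda>w. N u v w)) \<and>
     (\<forall>u v w. norm (N u v w) \<le> M * norm u * norm v * norm w)"

lemma bdd_trilinear_scaleR:
  assumes "bdd_trilinear M N"
  shows "N (a *\<^sub>R u) (b *\<^sub>R v) (c *\<^sub>R w) = (a * b * c) *\<^sub>R N u v w"
proof -
  have 1: "linear (\<lambda>u. N u v w)" "linear (\<lambda>v. N u v w)" "linear (\<lambda>w. N u v w)" for u v w
    using assms by (auto simp: bdd_trilinear_def)
  show ?thesis
    using linear_scale[OF 1(1)] linear_scale[OF 1(2)] linear_scale[OF 1(3)] by simp
qed

text \<open>Telescoping: the arguments are exchanged one at a time, and each exchange costs a factor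
  d in one slot and K in the other two.\<close>

lemma bdd_trilinear_norm_diff_le:
  assumes N: "bdd_trilinear M N" and "M \<ge> 0"
    and "norm u \<le> K" "norm v \<le> K" "norm w \<le> K" "norm u' \<le> K" "norm v' \<le> K" "norm w' \<le> K"
    and "norm (u - u') \<le> d" "norm (v - v') \<le> d" "norm (w - w') \<le> d"
  shows "norm (N u v w - N u' v' w') \<le> 3 * M * K\<^sup>2 * d"
proof -
  have lin: "linear (\<lambda>u. N u v w)" "linear (\<lambda>v. N u v w)" "linear (\<lambda>w. N u v w)" for u v w
    using N by (auto simp: bdd_trilinear_def)
  have bnd: "norm (N a b c) \<le> M * norm a * norm b * norm c" for a b c
    using N by (auto simp: bdd_trilinear_def)
  have "0 \<le> K" using norm_ge_zero assms(3) by (rule order_trans)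
  have "0 \<le> d" using norm_ge_zero assms(9) by (rule order_trans)
  have "N u v w - N u' v' w' = N (u - u') v w + N u' (v - v') w + N u' v' (w - w')"
    using linear_diff[OF lin(1)] linear_diff[OF lin(2)] linear_diff[OF lin(3)] by simp
  also have "norm \<dots> \<le> norm (N (u - u') v w) + norm (N u' (v - v') w) + norm (N u' v' (w - w'))"
    by (rule order_trans[OF norm_triangle_ineq] add_right_mono norm_triangle_ineq)+
  also have "\<dots> \<le> M * d * K * K + M * K * d * K + M * K * K * d"
    by (intro add_mono order_trans[OF bnd] mult_mono) (use assms \<open>0 \<le> K\<close> \<open>0 \<le> d\<close> in auto)
  finally show ?thesis by (simp add: power2_eq_square algebra_simps)
qed

text \<open>A contraction on the ball of radius 2 \<rho>. The remainder is of fifth order because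
  the fixed point differs from (x, y) by the cubic amount 8 M \<rho>^3, and the difference bound
  multiplies this by 3 M (2 \<rho>)^2. The first component is the one that is tested later.\<close>

lemma cubic_system_solution:
  fixes N1 N2 :: "'a::{real_normed_vector, complete_space} \<Rightarrow> 'a \<Rightarrow> 'a \<Rightarrow> 'a"
  assumes N1: "bdd_trilinear M N1" and N2: "bdd_trilinear M N2" and M: "0 \<le> M"
    and x: "norm x \<le> \<rho>" and y: "norm y \<le> \<rho>" and small: "48 * M * \<rho>\<^sup>2 \<le> 1"
  shows "\<exists>u v. u = x + N1 u v v \<and> v = y + N2 u u v \<and>
           norm (u - x - N1 x y y) \<le> 96 * M\<^sup>2 * \<rho> ^ 5"
proof -
  have rho: "0 \<le> \<rho>" using norm_ge_zero x by (rule order_trans)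
  let ?B = "cball 0 (2 * \<rho>) \<times> cball 0 (2 * \<rho>) :: ('a \<times> 'a) set"
  let ?F = "\<lambda>(u, v). (x + N1 u v v, y + N2 u u v)"
  have bnd1: "norm (N1 a b c) \<le> 8 * M * \<rho> ^ 3" "norm (N2 a b c) \<le> 8 * M * \<rho> ^ 3"
    if "norm a \<le> 2 * \<rho>" "norm b \<le> 2 * \<rho>" "norm c \<le> 2 * \<rho>" for a b c
  proof -
    have "M * norm a * norm b * norm c \<le> M * (2 * \<rho>) * (2 * \<rho>) * (2 * \<rho>)"
      by (intro mult_mono) (use that M rho in auto)
    also have "\<dots> = 8 * M * \<rho> ^ 3" by (simp add: power3_eq_cube)
    finally have "M * norm a * norm b * norm c \<le> 8 * M * \<rho> ^ 3" .
    moreover have "norm (N1 a b c) \<le> M * norm a * norm b * norm c"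
        "norm (N2 a b c) \<le> M * norm a * norm b * norm c"
      using N1 N2 unfolding bdd_trilinear_def by blast+
    ultimately show "norm (N1 a b c) \<le> 8 * M * \<rho> ^ 3" "norm (N2 a b c) \<le> 8 * M * \<rho> ^ 3"
      by linarith+
  qed
  have small': "8 * M * \<rho> ^ 3 \<le> \<rho>"
  proof -
    have "8 * M * \<rho> ^ 3 = (8 * M * \<rho>\<^sup>2) * \<rho>" by (simp add: power2_eq_square power3_eq_cube)
    also have "\<dots> \<le> 1 * \<rho>" by (intro mult_right_mono) (use small rho M in auto)
    finally show ?thesis by simp
  qed
  have "\<exists>!z. z \<in> ?B \<and> ?F z = z"
  proof (rule Banach_fix[where c = "1 / 2"])
    show "complete ?B" by (intro closed_Times closed_cball complete_eq_closed[THEN iffD2])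
    show "?B \<noteq> {}" using rho by auto
    show "?F ` ?B \<subseteq> ?B"
    proof clarsimp
      fix a b :: 'a assume ab: "norm a \<le> 2 * \<rho>" "norm b \<le> 2 * \<rho>"
      show "norm (x + N1 a b b) \<le> 2 * \<rho> \<and> norm (y + N2 a a b) \<le> 2 * \<rho>"
        using norm_triangle_ineq[of x "N1 a b b"] norm_triangle_ineq[of y "N2 a a b"]
          bnd1(1)[of a b b] bnd1(2)[of a a b] ab x y small' by auto
    qed
    fix z z' assume z: "z \<in> ?B" "z' \<in> ?B"
    obtain u v u' v' where zz: "z = (u, v)" "z' = (u', v')" by (cases z, cases z')
    have b: "norm u \<le> 2 * \<rho>" "norm v \<le> 2 * \<rho>" "norm u' \<le> 2 * \<rho>" "norm v' \<le> 2 * \<rho>"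
      using z zz by auto
    have d: "norm (u - u') \<le> dist z z'" "norm (v - v') \<le> dist z z'"
      using dist_fst_le[of z z'] dist_snd_le[of z z'] by (auto simp: zz dist_norm)
    have "dist (?F z) (?F z') = norm (N1 u v v - N1 u' v' v', N2 u u v - N2 u' u' v')"
      by (simp add: zz dist_norm)
    also have "\<dots> \<le> norm (N1 u v v - N1 u' v' v') + norm (N2 u u v - N2 u' u' v')"
      by (rule norm_Pair_le)
    \<comment> \<open>Each component has Lipschitz constant 12 M \<rho>^2, and the norm of a pair is
      bounded by the sum. The 48 in the smallness condition makes the total 24 M \<rho>^2 at most 1
      / 2.\<close>
    also have "\<dots> \<le> 3 * M * (2 * \<rho>)\<^sup>2 * dist z z' + 3 * M * (2 * \<rho>)\<^sup>2 * dist z z'"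
      by (intro add_mono bdd_trilinear_norm_diff_le N1 N2 M b d)
    also have "\<dots> = (24 * M * \<rho>\<^sup>2) * dist z z'" by (simp add: power2_eq_square)
    also have "\<dots> \<le> 1 / 2 * dist z z'"
      by (intro mult_right_mono) (use small in auto)
    finally show "dist (?F z) (?F z') \<le> 1 / 2 * dist z z'" .
  qed auto
  then obtain z where z: "z \<in> ?B" "?F z = z" by blast
  obtain u v where "z = (u, v)" by (cases z)
  with z have uv: "norm u \<le> 2 * \<rho>" "norm v \<le> 2 * \<rho>" "x + N1 u v v = u" "y + N2 u u v = v"
    by auto
  have diff: "u - x = N1 u v v" "v - y = N2 u u v"
    using uv(3,4) by (simp_all add: diff_eq_eq add.commute)
  have d: "norm (u - x) \<le> 8 * M * \<rho> ^ 3" "norm (v - y) \<le> 8 * M * \<rho> ^ 3"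
    unfolding diff by (rule bnd1; rule uv)+
  have "norm (u - x - N1 x y y) = norm (N1 u v v - N1 x y y)"
    by (simp only: diff)
  also have "\<dots> \<le> 3 * M * (2 * \<rho>)\<^sup>2 * (8 * M * \<rho> ^ 3)"
    by (rule bdd_trilinear_norm_diff_le[OF N1 M]) (use uv d x y rho in auto)
  also have "\<dots> = 96 * M\<^sup>2 * \<rho> ^ 5" by (simp add: eval_nat_numeral)
  finally show ?thesis using uv(3,4) by (intro exI[of _ u] exI[of _ v]) simp
qed

text \<open>
  The third difference \<open>f (3\<delta>) - 3 f (2\<delta>) + 3 f \<delta> - f 0\<close> removes the terms of lower order, and the
  bound for the cubic coefficient depends on \<open>f\<close> only through the third derivative at the origin.
\<close>

lemma C3_at_within_cubic_coefficient:
  fixes f :: "'a::real_normed_vector \<Rightarrow> 'b::real_normed_vector"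
  assumes C3: "C3_at_within f 0 A" and A: "\<And>c h. h \<in> A \<Longrightarrow> c *\<^sub>R h \<in> A"
  obtains C where "0 \<le> C"
    "\<And>h l L a b c \<delta>\<^sub>0. h \<in> A \<Longrightarrow> bounded_linear l \<Longrightarrow> 0 \<le> L \<Longrightarrow> (\<And>x. \<bar>l x\<bar> \<le> L * norm x) \<Longrightarrow> 0 < \<delta>\<^sub>0 \<Longrightarrow>
      (\<And>\<delta>. 0 \<le> \<delta> \<Longrightarrow> \<delta> \<le> \<delta>\<^sub>0 \<Longrightarrow> \<bar>l (f (\<delta> *\<^sub>R h)) - \<delta> * a - \<delta> ^ 3 * b\<bar> \<le> c * \<delta> ^ 5) \<Longrightarrow>
      \<bar>b\<bar> \<le> C * L * norm h ^ 3"
proof -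
  obtain V D1 D2 D3 where V: "open V" "0 \<in> V" and
    D: "\<And>y. y \<in> V \<inter> A \<Longrightarrow> (f has_derivative blinfun_apply (D1 y)) (at y within A)"
       "\<And>y. y \<in> V \<inter> A \<Longrightarrow> (D1 has_derivative blinfun_apply (D2 y)) (at y within A)"
       "\<And>y. y \<in> V \<inter> A \<Longrightarrow> (D2 has_derivative blinfun_apply (D3 y)) (at y within A)" and
    cont: "continuous (at 0 within A) D3"
    using C3 unfolding C3_at_within_def by blast
  obtain r where r: "0 < r" "ball 0 r \<subseteq> V" using V open_contains_ball by blast
  obtain r' where r': "0 < r'" "\<And>y. y \<in> A \<Longrightarrow> norm y < r' \<Longrightarrow> norm (D3 y - D3 0) < 1"
    using cont unfolding continuous_within_eps_delta by (auto simp: dist_norm dest: spec[of _ 1])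
  define d where "d = min r r'"
  \<comment> \<open>Continuity of the third derivative at the single point 0 bounds it by this K on
    a small ball within A.\<close>
  define K where "K = norm (D3 0) + 1"
  have d: "0 < d" using r r' by (auto simp: d_def)
  have K0: "0 \<le> K" by (simp add: K_def)
  have dV: "y \<in> V" if "norm y < d" for y using that r by (auto simp: d_def)
  have dK: "norm (D3 y) \<le> K" if "y \<in> A" "norm y < d" for y
    using r'(2)[of y] that norm_triangle_sub[of "D3 y" "D3 0"] by (auto simp: d_def K_def)
  show ?thesis
  proof
    show "0 \<le> 3 / 2 * K" using K0 by simp
    fix h :: 'a and l :: "'b \<Rightarrow> real" and L a b c \<delta>\<^sub>0 :: real
    assume h: "h \<in> A" and l: "bounded_linear l" and L0: "0 \<le> L" and L: "\<And>x. \<bar>l x\<bar> \<le> L * norm x" and \<delta>0: "0 < \<delta>\<^sub>0"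
      and approx: "\<And>\<delta>. 0 \<le> \<delta> \<Longrightarrow> \<delta> \<le> \<delta>\<^sub>0 \<Longrightarrow> \<bar>l (f (\<delta> *\<^sub>R h)) - \<delta> * a - \<delta> ^ 3 * b\<bar> \<le> c * \<delta> ^ 5"
    \<comment> \<open>\<open>g m\<close> is the m-th derivative of t \<mapsto> l (f (t h)), indexed
      as Maclaurin's formula expects it.\<close>
    define g where "g = (\<lambda>m t. if m = (0::nat) then l (f (t *\<^sub>R h)) else if m = 1 then l (D1 (t *\<^sub>R h) h)
      else if m = 2 then l (D2 (t *\<^sub>R h) h h) else l (D3 (t *\<^sub>R h) h h h))"
    have gs: "g 0 = (\<lambda>t. l (f (t *\<^sub>R h)))" "g 1 = (\<lambda>t. l (D1 (t *\<^sub>R h) h))"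
      "g 2 = (\<lambda>t. l (D2 (t *\<^sub>R h) h h))" "g 3 = (\<lambda>t. l (D3 (t *\<^sub>R h) h h h))"
      by (simp_all add: g_def)
    define B where "B = K * L * norm h ^ 3"
    have line: "((\<lambda>t. t *\<^sub>R h) has_derivative (\<lambda>t. t *\<^sub>R h)) (at t)" for t :: real
      by (auto intro!: derivative_eq_intros)
    \<comment> \<open>A is invariant under scaling, so the line through h stays in A and a
      derivative within A becomes an ordinary derivative along this line.\<close>
    have comp: "((\<lambda>t. G (t *\<^sub>R h)) has_derivative (\<lambda>s. G' (s *\<^sub>R h))) (at t)"
      if "(G has_derivative G') (at (t *\<^sub>R h) within A)" for G :: "'a \<Rightarrow> 'c::real_normed_vector" and G' and t :: real
      by (rule has_derivative_in_compose[OF line has_derivative_subset[OF that]]) (use A[OF h] in auto)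
    have der: "DERIV (g m) t :> g (Suc m) t" if "m < 3" "\<bar>t\<bar> * norm h < d" for m t
    proof -
      have y: "t *\<^sub>R h \<in> V \<inter> A" using that dV[of "t *\<^sub>R h"] A[OF h] by auto
      have 0: "DERIV (g 0) t :> g 1 t"
      proof -
        have "((\<lambda>t. l (f (t *\<^sub>R h))) has_derivative (\<lambda>s. l (D1 (t *\<^sub>R h) (s *\<^sub>R h)))) (at t)"
          by (intro bounded_linear.has_derivative[OF l] comp D y)
        then show ?thesis
          unfolding has_field_derivative_def gs
          by (rule has_derivative_eq_rhs)
            (auto simp: fun_eq_iff blinfun.bilinear_simps linear_simps[OF l] mult.commute)
      qed
      have 1: "DERIV (g 1) t :> g 2 t"
      proof -
        have "((\<lambda>t. l (D1 (t *\<^sub>R h) h)) has_derivative (\<lambda>s. l (D2 (t *\<^sub>R h) (s *\<^sub>R h) h))) (at t)"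
          by (intro bounded_linear.has_derivative[OF l] bounded_linear.has_derivative[OF blinfun.bounded_linear_left] comp D y)
        then show ?thesis
          unfolding has_field_derivative_def gs
          by (rule has_derivative_eq_rhs)
            (auto simp: fun_eq_iff blinfun.bilinear_simps linear_simps[OF l] mult.commute)
      qed
      have 2: "DERIV (g 2) t :> g 3 t"
      proof -
        have "((\<lambda>t. l (D2 (t *\<^sub>R h) h h)) has_derivative (\<lambda>s. l (D3 (t *\<^sub>R h) (s *\<^sub>R h) h h))) (at t)"
          by (intro bounded_linear.has_derivative[OF l] bounded_linear.has_derivative[OF blinfun.bounded_linear_left] comp D y)
        then show ?thesis
          unfolding has_field_derivative_def gs
          by (rule has_derivative_eq_rhs)
            (auto simp: fun_eq_iff blinfun.bilinear_simps linear_simps[OF l] mult.commute)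
      qed
      from that(1) consider "m = 0" | "m = 1" | "m = 2" by linarith
      then show ?thesis using 0 1 2 by cases (auto simp: numeral_eq_Suc)
    qed
    have g3: "\<bar>g 3 t\<bar> \<le> B" if "\<bar>t\<bar> * norm h < d" for t
    proof -
      have **: "\<bar>g 3 t\<bar> \<le> L * norm (D3 (t *\<^sub>R h) h h h)" by (simp add: g_def L)
      have "norm (D3 (t *\<^sub>R h) h h h) \<le> norm (D3 (t *\<^sub>R h)) * norm h * norm h * norm h"
        by (intro order_trans[OF norm_blinfun] mult_right_mono) auto
      also have "\<dots> \<le> K * norm h * norm h * norm h"
        by (intro mult_right_mono dK) (use that A[OF h] in auto)
      finally have *: "norm (D3 (t *\<^sub>R h) h h h) \<le> K * norm h * norm h * norm h" .
      show ?thesis using ** mult_left_mono[OF * L0] by (simp add: B_def power3_eq_cube mult_ac)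
    qed
    have tay: "\<bar>g 0 t - (g 0 0 + g 1 0 * t + g 2 0 / 2 * t\<^sup>2)\<bar> \<le> B / 6 * t ^ 3"
      if t: "0 < t" "t * norm h < d" for t
    proof -
      have *: "\<bar>u\<bar> * norm h < d" if "0 \<le> u" "u \<le> t" for u
        using that t mult_right_mono[of u t "norm h"] by auto
      obtain u where u: "0 < u" "u < t"
        and eq: "g 0 t = (\<Sum>m<3. g m 0 / fact m * t ^ m) + g 3 u / fact 3 * t ^ 3"
      proof -
        have "\<forall>m u. m < 3 \<and> 0 \<le> u \<and> u \<le> t \<longrightarrow> DERIV (g m) u :> g (Suc m) u"
          by (intro allI impI der) (use * in auto)
        from Maclaurin[OF t(1) _ refl this] show thesis
          using that by auto
      qed
      have "g 0 t - (g 0 0 + g 1 0 * t + g 2 0 / 2 * t\<^sup>2) = g 3 u / 6 * t ^ 3"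
        using eq by (simp add: numeral_eq_Suc)
      also have "\<bar>\<dots>\<bar> = \<bar>g 3 u\<bar> / 6 * t ^ 3"
        using t by (simp add: abs_mult)
      also have "\<dots> \<le> B / 6 * t ^ 3"
        by (intro mult_right_mono divide_right_mono g3 *) (use u t in auto)
      finally show ?thesis .
    qed
    \<comment> \<open>The third difference annihilates polynomials of degree at most 2 and gives 27
      - 24 + 3 = 6 on the cube. The Taylor remainders add up to (27 + 24 + 3) B / 6 = 9 B, the
      errors of the expansion to 243 + 96 + 3 = 342 times c.\<close>
    have main: "6 * \<bar>b\<bar> \<le> 9 * B + 342 * c * \<delta>\<^sup>2" if \<delta>: "0 < \<delta>" "3 * \<delta> \<le> \<delta>\<^sub>0" "3 * \<delta> * norm h < d" for \<delta>
    proof -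
      have "0 \<le> \<delta> * norm h" using \<delta> by simp
      then have hn: "\<delta> * norm h < d" "2 * \<delta> * norm h < d" using \<delta>(3) by linarith+
      have t: "\<bar>g 0 \<delta> - (g 0 0 + g 1 0 * \<delta> + g 2 0 / 2 * \<delta>\<^sup>2)\<bar> \<le> B / 6 * \<delta> ^ 3"
          "\<bar>g 0 (2*\<delta>) - (g 0 0 + g 1 0 * (2*\<delta>) + g 2 0 / 2 * (2*\<delta>)\<^sup>2)\<bar> \<le> B / 6 * (2*\<delta>) ^ 3"
          "\<bar>g 0 (3*\<delta>) - (g 0 0 + g 1 0 * (3*\<delta>) + g 2 0 / 2 * (3*\<delta>)\<^sup>2)\<bar> \<le> B / 6 * (3*\<delta>) ^ 3"
        by (rule tay; use \<delta> hn in linarith)+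
      have a: "\<bar>g 0 0\<bar> \<le> 0"
          "\<bar>g 0 \<delta> - \<delta> * a - \<delta> ^ 3 * b\<bar> \<le> c * \<delta> ^ 5"
          "\<bar>g 0 (2*\<delta>) - (2*\<delta>) * a - (2*\<delta>) ^ 3 * b\<bar> \<le> c * (2*\<delta>) ^ 5"
          "\<bar>g 0 (3*\<delta>) - (3*\<delta>) * a - (3*\<delta>) ^ 3 * b\<bar> \<le> c * (3*\<delta>) ^ 5"
        using approx[of 0] approx[of \<delta>] approx[of "2*\<delta>"] approx[of "3*\<delta>"] \<delta> \<delta>0 by (simp_all add: g_def)
      have pw: "(2*\<delta>)\<^sup>2 = 4 * \<delta>\<^sup>2" "(3*\<delta>)\<^sup>2 = 9 * \<delta>\<^sup>2" "(2*\<delta>)^3 = 8 * \<delta>^3" "(3*\<delta>)^3 = 27 * \<delta>^3"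
          "(2*\<delta>)^5 = 32 * \<delta>^5" "(3*\<delta>)^5 = 243 * \<delta>^5"
        by (simp_all add: power_mult_distrib)
      have "\<bar>6 * (\<delta> ^ 3 * b)\<bar> \<le> 9 * (B * \<delta> ^ 3) + 342 * (c * \<delta> ^ 5)"
        using t[THEN abs_le_D1] t[THEN abs_le_D2] a[THEN abs_le_D1] a[THEN abs_le_D2]
        unfolding pw by (intro abs_leI; linarith)
      moreover have "\<bar>6 * (\<delta> ^ 3 * b)\<bar> = \<delta> ^ 3 * (6 * \<bar>b\<bar>)" using \<delta> by (simp add: abs_mult)
      moreover have "9 * (B * \<delta> ^ 3) + 342 * (c * \<delta> ^ 5) = \<delta> ^ 3 * (9 * B + 342 * c * \<delta>\<^sup>2)"
        by (simp add: eval_nat_numeral algebra_simps)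
      ultimately have "\<delta> ^ 3 * (6 * \<bar>b\<bar>) \<le> \<delta> ^ 3 * (9 * B + 342 * c * \<delta>\<^sup>2)" by simp
      then show ?thesis using \<delta> by simp
    qed
    \<comment> \<open>The limit \<delta> \<rightarrow> 0 removes c, which may depend on h in any
      way.\<close>
    have "6 * \<bar>b\<bar> \<le> 9 * B"
    proof (rule tendsto_lowerbound[where F = "at_right 0"])
      have "((\<lambda>\<delta>. 9 * B + 342 * c * \<delta>\<^sup>2) \<longlongrightarrow> 9 * B + 342 * c * 0\<^sup>2) (at_right 0)"
        by (intro tendsto_intros)
      then show "((\<lambda>\<delta>. 9 * B + 342 * c * \<delta>\<^sup>2) \<longlongrightarrow> 9 * B) (at_right 0)" by simp
      have "((\<lambda>\<delta>. 3 * \<delta> * norm h) \<longlongrightarrow> 3 * 0 * norm h) (at_right 0)" "((\<lambda>\<delta>. 3 * \<delta>) \<longlongrightarrow> 3 * (0::real)) (at_right 0)"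
        by (intro tendsto_intros)+
      then have "\<forall>\<^sub>F \<delta> in at_right 0. 3 * \<delta> * norm h < d" "\<forall>\<^sub>F \<delta> in at_right 0. 3 * \<delta> < \<delta>\<^sub>0"
        using d \<delta>0 by (auto intro: order_tendstoD)
      then show "\<forall>\<^sub>F \<delta> in at_right 0. 6 * \<bar>b\<bar> \<le> 9 * B + 342 * c * \<delta>\<^sup>2"
        using eventually_at_right_less[of 0] by eventually_elim (auto intro: main)
    qed simp
    then show "\<bar>b\<bar> \<le> 3 / 2 * K * L * norm h ^ 3" by (simp add: B_def)
  qed
qed

section \<open>Functions with quadratic decay and the space \<open>L2\<close>\<close>

text \<open>The profile of the Poisson kernel: integrable with a known integral, and reproduced up
  to a constant by convolution, see \<open>decay_mult_le\<close>. It lets weighted supremum norms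
  control integrals over the whole line.\<close>

definition decay :: "real \<Rightarrow> real" where
  "decay x = 1 / (1 + x\<^sup>2)"

lemma decay_pos: "0 < decay x"
  by (simp add: decay_def add_pos_nonneg)

lemma decay_le_1: "decay x \<le> 1"
  by (simp add: decay_def divide_le_eq_1 add_pos_nonneg)

lemma decay_minus [simp]: "decay (- x) = decay x"
  by (simp add: decay_def)

lemma continuous_on_decay [continuous_intros]:
  assumes "continuous_on A f"
  shows "continuous_on A (\<lambda>x. decay (f x))"
  unfolding decay_def
  by (intro continuous_intros assms ballI) (metis add_pos_nonneg less_irrefl zero_le_power2 zero_less_one)

lemma borel_measurable_decay [measurable]: "decay \<in> borel_measurable borel"
  unfolding decay_def by measurable

lemma integrable_decay: "integrable lborel decay"
  and integral_decay: "(LINT x|lborel. decay x) = pi"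
proof -
  have 1: "decay = (\<lambda>x. inverse (1 + x\<^sup>2))" by (simp add: fun_eq_iff decay_def divide_inverse)
  show "integrable lborel decay"
    using integrable_inverse_1_plus_square
    by (simp add: 1 set_integrable_def einterval_def)
  show "(LINT x|lborel. decay x) = pi"
    using LBINT_inverse_1_plus_square
    by (simp add: 1 interval_lebesgue_integral_def set_lebesgue_integral_def einterval_def)
qed

lemma powr_unbounded:
  fixes a K :: real
  assumes "0 < a"
  obtains N where "1 \<le> N" "K < N powr a"
proof
  let ?M = "max 1 (K + 1)"
  show "1 \<le> ?M powr (1 / a)"
    using assms by (intro ge_one_powr_ge_zero) auto
  show "K < (?M powr (1 / a)) powr a"
    using assms by (simp add: powr_powr)
qed

lemma powr_times_exp_bounded:
  obtains K :: real where "0 \<le> K" "\<And>x. 0 \<le> x \<Longrightarrow> (1 + x) powr s * exp (- x) \<le> K"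
proof (cases "s \<le> 0")
  case True
  have "(1 + x) powr s * exp (- x) \<le> 1 * 1" if "0 \<le> x" for x
    using that True powr_mono[of s 0 "1 + x"] by (intro mult_mono) auto
  then show thesis by (intro that[of 1]) simp_all
next
  case False
  \<comment> \<open>The logarithm lies below its tangent at s; the constant is the value of the left
    side at 1 + x = s.\<close>
  have "(1 + x) powr s * exp (- x) \<le> exp (s * ln s + 1 - s)" if "0 \<le> x" for x
  proof -
    have "s * ln (1 + x) = s * ln s + s * ln ((1 + x) / s)"
      using that False by (simp add: ln_div algebra_simps)
    also have "\<dots> \<le> s * ln s + s * ((1 + x) / s - 1)"
      using that False by (intro add_left_mono mult_left_mono ln_le_minus_one) auto
    also have "\<dots> = s * ln s + 1 + x - s" using False by (simp add: field_simps)
    finally show ?thesis using that by (simp add: powr_def flip: exp_add)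
  qed
  then show thesis by (rule that[rotated]) simp_all
qed

section \<open>Representatives in \<open>L2\<close> and real-valued data\<close>

lemma inner_abs_L2:
  assumes "sq_int f" "sq_int g"
  shows "inner (abs_L2 f) (abs_L2 g) = (LINT x|lborel. f x \<bullet> g x)"
  by (rule inner_L2.abs_eq) (use assms in auto)

lemma norm_abs_L2:
  assumes "sq_int f"
  shows "(norm (abs_L2 f))\<^sup>2 = (LINT x|lborel. (cmod (f x))\<^sup>2)"
  by (simp add: power2_norm_eq_inner inner_abs_L2 assms)

lemma rep_abs_L2:
  assumes "sq_int f"
  shows "AE x in lborel. rep_L2 (abs_L2 f) x = f x"
  using Quotient3_rep_abs[OF Quotient3_L2, of f] assms by auto

lemma sq_int_bound:
  assumes "f \<in> borel_measurable lborel" "integrable lborel g" "\<And>x. (cmod (f x))\<^sup>2 \<le> g x"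
  shows "sq_int f"
  unfolding sq_int_def
  by (intro conjI assms Bochner_Integration.integrable_bound[OF assms(2)])
    (use assms in \<open>auto intro!: order_trans[OF assms(3)]\<close>)

lemma weight_diff: "weight s (\<lambda>\<xi>. f \<xi> - g \<xi>) = (\<lambda>\<xi>. weight s f \<xi> - weight s g \<xi>)"
  and weight_add: "weight s (\<lambda>\<xi>. f \<xi> + g \<xi>) = (\<lambda>\<xi>. weight s f \<xi> + weight s g \<xi>)"
  and weight_scaleR: "weight s (\<lambda>\<xi>. c *\<^sub>R f \<xi>) = (\<lambda>\<xi>. c *\<^sub>R weight s f \<xi>)"
  by (auto simp: weight_def fun_eq_iff algebra_simps)

lemma Hs_of_add: "in_Hs s f \<Longrightarrow> in_Hs s g \<Longrightarrow> Hs_of s (\<lambda>\<xi>. f \<xi> + g \<xi>) = Hs_of s f + Hs_of s g"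
  unfolding Hs_of_def weight_add in_Hs_def by (intro plus_L2.abs_eq[symmetric]) auto

lemma Hs_of_diff: "in_Hs s f \<Longrightarrow> in_Hs s g \<Longrightarrow> Hs_of s (\<lambda>\<xi>. f \<xi> - g \<xi>) = Hs_of s f - Hs_of s g"
  unfolding Hs_of_def weight_diff in_Hs_def by (intro minus_L2.abs_eq[symmetric]) auto

lemma Hs_of_scaleR: "in_Hs s f \<Longrightarrow> Hs_of s (\<lambda>\<xi>. c *\<^sub>R f \<xi>) = c *\<^sub>R Hs_of s f"
  unfolding Hs_of_def weight_scaleR in_Hs_def by (intro scaleR_L2.abs_eq[symmetric]) auto

text \<open>A Hermitian identity links the points \<xi> and - \<xi> of an arbitrary representative,
  so exceptional null sets have to be reflected as well.\<close>

lemma AE_lborel_uminus: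
  fixes P :: "real \<Rightarrow> bool"
  assumes "AE x in lborel. P x"
  shows "AE x in lborel. P (- x)"
proof -
  have "AE x in distr lborel borel uminus. P x"
    using assms by (simp only: lborel_distr_uminus)
  then show ?thesis by (rule AE_distrD[rotated]) simp
qed

lemma real_valued_scaleR:
  assumes "u \<in> real_valued"
  shows "c *\<^sub>R u \<in> real_valued"
proof -
  have u: "sq_int (rep_L2 u)" "abs_L2 (rep_L2 u) = u"
    using Quotient3_rep_reflp[OF Quotient3_L2] Quotient3_abs_rep[OF Quotient3_L2] by auto
  have "c *\<^sub>R u = abs_L2 (\<lambda>\<xi>. c *\<^sub>R rep_L2 u \<xi>)"
    using scaleR_L2.abs_eq[of "rep_L2 u" c] u by simp
  then have 1: "AE \<xi> in lborel. rep_L2 (c *\<^sub>R u) \<xi> = c *\<^sub>R rep_L2 u \<xi>"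
    using rep_abs_L2[OF sq_int_scaleR[OF u(1)]] by simp
  have 2: "AE \<xi> in lborel. rep_L2 u (- \<xi>) = cnj (rep_L2 u \<xi>)"
    using assms by (simp add: real_valued_def)
  from 1 2 AE_lborel_uminus[OF 1] have "AE \<xi> in lborel. rep_L2 (c *\<^sub>R u) (- \<xi>) = cnj (rep_L2 (c *\<^sub>R u) \<xi>)"
    by eventually_elim simp
  then show ?thesis by (simp add: real_valued_def)
qed

lemma Hs_of_real_valued:
  assumes "in_Hs s f" "\<And>\<xi>. f (- \<xi>) = cnj (f \<xi>)"
  shows "Hs_of s f \<in> real_valued"
proof -
  let ?u = "rep_L2 (Hs_of s f)"
  have 1: "AE \<xi> in lborel. ?u \<xi> = weight s f \<xi>"
    unfolding Hs_of_def using assms(1) by (intro rep_abs_L2) (simp add: in_Hs_def)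
  from AE_lborel_uminus[OF 1] have 2: "AE \<xi> in lborel. ?u (- \<xi>) = weight s f (- \<xi>)" .
  from 1 2 have "AE \<xi> in lborel. ?u (- \<xi>) = cnj (?u \<xi>)"
    by eventually_elim (simp add: weight_def assms(2))
  then show ?thesis by (simp add: real_valued_def)
qed

text \<open>The exponential absorbs Sobolev weights of any order, and the square of
  \<open>decay\<close> is still integrable. C depends on s alone, so the weighted supremum norm
  dominates the norm of H^s.\<close>

lemma Hs_of_exp_decay:
  obtains C where "0 \<le> C"
    "\<And>f A. f \<in> borel_measurable borel \<Longrightarrow> 0 \<le> A \<Longrightarrow> (\<And>\<xi>. cmod (f \<xi>) \<le> A * exp (- \<bar>\<xi>\<bar>) * decay \<xi>) \<Longrightarrow> in_Hs s f"
    "\<And>f A. f \<in> borel_measurable borel \<Longrightarrow> 0 \<le> A \<Longrightarrow> (\<And>\<xi>. cmod (f \<xi>) \<le> A * exp (- \<bar>\<xi>\<bar>) * decay \<xi>) \<Longrightarrow> norm (Hs_of s f) \<le> C * A"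
proof -
  obtain K where K: "0 \<le> K" "\<And>x. 0 \<le> x \<Longrightarrow> (1 + x) powr s * exp (- x) \<le> K"
    using powr_times_exp_bounded by blast
  have *: "(cmod (weight s f \<xi>))\<^sup>2 \<le> (A * K)\<^sup>2 * decay \<xi>"
    if f: "\<And>\<xi>. cmod (f \<xi>) \<le> A * exp (- \<bar>\<xi>\<bar>) * decay \<xi>" and A: "0 \<le> A" for f A \<xi>
  proof -
    have "cmod (weight s f \<xi>) = (1 + \<bar>\<xi>\<bar>) powr s * cmod (f \<xi>)"
      by (simp add: weight_def norm_mult)
    also have "\<dots> \<le> (1 + \<bar>\<xi>\<bar>) powr s * (A * exp (- \<bar>\<xi>\<bar>) * decay \<xi>)"
      by (intro mult_left_mono f) auto
    also have "\<dots> = A * decay \<xi> * ((1 + \<bar>\<xi>\<bar>) powr s * exp (- \<bar>\<xi>\<bar>))" by simp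
    also have "\<dots> \<le> A * decay \<xi> * K"
      using A decay_pos[of \<xi>] by (intro mult_left_mono K) auto
    finally have "(cmod (weight s f \<xi>))\<^sup>2 \<le> (A * decay \<xi> * K)\<^sup>2"
      by (intro power_mono) auto
    also have "\<dots> = (A * K)\<^sup>2 * (decay \<xi>)\<^sup>2" by (simp add: power_mult_distrib)
    also have "\<dots> \<le> (A * K)\<^sup>2 * decay \<xi>"
      using decay_pos[of \<xi>] decay_le_1[of \<xi>]
      by (intro mult_left_mono) (auto simp: power2_eq_square intro: mult_left_le)
    finally show ?thesis .
  qed
  have int: "integrable lborel (\<lambda>\<xi>. c * decay \<xi>)" for c :: real
    by (intro integrable_mult_right integrable_decay)
  have sq: "sq_int (weight s f)" if "f \<in> borel_measurable borel" "0 \<le> A"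
    "\<And>\<xi>. cmod (f \<xi>) \<le> A * exp (- \<bar>\<xi>\<bar>) * decay \<xi>" for f A
    by (rule sq_int_bound[OF _ int *[of f A]]) (use that in \<open>auto simp: weight_def[abs_def]\<close>)
  show thesis
  proof (rule that)
    show "0 \<le> K * sqrt pi" using K by simp
    fix f A assume f: "f \<in> borel_measurable borel" "0 \<le> A" "\<And>\<xi>. cmod (f \<xi>) \<le> A * exp (- \<bar>\<xi>\<bar>) * decay \<xi>"
    show "in_Hs s f" unfolding in_Hs_def by (rule sq[OF f])
    have "(norm (Hs_of s f))\<^sup>2 = (LINT \<xi>|lborel. (cmod (weight s f \<xi>))\<^sup>2)"
      unfolding Hs_of_def by (rule norm_abs_L2[OF sq[OF f]])
    also have "\<dots> \<le> (LINT \<xi>|lborel. (A * K)\<^sup>2 * decay \<xi>)"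
      using sq[OF f] by (intro integral_mono int * f) (auto simp: sq_int_def)
    also have "\<dots> = (A * K)\<^sup>2 * pi"
      by (simp add: integral_decay)
    also have "\<dots> = (K * sqrt pi * A)\<^sup>2" by (simp add: power_mult_distrib)
    finally show "norm (Hs_of s f) \<le> K * sqrt pi * A"
      by (rule power2_le_imp_le) (use K f in auto)
  qed
qed

section \<open>Fourier inversion\<close>

lemma integrable_lborel_shift:
  fixes f :: "real \<Rightarrow> 'a::{banach, second_countable_topology}"
  shows "integrable lborel f \<Longrightarrow> integrable lborel (\<lambda>x. f (x - c))"
  and integral_lborel_shift: "(LINT x|lborel. f (x - c)) = (LINT x|lborel. f x)"
  using lborel_integrable_real_affine[of f 1 "- c"] lborel_integral_real_affine[of 1 f "- c"]
  by simp_all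

lemma integrable_lborel_reflect:
  fixes f :: "real \<Rightarrow> 'a::{banach, second_countable_topology}"
  shows "integrable lborel f \<Longrightarrow> integrable lborel (\<lambda>x. f (c - x))"
  and integral_lborel_reflect: "(LINT x|lborel. f (c - x)) = (LINT x|lborel. f x)"
  using lborel_integrable_real_affine[of f "- 1" c] lborel_integral_real_affine[of "- 1" f c]
  by simp_all

lemma integrable_lborel_pair_mult:
  fixes a b :: "real \<Rightarrow> real"
  assumes "integrable lborel a" "integrable lborel b"
  shows "integrable (lborel \<Otimes>\<^sub>M lborel) (\<lambda>(x, y). a x * b y)"
proof (rule lborel_pair.Fubini_integrable)
  have [measurable]: "a \<in> borel_measurable borel" "b \<in> borel_measurable borel"
    using assms by (auto dest: borel_measurable_integrable)
  show "(\<lambda>(x, y). a x * b y) \<in> borel_measurable (lborel \<Otimes>\<^sub>M lborel)" by measurable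
  show "integrable lborel (\<lambda>x. \<integral>y. norm ((\<lambda>(x, y). a x * b y) (x, y)) \<partial>lborel)"
    using assms by (simp add: abs_mult)
qed (use assms in auto)

lemma borel_measurable_cis [measurable]: "cis \<in> borel_measurable borel"
  by (intro borel_measurable_continuous_onI continuous_intros)

text \<open>Rescaling reduces this to the characteristic function of the standard normal
  distribution.\<close>

lemma integral_gaussian_cis:
  assumes "0 < \<sigma>"
  shows "(LINT x|lborel. exp (- (\<sigma> * x)\<^sup>2 / 2) *\<^sub>R cis (x * y))
    = of_real (sqrt (2 * pi) / \<sigma> * exp (- (y / \<sigma>)\<^sup>2 / 2))"
    and "integrable lborel (\<lambda>x. exp (- (\<sigma> * x)\<^sup>2 / 2))"
proof -
  have eq: "exp (- x\<^sup>2 / 2) = sqrt (2 * pi) * std_normal_density x" for x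
    by (simp add: std_normal_density_def)
  have "(LINT x|lborel. exp (- (\<sigma> * x)\<^sup>2 / 2) *\<^sub>R cis (x * y))
      = (1 / \<sigma>) *\<^sub>R (LINT x|lborel. exp (- x\<^sup>2 / 2) *\<^sub>R cis (x * (y / \<sigma>)))"
    using assms by (subst lborel_integral_real_affine[of \<sigma> "\<lambda>x. exp (- x\<^sup>2 / 2) *\<^sub>R cis (x * (y / \<sigma>))" 0]) auto
  also have "(LINT x|lborel. exp (- x\<^sup>2 / 2) *\<^sub>R cis (x * (y / \<sigma>)))
      = sqrt (2 * pi) *\<^sub>R (LINT x|lborel. std_normal_density x *\<^sub>R cis (x * (y / \<sigma>)))"
    unfolding eq by (simp flip: integral_scaleR_right)
  also have "(LINT x|lborel. std_normal_density x *\<^sub>R cis (x * (y / \<sigma>))) = char std_normal_distribution (y / \<sigma>)"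
    unfolding char_def by (subst integral_density) (auto simp: cis_conv_exp mult_ac)
  finally show "(LINT x|lborel. exp (- (\<sigma> * x)\<^sup>2 / 2) *\<^sub>R cis (x * y))
    = of_real (sqrt (2 * pi) / \<sigma> * exp (- (y / \<sigma>)\<^sup>2 / 2))"
    by (simp add: char_std_normal_distribution scaleR_conv_of_real)
  have "integrable lborel (\<lambda>x. exp (- x\<^sup>2 / 2) :: real)"
    unfolding eq by (intro integrable_mult_right integrable_normal_density) auto
  from lborel_integrable_real_affine[OF this, of \<sigma> 0]
  show "integrable lborel (\<lambda>x. exp (- (\<sigma> * x)\<^sup>2 / 2))" using assms by simp
qed

lemma cmod_inv_fourier_le:
  "cmod (inv_fourier K x) \<le> 1 / (2 * pi) * (LINT \<xi>|lborel. cmod (K \<xi>))"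
proof -
  have "cmod (LINT \<xi>|lborel. cis (x * \<xi>) * K \<xi>) \<le> (LINT \<xi>|lborel. cmod (cis (x * \<xi>) * K \<xi>))"
    by (rule integral_norm_bound)
  then show ?thesis
    unfolding inv_fourier_def by (simp add: norm_mult norm_divide divide_right_mono)
qed

lemma borel_measurable_inv_fourier [measurable]:
  assumes [measurable]: "K \<in> borel_measurable borel"
  shows "inv_fourier K \<in> borel_measurable borel"
  unfolding inv_fourier_def by measurable

text \<open>The Gaussian factor makes the double integral absolutely convergent, so that the order
  of integration may be exchanged. What remains is an average of K against a Gaussian of width
  \<sigma>, an approximate identity.\<close>

lemma gaussian_average_inv_fourier:
  assumes K: "integrable lborel K" and \<sigma>: "0 < \<sigma>"
  shows "(LINT x|lborel. exp (- (\<sigma> * x)\<^sup>2 / 2) *\<^sub>R (cis (- (x * \<xi>)) * inv_fourier K x))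
    = (LINT y|lborel. std_normal_density y *\<^sub>R K (\<xi> + \<sigma> * y))"
proof -
  have [measurable]: "K \<in> borel_measurable borel"
    using K by (auto dest: borel_measurable_integrable)
  let ?c = "1 / (2 * pi) :: real"
  let ?g = "\<lambda>x. exp (- (\<sigma> * x)\<^sup>2 / 2) :: real"
  let ?F = "\<lambda>x \<eta>. ?c *\<^sub>R ?g x *\<^sub>R cis (x * (\<eta> - \<xi>)) * K \<eta>"
  have intF: "integrable (lborel \<Otimes>\<^sub>M lborel) (case_prod ?F)"
  proof (rule Bochner_Integration.integrable_bound)
    show "integrable (lborel \<Otimes>\<^sub>M lborel) (\<lambda>(x, y). (?c * ?g x) * cmod (K y))"
      by (intro integrable_lborel_pair_mult integrable_mult_right integral_gaussian_cis \<sigma> integrable_norm K)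
  qed (auto simp: norm_mult)
  have "(LINT x|lborel. ?g x *\<^sub>R (cis (- (x * \<xi>)) * inv_fourier K x)) = (LINT x|lborel. LINT \<eta>|lborel. ?F x \<eta>)"
  proof (rule Bochner_Integration.integral_cong[OF refl])
    fix x
    have "?g x *\<^sub>R (cis (- (x * \<xi>)) * inv_fourier K x)
      = (of_real (?g x) * cis (- (x * \<xi>)) * of_real ?c) * (LINT \<eta>|lborel. cis (x * \<eta>) * K \<eta>)"
      unfolding inv_fourier_def by (simp only: scaleR_conv_of_real mult.assoc)
    also have "\<dots> = (LINT \<eta>|lborel. (of_real (?g x) * cis (- (x * \<xi>)) * of_real ?c) * (cis (x * \<eta>) * K \<eta>))"
      by (rule integral_mult_right_zero[symmetric])
    also have "\<dots> = (LINT \<eta>|lborel. ?F x \<eta>)"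
    proof (rule Bochner_Integration.integral_cong[OF refl])
      fix \<eta>
      have "cis (x * (\<eta> - \<xi>)) = cis (- (x * \<xi>)) * cis (x * \<eta>)"
        by (simp add: cis_mult right_diff_distrib)
      then show "(of_real (?g x) * cis (- (x * \<xi>)) * of_real ?c) * (cis (x * \<eta>) * K \<eta>) = ?F x \<eta>"
        by (simp only: scaleR_conv_of_real mult_ac)
    qed
    finally show "?g x *\<^sub>R (cis (- (x * \<xi>)) * inv_fourier K x) = (LINT \<eta>|lborel. ?F x \<eta>)" .
  qed
  also have "\<dots> = (LINT \<eta>|lborel. LINT x|lborel. ?F x \<eta>)"
    by (rule lborel_pair.Fubini_integral[OF intF, symmetric])
  also have "\<dots> = (LINT \<eta>|lborel. (?c * (sqrt (2 * pi) / \<sigma> * exp (- ((\<eta> - \<xi>) / \<sigma>)\<^sup>2 / 2))) *\<^sub>R K \<eta>)"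
  proof (rule Bochner_Integration.integral_cong[OF refl])
    fix \<eta>
    have "(LINT x|lborel. ?F x \<eta>) = (LINT x|lborel. ?c *\<^sub>R (?g x *\<^sub>R cis (x * (\<eta> - \<xi>)) * K \<eta>))"
      by simp
    also have "\<dots> = ?c *\<^sub>R ((LINT x|lborel. ?g x *\<^sub>R cis (x * (\<eta> - \<xi>))) * K \<eta>)"
      by (simp only: integral_scaleR_right integral_mult_left_zero)
    finally show "(LINT x|lborel. ?F x \<eta>) = (?c * (sqrt (2 * pi) / \<sigma> * exp (- ((\<eta> - \<xi>) / \<sigma>)\<^sup>2 / 2))) *\<^sub>R K \<eta>"
      unfolding integral_gaussian_cis(1)[OF \<sigma>] by (simp add: scaleR_conv_of_real)
  qed
  also have "\<dots> = \<sigma> *\<^sub>R (LINT y|lborel. (?c * (sqrt (2 * pi) / \<sigma> * exp (- y\<^sup>2 / 2))) *\<^sub>R K (\<xi> + \<sigma> * y))"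
    using \<sigma> by (subst lborel_integral_real_affine[of \<sigma> _ \<xi>]) auto
  also have "\<dots> = (LINT y|lborel. std_normal_density y *\<^sub>R K (\<xi> + \<sigma> * y))"
  proof -
    have "\<sigma> * (?c * (sqrt (2 * pi) / \<sigma> * exp (- y\<^sup>2 / 2))) = std_normal_density y" for y
      using \<sigma> by (simp add: std_normal_density_def real_div_sqrt field_simps)
    then show ?thesis by (simp flip: integral_scaleR_right)
  qed
  finally show ?thesis .
qed

text \<open>Both sides of the Gaussian identity converge as \<sigma> \<rightarrow> 0. The left one
  is dominated by the integrable inverse transform, the right one by the bound B, and continuity of
  K identifies its limit.\<close>

lemma fourier_inv_fourier:
  assumes K: "integrable lborel K" "continuous_on UNIV K" and B: "\<And>\<xi>. cmod (K \<xi>) \<le> B"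
    and int: "integrable lborel (inv_fourier K)"
  shows "fourier (inv_fourier K) \<xi> = K \<xi>"
proof -
  have [measurable]: "K \<in> borel_measurable borel" "inv_fourier K \<in> borel_measurable borel"
    using K int by (auto dest: borel_measurable_integrable)
  let ?\<sigma> = "\<lambda>n. inverse (real (Suc n))"
  have lim: "?\<sigma> \<longlonglongrightarrow> 0" by (rule LIMSEQ_inverse_real_of_nat)
  have "(\<lambda>n. LINT x|lborel. exp (- (?\<sigma> n * x)\<^sup>2 / 2) *\<^sub>R (cis (- (x * \<xi>)) * inv_fourier K x))
      \<longlonglongrightarrow> (LINT x|lborel. cis (- (x * \<xi>)) * inv_fourier K x)"
  proof (rule integral_dominated_convergence[where w = "\<lambda>x. cmod (inv_fourier K x)"])
    show "AE x in lborel. (\<lambda>n. exp (- (?\<sigma> n * x)\<^sup>2 / 2) *\<^sub>R (cis (- (x * \<xi>)) * inv_fourier K x))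
        \<longlonglongrightarrow> cis (- (x * \<xi>)) * inv_fourier K x"
    proof (rule AE_I2)
      fix x
      have "(\<lambda>n. exp (- (?\<sigma> n * x)\<^sup>2 / 2) *\<^sub>R (cis (- (x * \<xi>)) * inv_fourier K x))
        \<longlonglongrightarrow> exp (- (0 * x)\<^sup>2 / 2) *\<^sub>R (cis (- (x * \<xi>)) * inv_fourier K x)"
        by (intro tendsto_intros lim) auto
      then show "(\<lambda>n. exp (- (?\<sigma> n * x)\<^sup>2 / 2) *\<^sub>R (cis (- (x * \<xi>)) * inv_fourier K x))
        \<longlonglongrightarrow> cis (- (x * \<xi>)) * inv_fourier K x" by simp
    qed
  qed (use int in \<open>auto simp: norm_mult intro!: mult_left_le_one_le\<close>)
  moreover have "(\<lambda>n. LINT y|lborel. std_normal_density y *\<^sub>R K (\<xi> + ?\<sigma> n * y))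
      \<longlonglongrightarrow> (LINT y|lborel. std_normal_density y *\<^sub>R K \<xi>)"
  proof (rule integral_dominated_convergence[where w = "\<lambda>y. std_normal_density y * B"])
    show "AE y in lborel. (\<lambda>n. std_normal_density y *\<^sub>R K (\<xi> + ?\<sigma> n * y)) \<longlonglongrightarrow> std_normal_density y *\<^sub>R K \<xi>"
    proof (rule AE_I2)
      fix y
      have "(\<lambda>n. \<xi> + ?\<sigma> n * y) \<longlonglongrightarrow> \<xi> + 0 * y" by (intro tendsto_intros lim)
      then have "(\<lambda>n. K (\<xi> + ?\<sigma> n * y)) \<longlonglongrightarrow> K \<xi>"
        using K(2) by (intro continuous_on_tendsto_compose[OF K(2)]) auto
      then show "(\<lambda>n. std_normal_density y *\<^sub>R K (\<xi> + ?\<sigma> n * y)) \<longlonglongrightarrow> std_normal_density y *\<^sub>R K \<xi>"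
        by (intro tendsto_intros)
    qed
  qed (auto simp: normal_density_nonneg intro!: mult_left_mono B)
  moreover have "(LINT y|lborel. std_normal_density y *\<^sub>R K \<xi>) = K \<xi>"
    by simp
  ultimately show ?thesis
    unfolding fourier_def using gaussian_average_inv_fourier[OF K(1), of "?\<sigma> _" \<xi>]
    by (simp add: LIMSEQ_unique)
qed

text \<open>This replaces Plancherel's theorem: it shows that inverse transforms are square integrable.\<close>

lemma integrable_nonneg_inv_fourier:
  fixes F :: "real \<Rightarrow> real"
  assumes K: "integrable lborel K" and B: "\<And>\<xi>. cmod (K \<xi>) \<le> B"
    and F: "\<And>x. inv_fourier K x = of_real (F x)" "\<And>x. 0 \<le> F x"
  shows "integrable lborel F"
proof -
  have [measurable]: "K \<in> borel_measurable borel"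
    using K by (auto dest: borel_measurable_integrable)
  have "F = (\<lambda>x. Re (inv_fourier K x))" by (simp add: F fun_eq_iff)
  then have [measurable]: "F \<in> borel_measurable borel" by simp
  let ?\<sigma> = "\<lambda>n. inverse (real (Suc n))"
  let ?f = "\<lambda>n x. exp (- (?\<sigma> n * x)\<^sup>2 / 2) * F x"
  have FB: "\<bar>F x\<bar> \<le> 1 / (2 * pi) * (LINT \<xi>|lborel. cmod (K \<xi>))" for x
    using cmod_inv_fourier_le[of K x] by (simp add: F)
  have int: "integrable lborel (?f n)" for n
  proof (rule Bochner_Integration.integrable_bound)
    show "integrable lborel (\<lambda>x. exp (- (?\<sigma> n * x)\<^sup>2 / 2) * (1 / (2 * pi) * (LINT \<xi>|lborel. cmod (K \<xi>))))"
      by (intro integrable_mult_left integral_gaussian_cis) simp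
    show "AE x in lborel. norm (?f n x) \<le> norm (exp (- (?\<sigma> n * x)\<^sup>2 / 2) * (1 / (2 * pi) * (LINT \<xi>|lborel. cmod (K \<xi>))))"
      using FB by (auto simp: abs_mult simp del: times_divide_eq_left intro!: mult_left_mono order_trans[OF FB])
  qed simp
  have mono_exp: "exp (- (?\<sigma> n * x)\<^sup>2 / 2) \<le> exp (- (?\<sigma> m * x)\<^sup>2 / 2)" if "n \<le> m" for n m x
  proof -
    have "(?\<sigma> m * x)\<^sup>2 \<le> (?\<sigma> n * x)\<^sup>2"
      unfolding power_mult_distrib using that by (intro mult_right_mono power_mono le_imp_inverse_le) auto
    then show ?thesis by simp
  qed
  have mono: "mono (\<lambda>n. ?f n x)" for x
    by (intro monoI mult_right_mono mono_exp F)
  \<comment> \<open>At frequency 0 the phase is absent, so these integrals are Gaussian averages of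
    K and are bounded by B uniformly in n. Monotone convergence then yields the integrability of
    F.\<close>
  have le: "integral\<^sup>L lborel (?f n) \<le> B" for n
  proof -
    have "complex_of_real (integral\<^sup>L lborel (?f n)) = (LINT y|lborel. std_normal_density y *\<^sub>R K (0 + ?\<sigma> n * y))"
      using gaussian_average_inv_fourier[OF K, of "?\<sigma> n" 0]
      by (simp add: F scaleR_conv_of_real flip: integral_complex_of_real of_real_mult)
    then have "\<bar>integral\<^sup>L lborel (?f n)\<bar> = cmod (LINT y|lborel. std_normal_density y *\<^sub>R K (0 + ?\<sigma> n * y))"
      by (metis norm_of_real)
    also have "\<dots> \<le> (LINT y|lborel. cmod (std_normal_density y *\<^sub>R K (0 + ?\<sigma> n * y)))"
      by (rule integral_norm_bound)
    also have "\<dots> \<le> (LINT y|lborel. std_normal_density y * B)"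
    proof (rule integral_mono)
      show "integrable lborel (\<lambda>y. cmod (std_normal_density y *\<^sub>R K (0 + ?\<sigma> n * y)))"
        by (rule Bochner_Integration.integrable_bound[of _ "\<lambda>y. std_normal_density y * B"])
          (auto simp: abs_mult intro!: mult_left_mono order_trans[OF B])
    qed (auto intro!: mult_left_mono B)
    also have "\<dots> = B" by simp
    finally show ?thesis by simp
  qed
  have "incseq (\<lambda>n. integral\<^sup>L lborel (?f n))"
    by (intro monoI integral_mono int) (use mono in \<open>auto simp: mono_def\<close>)
  then obtain L where L: "(\<lambda>n. integral\<^sup>L lborel (?f n)) \<longlonglongrightarrow> L"
    using incseq_convergent[of _ B] le by blast
  have lim: "(\<lambda>n. ?f n x) \<longlonglongrightarrow> F x" for x
  proof -
    have "(\<lambda>n. ?f n x) \<longlonglongrightarrow> exp (- (0 * x)\<^sup>2 / 2) * F x"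
      by (intro tendsto_intros LIMSEQ_inverse_real_of_nat) auto
    then show ?thesis by simp
  qed
  show ?thesis
    by (rule integrable_monotone_convergence[OF int _ _ L]) (use mono lim in auto)
qed

section \<open>Convolution of decaying functions\<close>

definition conv :: "(real \<Rightarrow> complex) \<Rightarrow> (real \<Rightarrow> complex) \<Rightarrow> real \<Rightarrow> complex" where
  "conv f g \<xi> = (LINT \<eta>|lborel. f (\<xi> - \<eta>) * g \<eta>)"

lemma integrable_decay_bound:
  fixes f :: "real \<Rightarrow> 'a::{banach, second_countable_topology}"
  assumes "f \<in> borel_measurable borel" "\<And>\<xi>. norm (f \<xi>) \<le> A * decay \<xi>"
  shows "integrable lborel f"
proof (rule Bochner_Integration.integrable_bound)
  show "integrable lborel (\<lambda>\<xi>. A * decay \<xi>)" by (intro integrable_mult_right integrable_decay)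
  show "AE \<xi> in lborel. norm (f \<xi>) \<le> norm (A * decay \<xi>)"
    by (intro AE_I2 order_trans[OF assms(2)]) simp
qed (use assms in simp)

lemma integrable_conv_integrand:
  assumes [measurable]: "f \<in> borel_measurable borel" "g \<in> borel_measurable borel"
    and f: "\<And>\<xi>. cmod (f \<xi>) \<le> A" and g: "\<And>\<xi>. cmod (g \<xi>) \<le> B * decay \<xi>"
  shows "integrable lborel (\<lambda>\<eta>. f (\<xi> - \<eta>) * g \<eta>)"
proof (rule integrable_decay_bound[of _ "A * B"])
  have "0 \<le> A" using norm_ge_zero f[of 0] by (rule order_trans)
  then show "cmod (f (\<xi> - \<eta>) * g \<eta>) \<le> A * B * decay \<eta>" for \<eta>
    unfolding norm_mult mult.assoc by (intro mult_mono f g) auto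
qed simp

text \<open>Divide 1 + (a + b)^2 \<le> 2 ((1 + a^2) + (1 + b^2)) by the three factors. The right
  side is integrable in \<eta>, which bounds the convolution of two decaying functions by a decaying
  one.\<close>

lemma decay_mult_le: "decay (\<xi> - \<eta>) * decay \<eta> \<le> 2 * decay \<xi> * (decay \<eta> + decay (\<xi> - \<eta>))"
proof -
  define a b where "a = \<xi> - \<eta>" and "b = \<eta>"
  have \<xi>: "\<xi> = a + b" by (simp add: a_def b_def)
  have p: "0 < 1 + a\<^sup>2" "0 < 1 + b\<^sup>2" "0 < 1 + (a + b)\<^sup>2" by (simp_all add: add_pos_nonneg)
  have "1 + (a + b)\<^sup>2 \<le> 2 * ((1 + a\<^sup>2) + (1 + b\<^sup>2))"
    using sum_squares_bound[of a b] by (simp add: power2_sum)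
  then have "1 / ((1 + a\<^sup>2) * (1 + b\<^sup>2)) \<le> 2 * ((1 + a\<^sup>2) + (1 + b\<^sup>2)) / ((1 + (a + b)\<^sup>2) * ((1 + a\<^sup>2) * (1 + b\<^sup>2)))"
    using p by (simp add: divide_simps)
  also have "\<dots> = 2 * decay (a + b) * (decay b + decay a)"
    using p unfolding decay_def by (simp add: divide_simps)
  finally show ?thesis
    unfolding \<xi> by (simp add: decay_def b_def)
qed

text \<open>By the triangle inequality the exponential weight passes through the convolution with
  its full rate r, so products lose no analyticity. The two summands of \<open>decay_mult_le\<close>
  integrate to \<pi> each, hence 4 \<pi>.\<close>

lemma conv_bound:
  assumes [measurable]: "f \<in> borel_measurable borel" "g \<in> borel_measurable borel"
    and f: "\<And>\<xi>. cmod (f \<xi>) \<le> A * (exp (- (r * \<bar>\<xi>\<bar>)) * decay \<xi>)"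
    and g: "\<And>\<xi>. cmod (g \<xi>) \<le> B * (exp (- (r * \<bar>\<xi>\<bar>)) * decay \<xi>)"
    and r: "0 \<le> r" and A: "0 \<le> A" and B: "0 \<le> B"
  shows "cmod (conv f g \<xi>) \<le> 4 * pi * A * B * (exp (- (r * \<bar>\<xi>\<bar>)) * decay \<xi>)"
proof -
  let ?E = "A * B * exp (- (r * \<bar>\<xi>\<bar>))"
  let ?G = "\<lambda>\<eta>. ?E * (2 * decay \<xi> * (decay \<eta> + decay (\<xi> - \<eta>)))"
  have le: "cmod (f (\<xi> - \<eta>) * g \<eta>) \<le> ?G \<eta>" for \<eta>
  proof -
    have "cmod (f (\<xi> - \<eta>) * g \<eta>)
        \<le> (A * (exp (- (r * \<bar>\<xi> - \<eta>\<bar>)) * decay (\<xi> - \<eta>))) * (B * (exp (- (r * \<bar>\<eta>\<bar>)) * decay \<eta>))"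
      unfolding norm_mult by (intro mult_mono f g) (use A decay_pos[of "\<xi> - \<eta>"] in auto)
    also have "\<dots> = (A * B * exp (- (r * (\<bar>\<xi> - \<eta>\<bar> + \<bar>\<eta>\<bar>)))) * (decay (\<xi> - \<eta>) * decay \<eta>)"
    proof -
      have "exp (- (r * (\<bar>\<xi> - \<eta>\<bar> + \<bar>\<eta>\<bar>))) = exp (- (r * \<bar>\<xi> - \<eta>\<bar>)) * exp (- (r * \<bar>\<eta>\<bar>))"
        by (simp add: distrib_left flip: exp_add)
      then show ?thesis by (simp only: mult_ac)
    qed
    also have "\<dots> \<le> ?E * (2 * decay \<xi> * (decay \<eta> + decay (\<xi> - \<eta>)))"
    proof (rule mult_mono[OF mult_left_mono decay_mult_le])
      have "r * \<bar>\<xi>\<bar> \<le> r * (\<bar>\<xi> - \<eta>\<bar> + \<bar>\<eta>\<bar>)"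
        using r by (intro mult_left_mono) auto
      then show "exp (- (r * (\<bar>\<xi> - \<eta>\<bar> + \<bar>\<eta>\<bar>))) \<le> exp (- (r * \<bar>\<xi>\<bar>))" by simp
    qed (use A B decay_pos[of "\<xi> - \<eta>"] decay_pos[of \<eta>] in auto)
    finally show ?thesis .
  qed
  have intG: "integrable lborel ?G"
    by (intro integrable_mult_right Bochner_Integration.integrable_add integrable_decay integrable_lborel_reflect)
  have "cmod (conv f g \<xi>) \<le> (LINT \<eta>|lborel. cmod (f (\<xi> - \<eta>) * g \<eta>))"
    unfolding conv_def by (rule integral_norm_bound)
  also have "\<dots> \<le> (LINT \<eta>|lborel. ?G \<eta>)"
    by (intro integral_mono intG le integrable_norm Bochner_Integration.integrable_bound[OF intG] AE_I2)
      (auto intro: order_trans[OF le])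
  also have "\<dots> = ?E * (2 * decay \<xi> * (2 * pi))"
    by (simp add: integral_decay integrable_decay integrable_lborel_reflect integral_lborel_reflect
        Bochner_Integration.integral_add)
  finally show ?thesis by (simp add: mult_ac)
qed

lemma continuous_on_curry:
  assumes "continuous_on UNIV (\<lambda>(t, \<xi>). f t \<xi>)"
  shows "continuous_on UNIV (f t)"
proof -
  have "continuous_on UNIV (\<lambda>\<xi>. case (t, \<xi>) of (t, \<xi>) \<Rightarrow> f t \<xi>)"
    by (rule continuous_on_compose2[OF assms]) (auto intro!: continuous_on_Pair)
  then show ?thesis by simp
qed

text \<open>Dominated convergence, jointly in a parameter and the frequency. One factor has to be
  bounded and the other integrably dominated, both uniformly in the parameter.\<close>

lemma continuous_on_conv:
  fixes f g :: "'a::metric_space \<Rightarrow> real \<Rightarrow> complex"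
  assumes f: "continuous_on UNIV (\<lambda>(t, \<xi>). f t \<xi>)" "\<And>t \<xi>. cmod (f t \<xi>) \<le> A"
    and g: "continuous_on UNIV (\<lambda>(t, \<xi>). g t \<xi>)" "\<And>t \<xi>. cmod (g t \<xi>) \<le> B * decay \<xi>"
  shows "continuous_on UNIV (\<lambda>(t, \<xi>). conv (f t) (g t) \<xi>)"
proof (rule continuous_on_sequentiallyI, clarsimp)
  fix u :: "nat \<Rightarrow> 'a \<times> real" and t \<xi> assume "u \<longlonglongrightarrow> (t, \<xi>)"
  then have u: "(\<lambda>n. fst (u n)) \<longlonglongrightarrow> t" "(\<lambda>n. snd (u n)) \<longlonglongrightarrow> \<xi>"
    by (auto dest: tendsto_fst tendsto_snd)
  have cf: "continuous_on UNIV (f t)" "continuous_on UNIV (g t)" for t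
    by (rule continuous_on_curry[OF f(1)], rule continuous_on_curry[OF g(1)])
  have [measurable]: "f t \<in> borel_measurable borel" "g t \<in> borel_measurable borel" for t
    using cf by (auto intro: borel_measurable_continuous_onI)
  have A: "0 \<le> A" using norm_ge_zero f(2)[of t 0] by (rule order_trans)
  have "(\<lambda>n. LINT \<eta>|lborel. f (fst (u n)) (snd (u n) - \<eta>) * g (fst (u n)) \<eta>)
      \<longlonglongrightarrow> (LINT \<eta>|lborel. f t (\<xi> - \<eta>) * g t \<eta>)"
  proof (rule integral_dominated_convergence[where w = "\<lambda>\<eta>. A * (B * decay \<eta>)"])
    show "integrable lborel (\<lambda>\<eta>. A * (B * decay \<eta>))"
      by (intro integrable_mult_right integrable_decay)
    show "AE \<eta> in lborel. (\<lambda>n. f (fst (u n)) (snd (u n) - \<eta>) * g (fst (u n)) \<eta>) \<longlonglongrightarrow> f t (\<xi> - \<eta>) * g t \<eta>"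
    proof (rule AE_I2)
      fix \<eta>
      have "(\<lambda>n. case (fst (u n), snd (u n) - \<eta>) of (t, \<xi>) \<Rightarrow> f t \<xi>) \<longlonglongrightarrow> (case (t, \<xi> - \<eta>) of (t, \<xi>) \<Rightarrow> f t \<xi>)"
        by (rule continuous_on_tendsto_compose[OF f(1)]) (auto intro!: tendsto_intros u)
      moreover have "(\<lambda>n. case (fst (u n), \<eta>) of (t, \<xi>) \<Rightarrow> g t \<xi>) \<longlonglongrightarrow> (case (t, \<eta>) of (t, \<xi>) \<Rightarrow> g t \<xi>)"
        by (rule continuous_on_tendsto_compose[OF g(1)]) (auto intro!: tendsto_intros u)
      ultimately show "(\<lambda>n. f (fst (u n)) (snd (u n) - \<eta>) * g (fst (u n)) \<eta>) \<longlonglongrightarrow> f t (\<xi> - \<eta>) * g t \<eta>"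
        by (auto intro!: tendsto_mult)
    qed
    show "AE \<eta> in lborel. norm (f (fst (u n)) (snd (u n) - \<eta>) * g (fst (u n)) \<eta>) \<le> A * (B * decay \<eta>)" for n
      by (rule AE_I2) (unfold norm_mult, intro mult_mono f g A, auto)
  qed simp_all
  then show "(\<lambda>n. case u n of (t, \<xi>) \<Rightarrow> conv (f t) (g t) \<xi>) \<longlonglongrightarrow> conv (f t) (g t) \<xi>"
    by (simp add: conv_def case_prod_beta)
qed

section \<open>Products of inverse transforms\<close>

definition cont_decay :: "real \<Rightarrow> (real \<Rightarrow> complex) \<Rightarrow> bool" where
  "cont_decay A f \<longleftrightarrow> 0 \<le> A \<and> continuous_on UNIV f \<and> (\<forall>\<xi>. cmod (f \<xi>) \<le> A * decay \<xi>)"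

lemma cont_decayD:
  assumes "cont_decay A f"
  shows "0 \<le> A" "continuous_on UNIV f" "cmod (f \<xi>) \<le> A * decay \<xi>" "cmod (f \<xi>) \<le> A"
    "f \<in> borel_measurable borel" "integrable lborel f"
proof -
  show 1: "0 \<le> A" "continuous_on UNIV f" "cmod (f \<xi>) \<le> A * decay \<xi>" for \<xi>
    using assms by (auto simp: cont_decay_def)
  then show 2: "f \<in> borel_measurable borel" by (intro borel_measurable_continuous_onI)
  show "integrable lborel f" by (rule integrable_decay_bound[OF 2 1(3)])
  show "cmod (f \<xi>) \<le> A"
    using 1(3)[of \<xi>] mult_left_mono[OF decay_le_1[of \<xi>] 1(1)] by simp
qed

lemma cont_decay_conv:
  assumes f: "cont_decay A f" and g: "cont_decay B g"
  shows "cont_decay (4 * pi * A * B) (conv f g)"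
  unfolding cont_decay_def
proof (intro conjI allI)
  note f = cont_decayD[OF f] and g = cont_decayD[OF g]
  show "0 \<le> 4 * pi * A * B" using f g by simp
  \<comment> \<open>A dummy time variable makes the version with a parameter applicable.\<close>
  have "continuous_on UNIV (\<lambda>(t::real, \<xi>). f \<xi>)" "continuous_on UNIV (\<lambda>(t::real, \<xi>). g \<xi>)"
    unfolding case_prod_beta
    by (rule continuous_on_compose2[OF f(2) continuous_on_snd[OF continuous_on_id]]
        continuous_on_compose2[OF g(2) continuous_on_snd[OF continuous_on_id]], simp)+
  then have "continuous_on UNIV (\<lambda>(t::real, \<xi>). conv f g \<xi>)"
    by (rule continuous_on_conv[OF _ f(4) _ g(3)])
  then show "continuous_on UNIV (conv f g)"
    by (rule continuous_on_curry)
  show "cmod (conv f g \<xi>) \<le> 4 * pi * A * B * decay \<xi>" for \<xi>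
    using conv_bound[of f g A 0 B \<xi>] f g by simp
qed

text \<open>The convolution theorem for inverse transforms: after the shift by \<eta> the phases
  multiply, and the double integral converges absolutely.\<close>

lemma inv_fourier_mult:
  assumes f: "cont_decay A f" and g: "cont_decay B g"
  shows "inv_fourier f x * inv_fourier g x = of_real (1 / (2 * pi)) * inv_fourier (conv f g) x"
proof -
  note f = cont_decayD[OF f] and g = cont_decayD[OF g]
  note [measurable] = f(5) g(5)
  let ?F = "\<lambda>\<eta> \<xi>. cis (x * \<xi>) * (f (\<xi> - \<eta>) * g \<eta>)"
  have intF: "integrable (lborel \<Otimes>\<^sub>M lborel) (case_prod ?F)"
  proof (rule lborel_pair.Fubini_integrable)
    have "(\<lambda>\<eta>. \<integral>\<xi>. norm (case_prod ?F (\<eta>, \<xi>)) \<partial>lborel) = (\<lambda>\<eta>. (LINT \<xi>|lborel. cmod (f \<xi>)) * cmod (g \<eta>))"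
      by (simp add: norm_mult integral_lborel_shift[of "\<lambda>\<xi>. cmod (f \<xi>)"])
    then show "integrable lborel (\<lambda>\<eta>. \<integral>\<xi>. norm (case_prod ?F (\<eta>, \<xi>)) \<partial>lborel)"
      using g(6) by simp
    show "AE \<eta> in lborel. integrable lborel (\<lambda>\<xi>. case_prod ?F (\<eta>, \<xi>))"
    proof (rule AE_I2)
      fix \<eta>
      have "integrable lborel (\<lambda>\<xi>. f (\<xi> - \<eta>) * g \<eta>)"
        by (intro integrable_mult_left integrable_lborel_shift f)
      then show "integrable lborel (\<lambda>\<xi>. case_prod ?F (\<eta>, \<xi>))"
        by (rule Bochner_Integration.integrable_bound) (auto simp: norm_mult)
    qed
  qed measurable
  have "(LINT \<xi>|lborel. cis (x * \<xi>) * f \<xi>) * (LINT \<eta>|lborel. cis (x * \<eta>) * g \<eta>)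
      = (LINT \<eta>|lborel. (LINT \<xi>|lborel. cis (x * \<xi>) * f \<xi>) * (cis (x * \<eta>) * g \<eta>))"
    by (rule integral_mult_right_zero[symmetric])
  also have "\<dots> = (LINT \<eta>|lborel. LINT \<xi>|lborel. ?F \<eta> \<xi>)"
  proof (rule Bochner_Integration.integral_cong[OF refl])
    fix \<eta>
    have "(LINT \<xi>|lborel. cis (x * \<xi>) * f \<xi>) = (LINT \<xi>|lborel. cis (x * (\<xi> - \<eta>)) * f (\<xi> - \<eta>))"
      by (rule integral_lborel_shift[symmetric])
    also have "\<dots> * (cis (x * \<eta>) * g \<eta>) = (LINT \<xi>|lborel. cis (x * (\<xi> - \<eta>)) * f (\<xi> - \<eta>) * (cis (x * \<eta>) * g \<eta>))"
      by (rule integral_mult_left_zero[symmetric])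
    also have "\<dots> = (LINT \<xi>|lborel. ?F \<eta> \<xi>)"
    proof (rule Bochner_Integration.integral_cong[OF refl])
      fix \<xi>
      have "cis (x * \<xi>) = cis (x * (\<xi> - \<eta>)) * cis (x * \<eta>)"
        by (simp add: cis_mult right_diff_distrib)
      then show "cis (x * (\<xi> - \<eta>)) * f (\<xi> - \<eta>) * (cis (x * \<eta>) * g \<eta>) = ?F \<eta> \<xi>"
        by (simp only: mult_ac)
    qed
    finally show "(LINT \<xi>|lborel. cis (x * \<xi>) * f \<xi>) * (cis (x * \<eta>) * g \<eta>) = (LINT \<xi>|lborel. ?F \<eta> \<xi>)" .
  qed
  also have "\<dots> = (LINT \<xi>|lborel. LINT \<eta>|lborel. ?F \<eta> \<xi>)"
    by (rule lborel_pair.Fubini_integral[OF intF, symmetric])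
  also have "\<dots> = (LINT \<xi>|lborel. cis (x * \<xi>) * conv f g \<xi>)"
    unfolding conv_def by (simp only: integral_mult_right_zero)
  finally show ?thesis
    by (simp add: inv_fourier_def)
qed

lemma inv_fourier_scale: "inv_fourier (\<lambda>\<xi>. c * f \<xi>) x = c * inv_fourier f x"
proof -
  have "(LINT \<xi>|lborel. cis (x * \<xi>) * (c * f \<xi>)) = (LINT \<xi>|lborel. c * (cis (x * \<xi>) * f \<xi>))"
    by (simp only: mult_ac)
  also have "\<dots> = c * (LINT \<xi>|lborel. cis (x * \<xi>) * f \<xi>)" by (rule integral_mult_right_zero)
  finally show ?thesis by (simp add: inv_fourier_def)
qed

lemma inv_fourier_reflect_cnj: "inv_fourier (\<lambda>\<xi>. cnj (f (- \<xi>))) x = cnj (inv_fourier f x)"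
proof -
  let ?F = "\<lambda>\<xi>. cnj (cis (x * \<xi>) * f \<xi>)"
  have "cis (x * \<xi>) * cnj (f (- \<xi>)) = ?F (0 - \<xi>)" for \<xi>
    by (simp add: cis_cnj)
  then have "(LINT \<xi>|lborel. cis (x * \<xi>) * cnj (f (- \<xi>))) = (LINT \<xi>|lborel. ?F (0 - \<xi>))"
    by (simp only:)
  also have "\<dots> = (LINT \<xi>|lborel. ?F \<xi>)"
    by (rule integral_lborel_reflect)
  also have "\<dots> = cnj (LINT \<xi>|lborel. cis (x * \<xi>) * f \<xi>)"
    by (rule Bochner_Integration.integral_cnj)
  finally show ?thesis by (simp add: inv_fourier_def)
qed

text \<open>The squared modulus is, up to a factor, the inverse transform of the convolution of f
  with its reflected conjugate. That convolution is bounded and integrable, so the criterion for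
  nonnegative inverse transforms applies.\<close>

lemma integrable_inv_fourier_square:
  assumes "cont_decay A f"
  shows "integrable lborel (\<lambda>x. (cmod (inv_fourier f x))\<^sup>2)"
proof -
  let ?c = "of_real (1 / (2 * pi)) :: complex"
  have g: "cont_decay A (\<lambda>\<xi>. cnj (f (- \<xi>)))"
    using assms unfolding cont_decay_def
    by (auto intro!: continuous_intros intro: continuous_on_compose2[of UNIV f] simp del: decay_minus)
      (metis decay_minus)
  note h = cont_decayD[OF cont_decay_conv[OF assms g]]
  show ?thesis
  proof (rule integrable_nonneg_inv_fourier)
    show "integrable lborel (\<lambda>\<xi>. ?c * conv f (\<lambda>\<xi>. cnj (f (- \<xi>))) \<xi>)"
      by (intro integrable_mult_right h)
    show "cmod (?c * conv f (\<lambda>\<xi>. cnj (f (- \<xi>))) \<xi>) \<le> cmod ?c * (4 * pi * A * A)" for \<xi>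
      unfolding norm_mult by (intro mult_left_mono h) auto
    show "inv_fourier (\<lambda>\<xi>. ?c * conv f (\<lambda>\<xi>. cnj (f (- \<xi>))) \<xi>) x = of_real ((cmod (inv_fourier f x))\<^sup>2)" for x
      unfolding inv_fourier_scale inv_fourier_mult[OF assms g, symmetric] inv_fourier_reflect_cnj
      by (simp only: complex_norm_square)
  qed simp
qed

text \<open>Fourier inversion requires the triple product to be integrable: two factors are square
  integrable, a b \<le> a^2 + b^2, and the third is bounded.\<close>

lemma fourier_triple_product:
  assumes f: "cont_decay A f" and g: "cont_decay B g" and h: "cont_decay C h"
  shows "fourier (\<lambda>x. inv_fourier f x * inv_fourier g x * inv_fourier h x) \<xi>
    = of_real (1 / (2 * pi)\<^sup>2) * conv (conv f g) h \<xi>"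
proof -
  let ?c = "of_real (1 / (2 * pi)) :: complex"
  let ?K = "\<lambda>\<xi>. ?c * (?c * conv (conv f g) h \<xi>)"
  note K = cont_decayD[OF cont_decay_conv[OF cont_decay_conv[OF f g] h]]
  note [measurable] = cont_decayD(5)[OF f] cont_decayD(5)[OF g] cont_decayD(5)[OF h]
  have eq: "inv_fourier f x * inv_fourier g x * inv_fourier h x = inv_fourier ?K x" for x
    unfolding inv_fourier_scale inv_fourier_mult[OF f g]
    by (simp only: mult.assoc inv_fourier_mult[OF cont_decay_conv[OF f g] h])
  have int: "integrable lborel (\<lambda>x. inv_fourier f x * inv_fourier g x * inv_fourier h x)"
  proof (rule Bochner_Integration.integrable_bound)
    let ?H = "1 / (2 * pi) * (LINT \<xi>|lborel. cmod (h \<xi>))"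
    have H: "0 \<le> ?H" by simp
    show "integrable lborel (\<lambda>x. ((cmod (inv_fourier f x))\<^sup>2 + (cmod (inv_fourier g x))\<^sup>2) * ?H)"
      by (intro integrable_mult_left Bochner_Integration.integrable_add integrable_inv_fourier_square[OF f] integrable_inv_fourier_square[OF g])
    show "AE x in lborel. norm (inv_fourier f x * inv_fourier g x * inv_fourier h x)
      \<le> norm (((cmod (inv_fourier f x))\<^sup>2 + (cmod (inv_fourier g x))\<^sup>2) * ?H)"
    proof (rule AE_I2)
      fix x
      let ?a = "cmod (inv_fourier f x)" and ?b = "cmod (inv_fourier g x)"
      have "?a * ?b \<le> ?a\<^sup>2 + ?b\<^sup>2" using sum_squares_bound[of ?a ?b] mult_nonneg_nonneg[of ?a ?b] by (simp del: mult_nonneg_nonneg)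
      then have "?a * ?b * cmod (inv_fourier h x) \<le> (?a\<^sup>2 + ?b\<^sup>2) * ?H"
        by (intro mult_mono cmod_inv_fourier_le) auto
      then show "norm (inv_fourier f x * inv_fourier g x * inv_fourier h x) \<le> norm ((?a\<^sup>2 + ?b\<^sup>2) * ?H)"
        by (simp add: norm_mult)
    qed
  qed simp
  have "fourier (inv_fourier ?K) \<xi> = ?K \<xi>"
  proof (rule fourier_inv_fourier)
    show "integrable lborel ?K" by (intro integrable_mult_right K)
    show "continuous_on UNIV ?K" by (intro continuous_intros K)
    show "cmod (?K \<xi>) \<le> cmod ?c * (cmod ?c * (4 * pi * (4 * pi * A * B) * C))" for \<xi>
      unfolding norm_mult by (intro mult_left_mono K) auto
    show "integrable lborel (inv_fourier ?K)" using int unfolding eq by simp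
  qed
  then show ?thesis unfolding eq by (simp add: power2_eq_square)
qed

section \<open>The Duhamel operator on analytic data\<close>

text \<open>The operators freeze time outside [0,T]. All functions then live on the whole plane,
  where the bounded continuous functions form a Banach space.\<close>

definition clip :: "real \<Rightarrow> real \<Rightarrow> real" where
  "clip T t = max 0 (min T t)"

text \<open>
  The band of analyticity shrinks linearly in time. A derivative costs a factor \<open>\<bar>\<xi>\<bar>\<close>, and
  \<open>\<integral>\<^sub>0\<^sup>t \<bar>\<xi>\<bar> exp (- (2 - t' / T) * \<bar>\<xi>\<bar>) dt' \<le> T * exp (- (2 - t / T) * \<bar>\<xi>\<bar>)\<close>, so that the Duhamel
  operator is bounded in the weighted supremum norm in spite of the derivative.
\<close>

definition aweight :: "real \<Rightarrow> real \<Rightarrow> real \<Rightarrow> real" where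
  "aweight T t \<xi> = exp (- ((2 - clip T t / T) * \<bar>\<xi>\<bar>)) * decay \<xi>"

definition admissible :: "real \<Rightarrow> real \<Rightarrow> (real \<Rightarrow> real \<Rightarrow> complex) \<Rightarrow> bool" where
  "admissible T A f \<longleftrightarrow> 0 \<le> A \<and> continuous_on UNIV (\<lambda>(t, \<xi>). f t \<xi>) \<and> (\<forall>t \<xi>. cmod (f t \<xi>) \<le> A * aweight T t \<xi>)"

definition duhamel :: "real \<Rightarrow> real \<Rightarrow> (real \<Rightarrow> real \<Rightarrow> complex) \<Rightarrow> real \<Rightarrow> real \<Rightarrow> complex" where
  "duhamel T a f t \<xi> = integral {0..clip T t} (\<lambda>t'. cis ((clip T t - t') * a * \<xi> ^ 3) * (\<i> * of_real \<xi> * f t' \<xi>))"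

definition free_evolution :: "real \<Rightarrow> real \<Rightarrow> (real \<Rightarrow> complex) \<Rightarrow> real \<Rightarrow> real \<Rightarrow> complex" where
  "free_evolution T a g t \<xi> = cis (clip T t * a * \<xi> ^ 3) * g \<xi>"

text \<open>
  Dividing by the weight turns the weighted supremum norm into the norm of bounded continuous
  functions. For a function that is not admissible \<open>encode\<close> yields an unspecified value.
\<close>

definition encode :: "real \<Rightarrow> (real \<Rightarrow> real \<Rightarrow> complex) \<Rightarrow> (real \<times> real) \<Rightarrow>\<^sub>C complex" where
  "encode T f = Bcontfun (\<lambda>(t, \<xi>). f t \<xi> / of_real (aweight T t \<xi>))"

definition decode :: "real \<Rightarrow> (real \<times> real) \<Rightarrow>\<^sub>C complex \<Rightarrow> real \<Rightarrow> real \<Rightarrow> complex" where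
  "decode T u t \<xi> = of_real (aweight T t \<xi>) * u (t, \<xi>)"

text \<open>The transform of a product of three inverse transforms, see
  \<open>fourier_triple_product\<close>. In this form the fixed point argument stays on the Fourier
  side.\<close>

definition triple :: "(real \<Rightarrow> real \<Rightarrow> complex) \<Rightarrow> (real \<Rightarrow> real \<Rightarrow> complex) \<Rightarrow> (real \<Rightarrow> real \<Rightarrow> complex) \<Rightarrow> real \<Rightarrow> real \<Rightarrow> complex" where
  "triple f g h t \<xi> = of_real (1 / (2 * pi)\<^sup>2) * conv (conv (f t) (g t)) (h t) \<xi>"

text \<open>The sign is included so that the integral equation reads: linear part plus
  \<open>cubic\<close>.\<close>

definition cubic :: "real \<Rightarrow> real \<Rightarrow> (real \<times> real) \<Rightarrow>\<^sub>C complex \<Rightarrow> (real \<times> real) \<Rightarrow>\<^sub>C complex \<Rightarrow> (real \<times> real) \<Rightarrow>\<^sub>C complex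
    \<Rightarrow> (real \<times> real) \<Rightarrow>\<^sub>C complex" where
  "cubic T a u v w = - encode T (duhamel T a (triple (decode T u) (decode T v) (decode T w)))"

lemma clip_eq: "t \<in> {0..T} \<Longrightarrow> clip T t = t"
  by (auto simp: clip_def)

lemma continuous_on_clip [continuous_intros]: "continuous_on A f \<Longrightarrow> continuous_on A (\<lambda>x. clip T (f x))"
  unfolding clip_def by (intro continuous_intros)

lemma continuous_on_curry_snd:
  assumes "continuous_on UNIV (\<lambda>(t, \<xi>). f t \<xi>)"
  shows "continuous_on S (\<lambda>t. f t \<xi>)"
proof -
  have "continuous_on S (\<lambda>t. case (t, \<xi>) of (t, \<xi>) \<Rightarrow> f t \<xi>)"
    by (rule continuous_on_compose2[OF assms]) (auto intro!: continuous_on_Pair)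
  then show ?thesis by simp
qed

context
  fixes T :: real
  assumes T: "0 < T"
begin

lemma clip_bounds: "0 \<le> clip T t" "clip T t \<le> T"
  using T by (auto simp: clip_def)

lemma aweight_pos: "0 < aweight T t \<xi>"
  by (simp add: aweight_def decay_pos)

text \<open>The exponential rate falls from 2 at time 0 to 1 at time T. Data of rate 2 therefore
  enter the space, and all of its elements keep rate 1, which suffices for every H^s.\<close>

lemma aweight_le: "aweight T t \<xi> \<le> exp (- \<bar>\<xi>\<bar>) * decay \<xi>" "exp (- (2 * \<bar>\<xi>\<bar>)) * decay \<xi> \<le> aweight T t \<xi>" "aweight T t \<xi> \<le> decay \<xi>"
proof -
  have c: "0 \<le> clip T t / T" "clip T t / T \<le> 1" using clip_bounds[of t] T by auto
  then have *: "1 * \<bar>\<xi>\<bar> \<le> (2 - clip T t / T) * \<bar>\<xi>\<bar>" "(2 - clip T t / T) * \<bar>\<xi>\<bar> \<le> 2 * \<bar>\<xi>\<bar>"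
    by (intro mult_right_mono; simp)+
  show 1: "aweight T t \<xi> \<le> exp (- \<bar>\<xi>\<bar>) * decay \<xi>" "exp (- (2 * \<bar>\<xi>\<bar>)) * decay \<xi> \<le> aweight T t \<xi>"
    unfolding aweight_def using * decay_pos[of \<xi>] by (intro mult_right_mono; simp)+
  have "exp (- \<bar>\<xi>\<bar>) * decay \<xi> \<le> 1 * decay \<xi>"
    using decay_pos[of \<xi>] by (intro mult_right_mono) auto
  then show "aweight T t \<xi> \<le> decay \<xi>" using 1(1) by simp
qed

lemma continuous_on_aweight: "continuous_on UNIV (\<lambda>z. aweight T (fst z) (snd z))"
  unfolding aweight_def using T by (intro continuous_intros) auto

lemma admissibleD:
  assumes "admissible T A f"
  shows "0 \<le> A" "continuous_on UNIV (\<lambda>(t, \<xi>). f t \<xi>)" "cmod (f t \<xi>) \<le> A * aweight T t \<xi>" "cont_decay A (f t)"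
    "cmod (f t \<xi>) \<le> A * exp (- \<bar>\<xi>\<bar>) * decay \<xi>" "cmod (f t \<xi>) \<le> A * decay \<xi>" "cmod (f t \<xi>) \<le> A"
    "f t \<in> borel_measurable borel"
proof -
  show 1: "0 \<le> A" "continuous_on UNIV (\<lambda>(t, \<xi>). f t \<xi>)" "cmod (f t \<xi>) \<le> A * aweight T t \<xi>" for t \<xi>
    using assms by (auto simp: admissible_def)
  show "cmod (f t \<xi>) \<le> A * exp (- \<bar>\<xi>\<bar>) * decay \<xi>"
    using order_trans[OF 1(3) mult_left_mono[OF aweight_le(1) 1(1)]] by (simp add: mult_ac)
  have 2: "cmod (f t \<xi>) \<le> A * decay \<xi>" for \<xi>
    by (rule order_trans[OF 1(3) mult_left_mono[OF aweight_le(3) 1(1)]])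
  then show "cmod (f t \<xi>) \<le> A * decay \<xi>" .
  show 3: "cont_decay A (f t)"
    unfolding cont_decay_def using 1(1) 2 continuous_on_curry[OF 1(2)] by auto
  show "cmod (f t \<xi>) \<le> A" "f t \<in> borel_measurable borel" using cont_decayD[OF 3] by auto
qed

lemma admissible_conv:
  assumes f: "admissible T A f" and g: "admissible T B g"
  shows "admissible T (4 * pi * A * B) (\<lambda>t. conv (f t) (g t))"
  unfolding admissible_def
proof (intro conjI allI)
  note f = admissibleD[OF f] and g = admissibleD[OF g]
  show "0 \<le> 4 * pi * A * B" using f(1) g(1) by simp
  show "continuous_on UNIV (\<lambda>(t, \<xi>). conv (f t) (g t) \<xi>)"
    by (rule continuous_on_conv[OF f(2) f(7) g(2) g(6)])
  show "cmod (conv (f t) (g t) \<xi>) \<le> 4 * pi * A * B * aweight T t \<xi>" for t \<xi>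
    unfolding aweight_def
    by (rule conv_bound[OF f(8) g(8) f(3)[unfolded aweight_def] g(3)[unfolded aweight_def] _ f(1) g(1)])
      (use clip_bounds[of t] T in \<open>simp add: divide_le_eq\<close>)
qed

lemma admissible_scale:
  assumes "admissible T A f"
  shows "admissible T (cmod c * A) (\<lambda>t \<xi>. c * f t \<xi>)"
  using admissibleD[OF assms] unfolding admissible_def
  by (auto simp: norm_mult mult.assoc case_prod_beta intro!: continuous_intros mult_left_mono)

text \<open>The constant is (4 \<pi>)^2 / (2 \<pi>)^2 = 4.\<close>

lemma admissible_triple:
  assumes f: "admissible T A f" and g: "admissible T B g" and h: "admissible T C h"
  shows "admissible T (4 * (A * B * C)) (triple f g h)"
proof -
  have eq: "4 * (A * B * C) = cmod (of_real (1 / (2 * pi)\<^sup>2)) * (4 * pi * (4 * pi * A * B) * C)"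
    unfolding norm_of_real by (simp add: power2_eq_square)
  show ?thesis
    unfolding eq triple_def by (intro admissible_scale admissible_conv f g h)
qed

text \<open>The substitution t' = r \<open>clip T t\<close> fixes the interval of integration, so
  that joint continuity follows from continuous dependence on parameters.\<close>

lemma duhamel_altdef:
  assumes "continuous_on UNIV (\<lambda>(t, \<xi>). f t \<xi>)"
  shows "duhamel T a f t \<xi> = of_real (clip T t) * integral {0..1} (\<lambda>r.
    cis ((clip T t - r * clip T t) * a * \<xi> ^ 3) * (\<i> * of_real \<xi> * f (r * clip T t) \<xi>))"
proof (cases "clip T t = 0")
  case False
  then have c: "0 < clip T t" using clip_bounds[of t] by simp
  let ?F = "\<lambda>t'. cis ((clip T t - t') * a * \<xi> ^ 3) * (\<i> * of_real \<xi> * f t' \<xi>)"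
  have cf: "continuous_on S (\<lambda>t'. f t' \<xi>)" for S
    by (rule continuous_on_curry_snd[OF assms])
  have "?F integrable_on {0..clip T t}"
    by (intro integrable_continuous_real continuous_intros cf)
  then have "(?F has_integral duhamel T a f t \<xi>) (cbox 0 (clip T t))"
    unfolding duhamel_def by (simp add: has_integral_integral)
  from has_integral_affinity[OF this, of "clip T t" 0]
  have "((\<lambda>r. ?F (clip T t * r)) has_integral (1 / clip T t) *\<^sub>R duhamel T a f t \<xi>) ((\<lambda>x. x / clip T t) ` {0..clip T t})"
    using c by (simp add: divide_inverse mult.commute)
  also have "(\<lambda>x. x / clip T t) ` {0..clip T t} = {0..1}"
    using c by (simp add: image_divide_atLeastAtMost)
  finally have "integral {0..1} (\<lambda>r. ?F (r * clip T t)) = (1 / clip T t) *\<^sub>R duhamel T a f t \<xi>"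
    by (simp add: integral_unique mult.commute)
  then show ?thesis using c by (simp add: scaleR_conv_of_real)
qed (simp add: duhamel_def)

lemma admissible_duhamel:
  assumes f: "admissible T A f"
  shows "admissible T (T * A) (duhamel T a f)"
  unfolding admissible_def
proof (intro conjI allI)
  note f = admissibleD[OF f]
  show "0 \<le> T * A" using T f(1) by simp
  let ?G = "\<lambda>z r. cis ((clip T (fst z) - r * clip T (fst z)) * a * snd z ^ 3) *
      (\<i> * of_real (snd z) * f (r * clip T (fst z)) (snd z))"
  have cf: "continuous_on S (\<lambda>z. f (\<sigma> z) (\<tau> z))" if "continuous_on S \<sigma>" "continuous_on S \<tau>" for S :: "((real \<times> real) \<times> real) set" and \<sigma> \<tau>
    using continuous_on_compose2[OF f(2) continuous_on_Pair[OF that]] by simp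
  have "continuous_on (UNIV \<times> cbox 0 1) (\<lambda>(z, r). ?G z r)"
    unfolding case_prod_beta by (intro continuous_intros cf)
  then have "continuous_on UNIV (\<lambda>z. integral (cbox 0 1) (?G z))"
    by (rule integral_continuous_on_param)
  then have "continuous_on UNIV (\<lambda>z. of_real (clip T (fst z)) * integral {0..1} (?G z))"
    by (intro continuous_intros) auto
  then show "continuous_on UNIV (\<lambda>(t, \<xi>). duhamel T a f t \<xi>)"
    unfolding duhamel_altdef[OF f(2)] case_prod_beta .
  fix t \<xi>
  let ?c = "clip T t" and ?e = "\<lambda>t'. exp (- ((2 - t' / T) * \<bar>\<xi>\<bar>))"
  have cf': "continuous_on S (\<lambda>t'. f t' \<xi>)" for S
    by (rule continuous_on_curry_snd[OF f(2)])
  \<comment> \<open>Differentiating the exponential in time produces exactly \<bar>\<xi>\<bar> / T,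
    so the factor \<bar>\<xi>\<bar> from the spatial derivative has an explicit primitive, at the
    price of one factor T.\<close>
  have FTC: "((\<lambda>t'. T * A * decay \<xi> * (?e t' * (\<bar>\<xi>\<bar> / T))) has_integral
      T * A * decay \<xi> * ?e ?c - T * A * decay \<xi> * ?e 0) {0..?c}"
    using T clip_bounds[of t]
    by (intro fundamental_theorem_of_calculus)
      (auto intro!: derivative_eq_intros simp flip: has_real_derivative_iff_has_vector_derivative)
  have "cmod (duhamel T a f t \<xi>) \<le> integral {0..?c} (\<lambda>t'. T * A * decay \<xi> * (?e t' * (\<bar>\<xi>\<bar> / T)))"
    unfolding duhamel_def
  proof (rule integral_norm_bound_integral)
    show "(\<lambda>t'. cis ((?c - t') * a * \<xi> ^ 3) * (\<i> * of_real \<xi> * f t' \<xi>)) integrable_on {0..?c}"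
      by (intro integrable_continuous_real continuous_intros cf')
    show "(\<lambda>t'. T * A * decay \<xi> * (?e t' * (\<bar>\<xi>\<bar> / T))) integrable_on {0..?c}"
      using FTC by blast
    fix t' assume "t' \<in> {0..?c}"
    then have "clip T t' = t'" using clip_bounds[of t] by (intro clip_eq) auto
    then have "cmod (f t' \<xi>) \<le> A * (?e t' * decay \<xi>)" using f(3)[of t' \<xi>] by (simp add: aweight_def)
    then have "\<bar>\<xi>\<bar> * cmod (f t' \<xi>) \<le> \<bar>\<xi>\<bar> * (A * (?e t' * decay \<xi>))" by (intro mult_left_mono) auto
    then show "norm (cis ((?c - t') * a * \<xi> ^ 3) * (\<i> * of_real \<xi> * f t' \<xi>)) \<le> T * A * decay \<xi> * (?e t' * (\<bar>\<xi>\<bar> / T))"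
      using T by (simp add: norm_mult mult_ac)
  qed
  also have "\<dots> = T * A * decay \<xi> * ?e ?c - T * A * decay \<xi> * ?e 0"
    using FTC by (rule integral_unique)
  also have "\<dots> \<le> T * A * aweight T t \<xi>"
    using T f(1) decay_pos[of \<xi>] by (simp add: aweight_def mult_ac)
  finally show "cmod (duhamel T a f t \<xi>) \<le> T * A * aweight T t \<xi>" .
qed

lemma admissible_free_evolution:
  assumes "continuous_on UNIV g" "0 \<le> A" "\<And>\<xi>. cmod (g \<xi>) \<le> A * (exp (- (2 * \<bar>\<xi>\<bar>)) * decay \<xi>)"
  shows "admissible T A (free_evolution T a g)"
  unfolding admissible_def
proof (intro conjI allI)
  show "continuous_on UNIV (\<lambda>(t, \<xi>). free_evolution T a g t \<xi>)"
    unfolding free_evolution_def case_prod_beta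
    by (intro continuous_intros continuous_on_compose2[OF assms(1) continuous_on_snd[OF continuous_on_id]]) auto
  fix t \<xi>
  have "cmod (free_evolution T a g t \<xi>) = cmod (g \<xi>)" by (simp add: free_evolution_def norm_mult)
  also have "\<dots> \<le> A * aweight T t \<xi>"
    by (rule order_trans[OF assms(3) mult_left_mono[OF aweight_le(2) assms(2)]])
  finally show "cmod (free_evolution T a g t \<xi>) \<le> A * aweight T t \<xi>" .
qed fact

lemma admissible_decode: "admissible T (norm u) (decode T u)"
  unfolding admissible_def
proof (intro conjI allI)
  show "continuous_on UNIV (\<lambda>(t, \<xi>). decode T u t \<xi>)"
    unfolding decode_def case_prod_beta
    by (intro continuous_on_mult continuous_on_of_real continuous_on_aweight) simp
  show "cmod (decode T u t \<xi>) \<le> norm u * aweight T t \<xi>" for t \<xi>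
    using mult_left_mono[OF norm_bounded[of u "(t, \<xi>)"], of "aweight T t \<xi>"] aweight_pos[of t \<xi>]
    by (simp add: decode_def norm_mult mult.commute)
qed simp

lemma apply_encode:
  assumes "admissible T A f"
  shows "apply_bcontfun (encode T f) (t, \<xi>) = f t \<xi> / of_real (aweight T t \<xi>)"
proof -
  note f = admissibleD[OF assms]
  have "(\<lambda>(t, \<xi>). f t \<xi> / of_real (aweight T t \<xi>)) \<in> bcontfun"
    unfolding bcontfun_def
  proof (intro CollectI conjI)
    show "continuous_on UNIV (\<lambda>(t, \<xi>). f t \<xi> / of_real (aweight T t \<xi>))"
      using f(2) aweight_pos unfolding case_prod_beta
      by (intro continuous_intros continuous_on_aweight) (auto simp: less_imp_neq[THEN not_sym])
    have "cmod (f t \<xi> / of_real (aweight T t \<xi>)) \<le> A" for t \<xi>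
      using f(3)[of t \<xi>] aweight_pos[of t \<xi>] by (simp add: norm_divide divide_le_eq)
    then show "bounded (range (\<lambda>(t, \<xi>). f t \<xi> / of_real (aweight T t \<xi>)))"
      by (intro boundedI[where B = A]) auto
  qed
  then show ?thesis by (simp add: encode_def Bcontfun_inverse)
qed

lemma decode_encode: "admissible T A f \<Longrightarrow> decode T (encode T f) = f"
  using aweight_pos by (auto simp: decode_def fun_eq_iff apply_encode less_imp_neq[THEN not_sym])

lemma norm_encode:
  assumes "admissible T A f"
  shows "norm (encode T f) \<le> A"
proof (rule norm_bound)
  fix z :: "real \<times> real"
  show "norm (encode T f z) \<le> A"
    using admissibleD(3)[OF assms, of "fst z" "snd z"] aweight_pos[of "fst z" "snd z"]
    by (cases z) (simp add: apply_encode[OF assms] norm_divide divide_le_eq)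
qed

lemma decode_add: "decode T (u + v) = (\<lambda>t \<xi>. decode T u t \<xi> + decode T v t \<xi>)"
  and decode_uminus: "decode T (- u) = (\<lambda>t \<xi>. - decode T u t \<xi>)"
  and decode_scaleR: "decode T (c *\<^sub>R u) = (\<lambda>t \<xi>. of_real c * decode T u t \<xi>)"
  by (auto simp: decode_def fun_eq_iff algebra_simps scaleR_conv_of_real)

text \<open>Identities between encoded functions can thus be checked after decoding, where the
  operators have explicit formulas.\<close>

lemma decode_inject: "decode T u = decode T v \<longleftrightarrow> u = v"
proof
  assume eq: "decode T u = decode T v"
  have "u (t, \<xi>) = v (t, \<xi>)" for t \<xi>
    using aweight_pos[of t \<xi>] fun_cong[OF fun_cong[OF eq], of t \<xi>] by (simp add: decode_def)
  then show "u = v" by (intro bcontfun_eqI) auto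
qed simp

section \<open>Linearity of the cubic operator in each argument\<close>

lemma conv_add:
  assumes "cont_decay A f" "cont_decay B f'" "cont_decay C g"
  shows "conv (\<lambda>\<xi>. f \<xi> + f' \<xi>) g = (\<lambda>\<xi>. conv f g \<xi> + conv f' g \<xi>)"
    and "conv g (\<lambda>\<xi>. f \<xi> + f' \<xi>) = (\<lambda>\<xi>. conv g f \<xi> + conv g f' \<xi>)"
proof -
  note f = cont_decayD[OF assms(1)] and f' = cont_decayD[OF assms(2)] and g = cont_decayD[OF assms(3)]
  show "conv (\<lambda>\<xi>. f \<xi> + f' \<xi>) g = (\<lambda>\<xi>. conv f g \<xi> + conv f' g \<xi>)"
    unfolding conv_def distrib_right fun_eq_iff
    by (intro allI Bochner_Integration.integral_add integrable_conv_integrand[OF f(5) g(5) f(4) g(3)]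
        integrable_conv_integrand[OF f'(5) g(5) f'(4) g(3)])
  show "conv g (\<lambda>\<xi>. f \<xi> + f' \<xi>) = (\<lambda>\<xi>. conv g f \<xi> + conv g f' \<xi>)"
    unfolding conv_def distrib_left fun_eq_iff
    by (intro allI Bochner_Integration.integral_add integrable_conv_integrand[OF g(5) f(5) g(4) f(3)]
        integrable_conv_integrand[OF g(5) f'(5) g(4) f'(3)])
qed

lemma conv_scale:
  "conv (\<lambda>\<xi>. c * f \<xi>) g = (\<lambda>\<xi>. c * conv f g \<xi>)" "conv f (\<lambda>\<xi>. c * g \<xi>) = (\<lambda>\<xi>. c * conv f g \<xi>)"
  unfolding conv_def by (simp_all add: mult.assoc mult.left_commute[of _ c])

lemma duhamel_add:
  assumes "admissible T A f" "admissible T B g"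
  shows "duhamel T a (\<lambda>t \<xi>. f t \<xi> + g t \<xi>) = (\<lambda>t \<xi>. duhamel T a f t \<xi> + duhamel T a g t \<xi>)"
proof (intro ext)
  fix t \<xi>
  have cf: "continuous_on S (\<lambda>t'. f t' \<xi>)" "continuous_on S (\<lambda>t'. g t' \<xi>)" for S
    by (rule continuous_on_curry_snd[OF admissibleD(2)[OF assms(1)]], rule continuous_on_curry_snd[OF admissibleD(2)[OF assms(2)]])
  show "duhamel T a (\<lambda>t \<xi>. f t \<xi> + g t \<xi>) t \<xi> = duhamel T a f t \<xi> + duhamel T a g t \<xi>"
    unfolding duhamel_def distrib_left
    by (intro Henstock_Kurzweil_Integration.integral_add integrable_continuous_real continuous_intros cf)
qed

lemma duhamel_scale: "duhamel T a (\<lambda>t \<xi>. c * f t \<xi>) = (\<lambda>t \<xi>. c * duhamel T a f t \<xi>)"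
proof (intro ext)
  fix t \<xi>
  have "duhamel T a (\<lambda>t \<xi>. c * f t \<xi>) t \<xi>
      = integral {0..clip T t} (\<lambda>t'. c * (cis ((clip T t - t') * a * \<xi> ^ 3) * (\<i> * of_real \<xi> * f t' \<xi>)))"
    unfolding duhamel_def by (simp only: mult_ac)
  then show "duhamel T a (\<lambda>t \<xi>. c * f t \<xi>) t \<xi> = c * duhamel T a f t \<xi>"
    unfolding duhamel_def by (simp only: Henstock_Kurzweil_Integration.integral_mult_right)
qed

lemma admissible_duhamel_triple_decode:
  "admissible T (4 * T * norm u * norm v * norm w) (duhamel T a (triple (decode T u) (decode T v) (decode T w)))"
  using admissible_duhamel[OF admissible_triple[OF admissible_decode admissible_decode admissible_decode], of u v w a] by (simp add: mult_ac)

lemma decode_cubic: "decode T (cubic T a u v w) = (\<lambda>t \<xi>. - duhamel T a (triple (decode T u) (decode T v) (decode T w)) t \<xi>)"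
  unfolding cubic_def decode_uminus decode_encode[OF admissible_duhamel_triple_decode] ..

text \<open>The 4 stems from the triple convolution and the T from the Duhamel integral. As T is
  arbitrary, smallness has to come from the data.\<close>

lemma bdd_trilinear_cubic: "bdd_trilinear (4 * T) (cubic T a)"
  unfolding bdd_trilinear_def
proof (intro conjI allI)
  note decode = admissibleD(4)[OF admissible_decode]
  note dconv = cont_decay_conv[OF decode decode]
  note adm3 = admissible_triple[OF admissible_decode admissible_decode admissible_decode]
  fix u v w
  show "norm (cubic T a u v w) \<le> 4 * T * norm u * norm v * norm w"
    unfolding cubic_def norm_minus_cancel by (rule norm_encode[OF admissible_duhamel_triple_decode])
  show "linear (\<lambda>u. cubic T a u v w)"
  proof (rule linearI)
    fix x y c
    have "triple (decode T (x + y)) (decode T v) (decode T w) =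
        (\<lambda>t \<xi>. triple (decode T x) (decode T v) (decode T w) t \<xi> + triple (decode T y) (decode T v) (decode T w) t \<xi>)"
      unfolding triple_def decode_add conv_add(1)[OF decode decode decode] conv_add(1)[OF dconv dconv decode] distrib_left ..
    then show "cubic T a (x + y) v w = cubic T a x v w + cubic T a y v w"
      by (simp add: decode_inject[symmetric] decode_add decode_cubic duhamel_add[OF adm3 adm3])
    have "triple (decode T (c *\<^sub>R x)) (decode T v) (decode T w) = (\<lambda>t \<xi>. of_real c * triple (decode T x) (decode T v) (decode T w) t \<xi>)"
      unfolding triple_def decode_scaleR conv_scale by (simp only: mult_ac)
    then show "cubic T a (c *\<^sub>R x) v w = c *\<^sub>R cubic T a x v w"
      by (simp add: decode_inject[symmetric] decode_scaleR decode_cubic duhamel_scale)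
  qed
  show "linear (\<lambda>v. cubic T a u v w)"
  proof (rule linearI)
    fix x y c
    have "triple (decode T u) (decode T (x + y)) (decode T w) =
        (\<lambda>t \<xi>. triple (decode T u) (decode T x) (decode T w) t \<xi> + triple (decode T u) (decode T y) (decode T w) t \<xi>)"
      unfolding triple_def decode_add conv_add(2)[OF decode decode decode] conv_add(1)[OF dconv dconv decode] distrib_left ..
    then show "cubic T a u (x + y) w = cubic T a u x w + cubic T a u y w"
      by (simp add: decode_inject[symmetric] decode_add decode_cubic duhamel_add[OF adm3 adm3])
    have "triple (decode T u) (decode T (c *\<^sub>R x)) (decode T w) = (\<lambda>t \<xi>. of_real c * triple (decode T u) (decode T x) (decode T w) t \<xi>)"
      unfolding triple_def decode_scaleR conv_scale by (simp only: mult_ac)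
    then show "cubic T a u (c *\<^sub>R x) w = c *\<^sub>R cubic T a u x w"
      by (simp add: decode_inject[symmetric] decode_scaleR decode_cubic duhamel_scale)
  qed
  show "linear (\<lambda>w. cubic T a u v w)"
  proof (rule linearI)
    fix x y c
    have "triple (decode T u) (decode T v) (decode T (x + y)) =
        (\<lambda>t \<xi>. triple (decode T u) (decode T v) (decode T x) t \<xi> + triple (decode T u) (decode T v) (decode T y) t \<xi>)"
      unfolding triple_def decode_add conv_add(2)[OF decode decode dconv] distrib_left ..
    then show "cubic T a u v (x + y) = cubic T a u v x + cubic T a u v y"
      by (simp add: decode_inject[symmetric] decode_add decode_cubic duhamel_add[OF adm3 adm3])
    have "triple (decode T u) (decode T v) (decode T (c *\<^sub>R x)) = (\<lambda>t \<xi>. of_real c * triple (decode T u) (decode T v) (decode T x) t \<xi>)"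
      unfolding triple_def decode_scaleR conv_scale by (simp only: mult_ac)
    then show "cubic T a u v (c *\<^sub>R x) = c *\<^sub>R cubic T a u v x"
      by (simp add: decode_inject[symmetric] decode_scaleR decode_cubic duhamel_scale)
  qed
qed

end

section \<open>Smooth solutions and their expansion\<close>

context
  fixes T :: real
  assumes T: "0 < T"
begin

text \<open>A majorant that is independent of time lies in every H^\<sigma>. Dominated convergence
  then turns pointwise continuity in time into continuity in norm.\<close>

lemma smooth_curve_admissible:
  assumes "admissible T A p"
  shows "smooth_curve T p"
  unfolding smooth_curve_def
proof (intro allI conjI ballI)
  fix \<sigma> t
  note p = admissibleD[OF T assms]
  obtain C where C: "\<And>f A. f \<in> borel_measurable borel \<Longrightarrow> 0 \<le> A \<Longrightarrow>
      (\<And>\<xi>. cmod (f \<xi>) \<le> A * exp (- \<bar>\<xi>\<bar>) * decay \<xi>) \<Longrightarrow> in_Hs \<sigma> f"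
    using Hs_of_exp_decay[of \<sigma>] by blast
  show in_Hs: "in_Hs \<sigma> (p t)" for t
    by (rule C[OF p(8) p(1) p(5)])
  define g where "g = (\<lambda>\<xi>. of_real (A * exp (- \<bar>\<xi>\<bar>) * decay \<xi>) :: complex)"
  have g: "in_Hs \<sigma> g"
    unfolding g_def by (rule C[OF _ p(1)]) (use p(1) in \<open>auto simp: norm_mult decay_pos less_imp_le\<close>)
  have dom: "(cmod (weight \<sigma> (p t) \<xi> - weight \<sigma> (p t') \<xi>))\<^sup>2 \<le> 4 * (cmod (weight \<sigma> g \<xi>))\<^sup>2" for t t' \<xi>
  proof -
    have "cmod (weight \<sigma> (p t) \<xi>) \<le> cmod (weight \<sigma> g \<xi>)" for t
      unfolding weight_def norm_mult
      by (intro mult_left_mono) (use p(1) p(5)[of t \<xi>] in \<open>auto simp: g_def norm_mult decay_pos less_imp_le\<close>)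
    from this[of t] this[of t']
    have "cmod (weight \<sigma> (p t) \<xi> - weight \<sigma> (p t') \<xi>) \<le> 2 * cmod (weight \<sigma> g \<xi>)"
      using norm_triangle_ineq4[of "weight \<sigma> (p t) \<xi>" "weight \<sigma> (p t') \<xi>"] by linarith
    then have "(cmod (weight \<sigma> (p t) \<xi> - weight \<sigma> (p t') \<xi>))\<^sup>2 \<le> (2 * cmod (weight \<sigma> g \<xi>))\<^sup>2"
      by (intro power_mono) auto
    then show ?thesis by (simp add: power_mult_distrib)
  qed
  have [measurable]: "weight \<sigma> (p t) \<in> borel_measurable lborel" for t
    using in_Hs by (simp add: in_Hs_def sq_int_def)
  have "continuous_on UNIV (\<lambda>t. Hs_of \<sigma> (p t))"
  proof (rule continuous_on_sequentiallyI)
    fix u :: "nat \<Rightarrow> real" and t assume u: "u \<longlonglongrightarrow> t"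
    have norm_eq: "(norm (Hs_of \<sigma> (p (u n)) - Hs_of \<sigma> (p t)))\<^sup>2
        = (LINT \<xi>|lborel. (cmod (weight \<sigma> (p (u n)) \<xi> - weight \<sigma> (p t) \<xi>))\<^sup>2)" for n
      unfolding Hs_of_diff[OF in_Hs in_Hs, symmetric]
      unfolding Hs_of_def weight_diff
      by (rule norm_abs_L2) (use in_Hs in \<open>auto simp: in_Hs_def intro: sq_int_diff\<close>)
    have "(\<lambda>n. LINT \<xi>|lborel. (cmod (weight \<sigma> (p (u n)) \<xi> - weight \<sigma> (p t) \<xi>))\<^sup>2)
        \<longlonglongrightarrow> integral\<^sup>L (lborel :: real measure) (\<lambda>_. 0 :: real)"
    proof (rule integral_dominated_convergence[where w = "\<lambda>\<xi>. 4 * (cmod (weight \<sigma> g \<xi>))\<^sup>2"])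
      show "integrable lborel (\<lambda>\<xi>. 4 * (cmod (weight \<sigma> g \<xi>))\<^sup>2)"
        using g by (simp add: in_Hs_def sq_int_def)
      show "AE \<xi> in lborel. (\<lambda>n. (cmod (weight \<sigma> (p (u n)) \<xi> - weight \<sigma> (p t) \<xi>))\<^sup>2) \<longlonglongrightarrow> 0"
      proof (rule AE_I2)
        fix \<xi>
        have "(\<lambda>n. p (u n) \<xi>) \<longlonglongrightarrow> p t \<xi>"
          by (rule continuous_on_tendsto_compose[OF continuous_on_curry_snd[OF p(2), of UNIV] u]) auto
        then have "(\<lambda>n. (cmod (weight \<sigma> (p (u n)) \<xi> - weight \<sigma> (p t) \<xi>))\<^sup>2)
            \<longlonglongrightarrow> (cmod (weight \<sigma> (p t) \<xi> - weight \<sigma> (p t) \<xi>))\<^sup>2"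
          unfolding weight_def by (intro tendsto_intros)
        then show "(\<lambda>n. (cmod (weight \<sigma> (p (u n)) \<xi> - weight \<sigma> (p t) \<xi>))\<^sup>2) \<longlonglongrightarrow> 0" by simp
      qed
    qed (use dom in auto)
    then have "(\<lambda>n. sqrt ((norm (Hs_of \<sigma> (p (u n)) - Hs_of \<sigma> (p t)))\<^sup>2)) \<longlonglongrightarrow> sqrt 0"
      unfolding norm_eq by (intro tendsto_intros) simp
    then show "(\<lambda>n. Hs_of \<sigma> (p (u n))) \<longlonglongrightarrow> Hs_of \<sigma> (p t)"
      by (simp add: tendsto_norm_zero_iff LIM_zero_iff)
  qed
  then show "continuous_on {0..T} (\<lambda>t. Hs_of \<sigma> (p t))"
    by (rule continuous_on_subset) simp
qed

text \<open>Translates a fixed point on the Fourier side into the equation with its nonlinearity in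
  physical space; for times in [0,T] \<open>clip\<close> is the identity.\<close>

lemma integral_eq_triple:
  assumes f: "admissible T A f" and g: "admissible T B g" and h: "admissible T C h"
    and p: "\<And>t \<xi>. p t \<xi> = free_evolution T a \<phi> t \<xi> - duhamel T a (triple f g h) t \<xi>"
  shows "integral_eq a T p (\<lambda>t x. inv_fourier (f t) x * inv_fourier (g t) x * inv_fourier (h t) x)"
    and "p 0 = \<phi>"
proof -
  have "clip T 0 = 0" using T by (simp add: clip_eq)
  then show p0: "p 0 = \<phi>"
    by (simp add: fun_eq_iff p free_evolution_def duhamel_def)
  have "fourier (\<lambda>x. inv_fourier (f t) x * inv_fourier (g t) x * inv_fourier (h t) x) \<xi> = triple f g h t \<xi>" for t \<xi>
    unfolding triple_def
    by (rule fourier_triple_product[OF admissibleD(4)[OF T f] admissibleD(4)[OF T g] admissibleD(4)[OF T h]])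
  then show "integral_eq a T p (\<lambda>t x. inv_fourier (f t) x * inv_fourier (g t) x * inv_fourier (h t) x)"
    unfolding integral_eq_def p0 by (auto simp: p clip_eq free_evolution_def duhamel_def)
qed

lemma smooth_solution_decode:
  assumes \<phi>: "admissible T A (free_evolution T 1 \<phi>)" and \<psi>: "admissible T B (free_evolution T \<alpha> \<psi>)"
    and u: "u = encode T (free_evolution T 1 \<phi>) + cubic T 1 u v v"
    and v: "v = encode T (free_evolution T \<alpha> \<psi>) + cubic T \<alpha> u u v"
  shows "smooth_solution \<alpha> T (decode T u) (decode T v)" "decode T u 0 = \<phi>" "decode T v 0 = \<psi>"
proof -
  note d = admissible_decode[OF T]
  have eq: "decode T u t \<xi> = free_evolution T 1 \<phi> t \<xi> - duhamel T 1 (triple (decode T u) (decode T v) (decode T v)) t \<xi>"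
    "decode T v t \<xi> = free_evolution T \<alpha> \<psi> t \<xi> - duhamel T \<alpha> (triple (decode T u) (decode T u) (decode T v)) t \<xi>" for t \<xi>
    by (subst u, simp add: decode_add[OF T] decode_encode[OF T \<phi>] decode_cubic[OF T])
      (subst v, simp add: decode_add[OF T] decode_encode[OF T \<psi>] decode_cubic[OF T])
  show "smooth_solution \<alpha> T (decode T u) (decode T v)"
    unfolding smooth_solution_def Let_def
    using integral_eq_triple(1)[OF d d d eq(1)] integral_eq_triple(1)[OF d d d eq(2)]
    by (auto simp: power2_eq_square mult.assoc intro!: smooth_curve_admissible[OF d])
  show "decode T u 0 = \<phi>" "decode T v 0 = \<psi>"
    using integral_eq_triple(2)[OF d d d eq(1)] integral_eq_triple(2)[OF d d d eq(2)] by auto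
qed

text \<open>The constant sequence of approximations identifies the abstract solution on smooth data.\<close>

lemma solution_of_smooth_solution:
  assumes S: "is_solution X s \<alpha> T (\<phi>, \<psi>) z" and pq: "smooth_solution \<alpha> T p q"
    and "Hs_of s (p 0) = \<phi>" "Hs_of s (q 0) = \<psi>" "\<phi> \<in> X" "\<psi> \<in> X" and t: "t \<in> {0..T}"
  shows "apply_bcontfun (fst z) t = Hs_of s (p t)"
proof -
  have "smooth_approx X s \<alpha> T \<phi> \<psi> (\<lambda>_. p) (\<lambda>_. q)"
    using assms by (simp add: smooth_approx_def)
  then have "uniform_limit {0..T} (\<lambda>n t. Hs_of s (p t)) (fst z) sequentially"
    using S unfolding is_solution_def by (auto simp: case_prod_beta)
  from tendsto_uniform_limitI[OF this t] show ?thesis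
    by (simp add: tendsto_const_iff)
qed

text \<open>Pairing with e at time T turns S along a ray into a scalar function of \<delta>. The
  fixed point for the scaled data is a smooth solution, hence gives the value of S, and the
  expansion of the fixed point, with cubic term - w, becomes that of S.\<close>

lemma solution_map_expansion:
  assumes S: "data_to_solution_map X s \<alpha> T U S" and X: "X = UNIV \<or> X = real_valued"
    and \<phi>: "continuous_on UNIV \<phi>" "\<And>\<xi>. cmod (\<phi> \<xi>) \<le> A * (exp (- (2 * \<bar>\<xi>\<bar>)) * decay \<xi>)" "\<And>\<xi>. \<phi> (- \<xi>) = cnj (\<phi> \<xi>)"
    and \<psi>: "continuous_on UNIV \<psi>" "\<And>\<xi>. cmod (\<psi> \<xi>) \<le> A * (exp (- (2 * \<bar>\<xi>\<bar>)) * decay \<xi>)" "\<And>\<xi>. \<psi> (- \<xi>) = cnj (\<psi> \<xi>)"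
    and A: "0 \<le> A"
  defines "w \<equiv> duhamel T 1 (triple (free_evolution T 1 \<phi>) (free_evolution T \<alpha> \<psi>) (free_evolution T \<alpha> \<psi>))"
  shows "in_Hs s \<phi>" "in_Hs s \<psi>" "in_Hs s (w t)" "Hs_of s \<phi> \<in> X" "Hs_of s \<psi> \<in> X"
    and "\<exists>\<delta>\<^sub>0>0. \<exists>a c. \<forall>\<delta>. 0 \<le> \<delta> \<longrightarrow> \<delta> \<le> \<delta>\<^sub>0 \<longrightarrow>
      \<bar>inner (apply_bcontfun (fst (S (\<delta> *\<^sub>R (Hs_of s \<phi>, Hs_of s \<psi>)))) T) e - \<delta> * a - \<delta> ^ 3 * (- inner (Hs_of s (w T)) e)\<bar> \<le> c * \<delta> ^ 5"
proof -
  note admissible\<phi> = admissible_free_evolution[OF T \<phi>(1) A \<phi>(2), of 1]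
  note admissible\<psi> = admissible_free_evolution[OF T \<psi>(1) A \<psi>(2), of \<alpha>]
  have admw: "admissible T (T * (4 * (A * A * A))) w"
    unfolding w_def by (intro admissible_duhamel[OF T] admissible_triple[OF T] admissible\<phi> admissible\<psi>)
  obtain C where C0: "0 \<le> C" and C: "\<And>f A. f \<in> borel_measurable borel \<Longrightarrow> 0 \<le> A \<Longrightarrow>
      (\<And>\<xi>. cmod (f \<xi>) \<le> A * exp (- \<bar>\<xi>\<bar>) * decay \<xi>) \<Longrightarrow> in_Hs s f"
    "\<And>f A. f \<in> borel_measurable borel \<Longrightarrow> 0 \<le> A \<Longrightarrow>
      (\<And>\<xi>. cmod (f \<xi>) \<le> A * exp (- \<bar>\<xi>\<bar>) * decay \<xi>) \<Longrightarrow> norm (Hs_of s f) \<le> C * A"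
    using Hs_of_exp_decay[of s] by blast
  have in_Hs: "in_Hs s (f t)" if "admissible T B f" for B f t
    by (rule C(1)[OF admissibleD(8)[OF T that] admissibleD(1)[OF T that] admissibleD(5)[OF T that]])
  have free0: "free_evolution T a f 0 = f" for a f
    using T by (simp add: free_evolution_def fun_eq_iff clip_def)
  show in\<phi>: "in_Hs s \<phi>" using in_Hs[OF admissible\<phi>, of 0] by (simp add: free0)
  show in\<psi>: "in_Hs s \<psi>" using in_Hs[OF admissible\<psi>, of 0] by (simp add: free0)
  show "in_Hs s (w t)" by (rule in_Hs[OF admw])
  \<comment> \<open>The whole ray has to consist of data in X, since S is specified only
    there.\<close>
  have X_scale: "\<delta> *\<^sub>R Hs_of s f \<in> X" if f: "in_Hs s f" "\<And>\<xi>. f (- \<xi>) = cnj (f \<xi>)" for f \<delta>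
  proof -
    have "in_Hs s (\<lambda>\<xi>. \<delta> *\<^sub>R f \<xi>)"
      using f(1) unfolding in_Hs_def weight_scaleR by (rule sq_int_scaleR)
    then have "Hs_of s (\<lambda>\<xi>. \<delta> *\<^sub>R f \<xi>) \<in> real_valued"
      by (rule Hs_of_real_valued) (simp add: f(2))
    then show ?thesis using X unfolding Hs_of_scaleR[OF f(1)] by auto
  qed
  have X\<phi>: "\<delta> *\<^sub>R Hs_of s \<phi> \<in> X" and X\<psi>: "\<delta> *\<^sub>R Hs_of s \<psi> \<in> X" for \<delta>
    by (rule X_scale in\<phi> in\<psi> \<phi> \<psi>)+
  show "Hs_of s \<phi> \<in> X" "Hs_of s \<psi> \<in> X" using X\<phi>[of 1] X\<psi>[of 1] by simp_all
  let ?h = "(Hs_of s \<phi>, Hs_of s \<psi>)"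
  have "open U" "0 \<in> U" and sol: "\<And>z. z \<in> U \<Longrightarrow> z \<in> X \<times> X \<Longrightarrow> is_solution X s \<alpha> T z (S z)"
    using S by (auto simp: data_to_solution_map_def)
  then obtain r where r: "0 < r" "ball 0 r \<subseteq> U" using open_contains_ball by blast
  define x y where "x = encode T (free_evolution T 1 \<phi>)" and "y = encode T (free_evolution T \<alpha> \<psi>)"
  have xy: "norm x \<le> A" "norm y \<le> A"
    unfolding x_def y_def by (rule norm_encode[OF T] admissible\<phi> admissible\<psi>)+
  \<comment> \<open>Evaluation at time T, paired with e, as a functional on encoded curves. Being
    linear and bounded it carries remainder estimates from the weighted supremum norm over to
    H^s.\<close>
  define J where "J = (\<lambda>u. inner (Hs_of s (decode T u T)) e)"
  have J_add: "J (u + v) = J u + J v" for u v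
    unfolding J_def decode_add[OF T] by (simp add: Hs_of_add in_Hs[OF admissible_decode[OF T]] inner_add_left)
  have J_scale: "J (c *\<^sub>R u) = c * J u" for c u
    unfolding J_def decode_scaleR[OF T] by (simp add: Hs_of_scaleR[OF in_Hs[OF admissible_decode[OF T]], unfolded scaleR_conv_of_real])
  have J_bound: "\<bar>J u\<bar> \<le> C * norm u * norm e" for u
  proof -
    have "norm (Hs_of s (decode T u T)) \<le> C * norm u"
      by (rule C(2)) (rule admissibleD[OF T admissible_decode[OF T]])+
    then show ?thesis
      unfolding J_def using Cauchy_Schwarz_ineq2[of "Hs_of s (decode T u T)" e]
        mult_right_mono[of "norm (Hs_of s (decode T u T))" "C * norm u" "norm e"] by auto
  qed
  have J_w: "J (cubic T 1 x y y) = - inner (Hs_of s (w T)) e"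
  proof -
    have "decode T (cubic T 1 x y y) T = (\<lambda>\<xi>. - 1 *\<^sub>R w T \<xi>)"
      unfolding decode_cubic[OF T] x_def y_def decode_encode[OF T admissible\<phi>] decode_encode[OF T admissible\<psi>] w_def by simp
    then have "Hs_of s (decode T (cubic T 1 x y y) T) = - 1 *\<^sub>R Hs_of s (w T)"
      by (simp only: Hs_of_scaleR[OF in_Hs[OF admw]])
    then show ?thesis by (simp add: J_def)
  qed
  \<comment> \<open>The last condition is the smallness required by the fixed point lemma for M = 4
    T and \<rho> = \<delta> A: small data take the place of a short time.\<close>
  have bound: "\<bar>inner (apply_bcontfun (fst (S (\<delta> *\<^sub>R ?h))) T) e - \<delta> * J x - \<delta> ^ 3 * (- inner (Hs_of s (w T)) e)\<bar>
      \<le> C * norm e * (96 * (4 * T)\<^sup>2 * A ^ 5) * \<delta> ^ 5"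
    if \<delta>: "0 \<le> \<delta>" "\<delta> * norm ?h < r" "48 * (4 * T) * (\<delta> * A)\<^sup>2 \<le> 1" for \<delta>
  proof -
    have "norm (\<delta> *\<^sub>R x) \<le> \<delta> * A" "norm (\<delta> *\<^sub>R y) \<le> \<delta> * A"
      using \<delta>(1) xy by (auto intro: mult_left_mono)
    with cubic_system_solution[OF bdd_trilinear_cubic[OF T, of 1] bdd_trilinear_cubic[OF T, of \<alpha>],
        of "\<delta> *\<^sub>R x" "\<delta> * A" "\<delta> *\<^sub>R y"] \<delta>(3) T
    obtain u v where uv: "u = \<delta> *\<^sub>R x + cubic T 1 u v v" "v = \<delta> *\<^sub>R y + cubic T \<alpha> u u v"
      and rem: "norm (u - \<delta> *\<^sub>R x - cubic T 1 (\<delta> *\<^sub>R x) (\<delta> *\<^sub>R y) (\<delta> *\<^sub>R y)) \<le> 96 * (4 * T)\<^sup>2 * (\<delta> * A) ^ 5"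
      by auto
    have free_scale: "free_evolution T a (\<lambda>\<xi>. \<delta> *\<^sub>R f \<xi>) = (\<lambda>t \<xi>. of_real \<delta> * free_evolution T a f t \<xi>)" for a f
      by (simp add: free_evolution_def fun_eq_iff scaleR_conv_of_real)
    have admd: "admissible T (cmod (of_real \<delta>) * A) (free_evolution T 1 (\<lambda>\<xi>. \<delta> *\<^sub>R \<phi> \<xi>))"
      "admissible T (cmod (of_real \<delta>) * A) (free_evolution T \<alpha> (\<lambda>\<xi>. \<delta> *\<^sub>R \<psi> \<xi>))"
      unfolding free_scale by (rule admissible_scale[OF T admissible\<phi>] admissible_scale[OF T admissible\<psi>])+
    have "\<delta> *\<^sub>R x = encode T (free_evolution T 1 (\<lambda>\<xi>. \<delta> *\<^sub>R \<phi> \<xi>))" "\<delta> *\<^sub>R y = encode T (free_evolution T \<alpha> (\<lambda>\<xi>. \<delta> *\<^sub>R \<psi> \<xi>))"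
      unfolding decode_inject[OF T, symmetric] decode_scaleR[OF T] x_def y_def
        decode_encode[OF T admissible\<phi>] decode_encode[OF T admissible\<psi>] decode_encode[OF T admd(1)] decode_encode[OF T admd(2)] by (simp_all add: free_scale)
    note sm = smooth_solution_decode[OF admd uv[unfolded this]]
    have "\<delta> *\<^sub>R ?h \<in> U" using r \<delta> by (auto simp del: scaleR_Pair)
    then have "is_solution X s \<alpha> T (\<delta> *\<^sub>R Hs_of s \<phi>, \<delta> *\<^sub>R Hs_of s \<psi>) (S (\<delta> *\<^sub>R ?h))"
      using sol[of "\<delta> *\<^sub>R ?h"] X\<phi>[of \<delta>] X\<psi>[of \<delta>] by simp
    then have "apply_bcontfun (fst (S (\<delta> *\<^sub>R ?h))) T = Hs_of s (decode T u T)"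
      by (rule solution_of_smooth_solution[OF _ sm(1)])
        (use sm(2,3) X\<phi>[of \<delta>] X\<psi>[of \<delta>] T in \<open>auto simp: Hs_of_scaleR in\<phi> in\<psi>\<close>)
    then have "inner (apply_bcontfun (fst (S (\<delta> *\<^sub>R ?h))) T) e = J u" by (simp add: J_def)
    also have "\<dots> = J (\<delta> *\<^sub>R x + \<delta> ^ 3 *\<^sub>R cubic T 1 x y y + (u - \<delta> *\<^sub>R x - cubic T 1 (\<delta> *\<^sub>R x) (\<delta> *\<^sub>R y) (\<delta> *\<^sub>R y)))"
      by (simp add: bdd_trilinear_scaleR[OF bdd_trilinear_cubic[OF T]] power3_eq_cube)
    also have "\<dots> = \<delta> * J x + \<delta> ^ 3 * (- inner (Hs_of s (w T)) e) + J (u - \<delta> *\<^sub>R x - cubic T 1 (\<delta> *\<^sub>R x) (\<delta> *\<^sub>R y) (\<delta> *\<^sub>R y))"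
      by (simp only: J_add J_scale J_w)
    finally have "\<bar>inner (apply_bcontfun (fst (S (\<delta> *\<^sub>R ?h))) T) e - \<delta> * J x - \<delta> ^ 3 * (- inner (Hs_of s (w T)) e)\<bar>
        = \<bar>J (u - \<delta> *\<^sub>R x - cubic T 1 (\<delta> *\<^sub>R x) (\<delta> *\<^sub>R y) (\<delta> *\<^sub>R y))\<bar>" by simp
    also have "\<dots> \<le> C * norm (u - \<delta> *\<^sub>R x - cubic T 1 (\<delta> *\<^sub>R x) (\<delta> *\<^sub>R y) (\<delta> *\<^sub>R y)) * norm e"
      by (rule J_bound)
    also have "\<dots> \<le> C * (96 * (4 * T)\<^sup>2 * (\<delta> * A) ^ 5) * norm e"
      by (intro mult_right_mono mult_left_mono rem C0) auto
    finally show ?thesis by (simp only: power_mult_distrib mult_ac)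
  qed
  have "((\<lambda>\<delta>. \<delta> * norm ?h) \<longlongrightarrow> 0 * norm ?h) (at_right 0)"
    "((\<lambda>\<delta>. 48 * (4 * T) * (\<delta> * A)\<^sup>2) \<longlongrightarrow> 48 * (4 * T) * (0 * A)\<^sup>2) (at_right 0)"
    by (intro tendsto_intros)+
  then have "\<forall>\<^sub>F \<delta> in at_right 0. \<delta> * norm ?h < r" "\<forall>\<^sub>F \<delta> in at_right 0. 48 * (4 * T) * (\<delta> * A)\<^sup>2 < 1"
    using r(1) by (auto intro: order_tendstoD)
  then have "\<forall>\<^sub>F \<delta> in at_right 0. \<delta> * norm ?h < r \<and> 48 * (4 * T) * (\<delta> * A)\<^sup>2 < 1"
    by (rule eventually_conj)
  then obtain b where b: "0 < b" "\<And>\<delta>. 0 < \<delta> \<Longrightarrow> \<delta> < b \<Longrightarrow> \<delta> * norm ?h < r \<and> 48 * (4 * T) * (\<delta> * A)\<^sup>2 < 1"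
    unfolding eventually_at_right_field by blast
  \<comment> \<open>The filter excludes \<delta> = 0, which is treated by itself, and b / 2 turns
    the open range into a closed one.\<close>
  have "\<delta> * norm ?h < r \<and> 48 * (4 * T) * (\<delta> * A)\<^sup>2 \<le> 1" if "0 \<le> \<delta>" "\<delta> \<le> b / 2" for \<delta>
    using b(2)[of \<delta>] that r(1) b(1) by (cases "\<delta> = 0") (auto simp del: norm_Pair)
  then show "\<exists>\<delta>\<^sub>0>0. \<exists>a c. \<forall>\<delta>. 0 \<le> \<delta> \<longrightarrow> \<delta> \<le> \<delta>\<^sub>0 \<longrightarrow>
      \<bar>inner (apply_bcontfun (fst (S (\<delta> *\<^sub>R ?h))) T) e - \<delta> * a - \<delta> ^ 3 * (- inner (Hs_of s (w T)) e)\<bar> \<le> c * \<delta> ^ 5"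
    using bound b(1) by (intro exI[of _ "b / 2"] conjI exI[of _ "J x"] exI[of _ "C * norm e * (96 * (4 * T)\<^sup>2 * A ^ 5)"]) auto
qed

end

section \<open>The resonant interaction\<close>

text \<open>The inner modulus produces bumps at both N and - N, so that the datum is real-valued. A
  continuous profile, unlike an indicator, fits into the space of continuous functions used for the
  fixed point.\<close>

definition tent :: "real \<Rightarrow> real \<Rightarrow> real \<Rightarrow> real" where
  "tent N \<gamma> \<xi> = max 0 (1 - \<bar>\<bar>\<xi>\<bar> - N\<bar> / \<gamma>)"

lemma tent_nonneg: "0 \<le> tent N \<gamma> \<xi>"
  by (simp add: tent_def)

lemma tent_minus [simp]: "tent N \<gamma> (- \<xi>) = tent N \<gamma> \<xi>"
  by (simp add: tent_def)

lemma tent_eq_0: "0 < \<gamma> \<Longrightarrow> \<gamma> \<le> \<bar>\<bar>\<xi>\<bar> - N\<bar> \<Longrightarrow> tent N \<gamma> \<xi> = 0"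
  by (simp add: tent_def le_divide_eq)

lemma tent_le_1: "0 < \<gamma> \<Longrightarrow> tent N \<gamma> \<xi> \<le> 1"
  by (simp add: tent_def)

lemma tent_ge_half: "0 < \<gamma> \<Longrightarrow> \<bar>\<bar>\<xi>\<bar> - N\<bar> \<le> \<gamma> / 2 \<Longrightarrow> 1 / 2 \<le> tent N \<gamma> \<xi>"
  by (simp add: tent_def le_max_iff_disj divide_le_eq)

lemma continuous_on_tent: "0 < \<gamma> \<Longrightarrow> continuous_on A (tent N \<gamma>)"
  unfolding tent_def[abs_def] by (intro continuous_intros) auto

text \<open>Compact support allows any decay; R bounds the frequencies in the support. The constant
  is exponentially large in N, but it enters only the expansion in \<delta>, not the final
  inequality.\<close>

lemma tent_exp_decay:
  assumes "0 < \<gamma>" "0 \<le> N"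
  obtains A where "0 \<le> A" "\<And>\<xi>. tent N \<gamma> \<xi> \<le> A * (exp (- (2 * \<bar>\<xi>\<bar>)) * decay \<xi>)"
proof
  define R where "R = N + \<gamma>"
  let ?A = "exp (2 * R) * (1 + R\<^sup>2)"
  show "0 \<le> ?A" by (simp add: add_nonneg_nonneg)
  fix \<xi>
  show "tent N \<gamma> \<xi> \<le> ?A * (exp (- (2 * \<bar>\<xi>\<bar>)) * decay \<xi>)"
  proof (cases "\<bar>\<xi>\<bar> \<le> R")
    case True
    have "exp (2 * \<bar>\<xi>\<bar>) * (1 + \<xi>\<^sup>2) \<le> ?A"
      using True abs_le_square_iff[of \<xi> R] by (intro mult_mono) (auto simp: add_nonneg_nonneg)
    then have "1 \<le> ?A * (exp (- (2 * \<bar>\<xi>\<bar>)) * decay \<xi>)"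
      by (simp add: decay_def exp_minus field_simps add_pos_nonneg)
    then show ?thesis using tent_le_1[OF assms(1), of N \<xi>] by linarith
  next
    case False
    then have "tent N \<gamma> \<xi> = 0" using assms by (intro tent_eq_0) (auto simp: R_def)
    then show ?thesis using decay_pos[of \<xi>] by (simp add: add_nonneg_nonneg)
  qed
qed

lemma integrable_indicator_Icc: "integrable lborel (indicator {a..b} :: real \<Rightarrow> real)"
  by (rule integrable_real_indicator) (simp_all add: emeasure_lborel_Icc_eq)

text \<open>On the support 1 + \<bar>\<xi>\<bar> \<ge> N because \<gamma> \<le> 1, which for s \<le>
  0 bounds the weight by N^s. The support has measure at most 4 \<gamma>.\<close>

lemma norm_Hs_of_tent_le:
  assumes s: "s \<le> 0" and \<gamma>: "0 < \<gamma>" "\<gamma> \<le> 1" and N: "1 \<le> N"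
    and in_Hs: "in_Hs s (\<lambda>\<xi>. of_real (tent N \<gamma> \<xi>))"
  shows "norm (Hs_of s (\<lambda>\<xi>. of_real (tent N \<gamma> \<xi>))) \<le> 2 * N powr s * sqrt \<gamma>"
proof (rule power2_le_imp_le)
  let ?f = "\<lambda>\<xi>. of_real (tent N \<gamma> \<xi>) :: complex"
  let ?g = "\<lambda>\<xi>. (N powr s)\<^sup>2 * (indicator {N - \<gamma>..N + \<gamma>} \<xi> + indicator {- N - \<gamma>..- N + \<gamma>} \<xi>) :: real"
  have le: "(cmod (weight s ?f \<xi>))\<^sup>2 \<le> ?g \<xi>" for \<xi>
  proof (cases "\<bar>\<bar>\<xi>\<bar> - N\<bar> < \<gamma>")
    case True
    then have "\<xi> \<in> {N - \<gamma>..N + \<gamma>} \<or> \<xi> \<in> {- N - \<gamma>..- N + \<gamma>}" by auto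
    then have 1: "1 \<le> (indicator {N - \<gamma>..N + \<gamma>} \<xi> + indicator {- N - \<gamma>..- N + \<gamma>} \<xi> :: real)"
      by (auto simp: indicator_def)
    have "(1 + \<bar>\<xi>\<bar>) powr s \<le> N powr s"
      using s True \<gamma> N by (intro powr_mono2') auto
    then have "(1 + \<bar>\<xi>\<bar>) powr s * tent N \<gamma> \<xi> \<le> N powr s * 1"
      by (intro mult_mono tent_le_1 tent_nonneg \<gamma>) auto
    then have "(cmod (weight s ?f \<xi>))\<^sup>2 \<le> (N powr s)\<^sup>2"
      by (intro power_mono) (auto simp: weight_def norm_mult tent_nonneg)
    also have "\<dots> \<le> ?g \<xi>" using mult_left_mono[OF 1, of "(N powr s)\<^sup>2"] by simp
    finally show ?thesis .
  next
    case False
    then have "tent N \<gamma> \<xi> = 0" using \<gamma> by (intro tent_eq_0) auto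
    then show ?thesis by (simp add: weight_def)
  qed
  have "(norm (Hs_of s ?f))\<^sup>2 = (LINT \<xi>|lborel. (cmod (weight s ?f \<xi>))\<^sup>2)"
    unfolding Hs_of_def by (rule norm_abs_L2) (use in_Hs in \<open>simp add: in_Hs_def\<close>)
  also have "\<dots> \<le> (LINT \<xi>|lborel. ?g \<xi>)"
    by (rule integral_mono) (use in_Hs le in \<open>auto simp: in_Hs_def sq_int_def intro!: integrable_mult_right Bochner_Integration.integrable_add integrable_indicator_Icc\<close>)
  also have "\<dots> = (N powr s)\<^sup>2 * (4 * \<gamma>)"
    using \<gamma> by (subst integral_mult_right_zero, subst Bochner_Integration.integral_add) (auto intro!: integrable_indicator_Icc)
  also have "\<dots> = (2 * N powr s * sqrt \<gamma>)\<^sup>2" using \<gamma> by (simp add: power_mult_distrib)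
  finally show "(norm (Hs_of s ?f))\<^sup>2 \<le> (2 * N powr s * sqrt \<gamma>)\<^sup>2" .
qed (use \<gamma> in simp)

text \<open>The minorant vanishes off a square of side l, so the hypothesis also says that nothing
  outside contributes negatively. Integrating twice gives m times the area.\<close>

lemma Re_conv_conv_ge:
  assumes f: "cont_decay A f" and g: "cont_decay B g" and h: "cont_decay C h"
    and l: "0 \<le> l" and le: "\<And>\<eta> \<zeta>. m * indicator {a..a + l} \<eta> * indicator {b..b + l} \<zeta> \<le> Re (c * (f (\<xi> - \<zeta> - \<eta>) * g \<eta> * h \<zeta>))"
  shows "m * l\<^sup>2 \<le> Re (c * conv (conv f g) h \<xi>)"
proof -
  note f' = cont_decayD[OF f] and g' = cont_decayD[OF g] and h' = cont_decayD[OF h]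
    and fg' = cont_decayD[OF cont_decay_conv[OF f g]]
  have int: "integrable lborel (\<lambda>\<eta>. c * (f (\<xi> - \<zeta> - \<eta>) * g \<eta> * h \<zeta>))" for \<zeta>
    by (intro integrable_mult_right integrable_mult_left integrable_conv_integrand[OF f'(5) g'(5) f'(4) g'(3)])
  have ind: "integrable lborel (\<lambda>\<eta>. k * indicator {a..a + l} \<eta> :: real)" for k a
    by (intro integrable_mult_right integrable_indicator_Icc)
  have 1: "m * l * indicator {b..b + l} \<zeta> \<le> Re (c * (conv f g (\<xi> - \<zeta>) * h \<zeta>))" for \<zeta>
  proof -
    have "m * l * indicator {b..b + l} \<zeta> = (LINT \<eta>|lborel. m * indicator {b..b + l} \<zeta> * indicator {a..a + l} \<eta>)"
      using l by simp
    also have "\<dots> \<le> (LINT \<eta>|lborel. Re (c * (f (\<xi> - \<zeta> - \<eta>) * g \<eta> * h \<zeta>)))"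
      by (rule integral_mono[OF ind integrable_Re[OF int]]) (use le[of _ \<zeta>] in \<open>simp add: mult_ac\<close>)
    also have "\<dots> = Re (LINT \<eta>|lborel. c * (f (\<xi> - \<zeta> - \<eta>) * g \<eta> * h \<zeta>))"
      by (rule integral_Re[OF int])
    also have "(LINT \<eta>|lborel. c * (f (\<xi> - \<zeta> - \<eta>) * g \<eta> * h \<zeta>)) = c * (conv f g (\<xi> - \<zeta>) * h \<zeta>)"
      unfolding conv_def by (simp only: integral_mult_right_zero integral_mult_left_zero)
    finally show ?thesis .
  qed
  have int2: "integrable lborel (\<lambda>\<zeta>. c * (conv f g (\<xi> - \<zeta>) * h \<zeta>))"
    by (intro integrable_mult_right integrable_conv_integrand[OF fg'(5) h'(5) fg'(4) h'(3)])
  have "m * l\<^sup>2 = (LINT \<zeta>|lborel. m * l * indicator {b..b + l} \<zeta>)"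
    using l by (simp add: power2_eq_square)
  also have "\<dots> \<le> (LINT \<zeta>|lborel. Re (c * (conv f g (\<xi> - \<zeta>) * h \<zeta>)))"
    by (rule integral_mono[OF ind integrable_Re[OF int2] 1])
  also have "\<dots> = Re (LINT \<zeta>|lborel. c * (conv f g (\<xi> - \<zeta>) * h \<zeta>))"
    by (rule integral_Re[OF int2])
  also have "(LINT \<zeta>|lborel. c * (conv f g (\<xi> - \<zeta>) * h \<zeta>)) = c * conv (conv f g) h \<xi>"
    unfolding conv_def[of "conv f g"] by (rule integral_mult_right_zero)
  finally show ?thesis .
qed

lemma abs_cube_diff_le:
  fixes a b :: real
  assumes "\<bar>a\<bar> \<le> R" "\<bar>b\<bar> \<le> R"
  shows "\<bar>a ^ 3 - b ^ 3\<bar> \<le> 3 * R\<^sup>2 * \<bar>a - b\<bar>"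
proof -
  have "0 \<le> R" using assms by linarith
  have "\<bar>a\<^sup>2 + a * b + b\<^sup>2\<bar> \<le> \<bar>a\<^sup>2\<bar> + \<bar>a * b\<bar> + \<bar>b\<^sup>2\<bar>" by linarith
  also have "\<dots> = \<bar>a\<bar> * \<bar>a\<bar> + \<bar>a\<bar> * \<bar>b\<bar> + \<bar>b\<bar> * \<bar>b\<bar>"
    by (simp add: power2_eq_square abs_mult)
  also have "\<dots> \<le> R * R + R * R + R * R"
    by (intro add_mono mult_mono assms \<open>0 \<le> R\<close>) auto
  finally have "\<bar>a - b\<bar> * \<bar>a\<^sup>2 + a * b + b\<^sup>2\<bar> \<le> \<bar>a - b\<bar> * (3 * R\<^sup>2)"
    by (intro mult_left_mono) (auto simp: power2_eq_square)
  moreover have "a ^ 3 - b ^ 3 = (a - b) * (a\<^sup>2 + a * b + b\<^sup>2)"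
    by (simp add: power2_eq_square power3_eq_cube algebra_simps)
  ultimately show ?thesis by (simp add: abs_mult mult_ac)
qed

text \<open>
  Near the frequency \<open>N\<close> only \<open>(N, 2N, - 2N)\<close> and \<open>(N, - 2N, 2N)\<close> contribute. There
  the resonance function \<open>\<xi>\<^sup>3 - \<xi>\<^sub>1\<^sup>3 - \<alpha> \<eta>\<^sup>3 - \<alpha> \<zeta>\<^sup>3\<close> vanishes up to an error of order \<open>N\<^sup>2 \<gamma>\<close>.
\<close>

lemma resonance_bound:
  assumes \<alpha>: "0 \<le> \<alpha>" "\<alpha> \<le> 1" and \<gamma>: "0 < \<gamma>" "\<gamma> \<le> 1 / 4" and N: "1 \<le> N" and \<xi>: "\<bar>\<xi> - N\<bar> \<le> \<gamma> / 4"
    and "tent N \<gamma> (\<xi> - \<zeta> - \<eta>) \<noteq> 0" "tent (2 * N) \<gamma> \<eta> \<noteq> 0" "tent (2 * N) \<gamma> \<zeta> \<noteq> 0"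
  shows "\<bar>\<xi> ^ 3 - (\<xi> - \<zeta> - \<eta>) ^ 3 - \<alpha> * \<eta> ^ 3 - \<alpha> * \<zeta> ^ 3\<bar> \<le> 78 * N\<^sup>2 * \<gamma>"
proof -
  define \<kappa> where "\<kappa> = \<xi> - \<zeta> - \<eta>"
  have sup: "\<bar>\<bar>\<kappa>\<bar> - N\<bar> < \<gamma>" "\<bar>\<bar>\<eta>\<bar> - 2 * N\<bar> < \<gamma>" "\<bar>\<bar>\<zeta>\<bar> - 2 * N\<bar> < \<gamma>"
    using assms(7-9) tent_eq_0[OF \<gamma>(1)] unfolding \<kappa>_def by (meson not_le)+
  \<comment> \<open>With \<xi> near N, any signs other than \<kappa> > 0 and opposite \<eta>,
    \<zeta> would separate \<eta> + \<zeta> from \<xi> - \<kappa> by a distance of order N. Hence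
    \<eta> + \<zeta> = \<xi> - \<kappa> is at most \<gamma> / 4 + \<gamma> in modulus.\<close>
  have sum: "\<bar>\<eta> + \<zeta>\<bar> \<le> 2 * \<gamma>" and diff: "\<xi> - \<kappa> = \<eta> + \<zeta>"
    using sup \<xi> \<gamma> N unfolding \<kappa>_def by (auto simp: abs_if split: if_splits)
  \<comment> \<open>The moduli of \<xi>, \<kappa> are at most 2 N and those of \<eta>, \<zeta> at
    most 3 N. The two cube differences contribute 3 * 4 * 2 = 24 and 3 * 9 * 2 = 54, together
    78.\<close>
  have "\<bar>\<xi> ^ 3 - \<kappa> ^ 3\<bar> \<le> 3 * (2 * N)\<^sup>2 * \<bar>\<xi> - \<kappa>\<bar>"
    by (rule abs_cube_diff_le) (use sup \<xi> \<gamma> N in linarith)+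
  also have "\<dots> \<le> 3 * (2 * N)\<^sup>2 * (2 * \<gamma>)"
    unfolding diff by (intro mult_left_mono sum) auto
  finally have 1: "\<bar>\<xi> ^ 3 - \<kappa> ^ 3\<bar> \<le> 24 * (N\<^sup>2 * \<gamma>)" by (simp add: power_mult_distrib)
  have "\<bar>\<eta> ^ 3 - (- \<zeta>) ^ 3\<bar> \<le> 3 * (3 * N)\<^sup>2 * \<bar>\<eta> - (- \<zeta>)\<bar>"
    by (rule abs_cube_diff_le) (use sup \<xi> \<gamma> N in linarith)+
  also have "\<dots> \<le> 3 * (3 * N)\<^sup>2 * (2 * \<gamma>)"
    using sum by (intro mult_left_mono) auto
  finally have "\<bar>\<eta> ^ 3 + \<zeta> ^ 3\<bar> \<le> 54 * (N\<^sup>2 * \<gamma>)" by (simp add: power_mult_distrib)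
  then have "\<alpha> * \<bar>\<eta> ^ 3 + \<zeta> ^ 3\<bar> \<le> 1 * (54 * (N\<^sup>2 * \<gamma>))"
    using \<alpha> by (intro mult_mono) auto
  then have 2: "\<bar>\<alpha> * \<eta> ^ 3 + \<alpha> * \<zeta> ^ 3\<bar> \<le> 54 * (N\<^sup>2 * \<gamma>)"
    using \<alpha> by (simp add: abs_mult distrib_left[symmetric])
  show ?thesis using 1 2 unfolding \<kappa>_def[symmetric] by linarith
qed

section \<open>Lower bound for the first Picard iterate\<close>

lemma Re_mult_cnj: "Re (x * cnj y) = x \<bullet> y"
  by (simp add: inner_complex_def)

lemma half_le_cos:
  fixes x :: real
  assumes "\<bar>x\<bar> \<le> 1"
  shows "1 / 2 \<le> cos x"
proof -
  have "cos (pi / 3) \<le> cos \<bar>x\<bar>"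
    using assms pi_gt3 by (intro cos_monotone_0_pi_le) auto
  then show ?thesis by (simp add: cos_60)
qed

context
  fixes T \<alpha> N \<gamma> :: real
  assumes T: "0 < T" and \<alpha>: "0 \<le> \<alpha>" "\<alpha> \<le> 1" and N: "1 \<le> N" and \<gamma>: "0 < \<gamma>" "\<gamma> \<le> 1 / 4"
    and T\<gamma>: "78 * N\<^sup>2 * \<gamma> * T \<le> 1"
begin

abbreviation "v\<^sub>0 \<equiv> \<lambda>\<xi>. of_real (tent N \<gamma> \<xi>) :: complex"
abbreviation "w\<^sub>0 \<equiv> \<lambda>\<xi>. of_real (tent (2 * N) \<gamma> \<xi>) :: complex"
abbreviation "cubic_term \<equiv> triple (free_evolution T 1 v\<^sub>0) (free_evolution T \<alpha> w\<^sub>0) (free_evolution T \<alpha> w\<^sub>0)"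

lemma admissible_tents:
  obtains A where "0 \<le> A" "\<And>\<xi>. cmod (v\<^sub>0 \<xi>) \<le> A * (exp (- (2 * \<bar>\<xi>\<bar>)) * decay \<xi>)"
    "\<And>\<xi>. cmod (w\<^sub>0 \<xi>) \<le> A * (exp (- (2 * \<bar>\<xi>\<bar>)) * decay \<xi>)"
    "admissible T A (free_evolution T a v\<^sub>0)" "admissible T A (free_evolution T a w\<^sub>0)"
proof -
  obtain A where A: "0 \<le> A" "\<And>\<xi>. tent N \<gamma> \<xi> \<le> A * (exp (- (2 * \<bar>\<xi>\<bar>)) * decay \<xi>)"
    using tent_exp_decay[of \<gamma> N] \<gamma> N by auto
  obtain B where B: "0 \<le> B" "\<And>\<xi>. tent (2 * N) \<gamma> \<xi> \<le> B * (exp (- (2 * \<bar>\<xi>\<bar>)) * decay \<xi>)"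
    using tent_exp_decay[of \<gamma> "2 * N"] \<gamma> N by auto
  have "0 \<le> exp (- (2 * \<bar>\<xi>\<bar>)) * decay \<xi>" for \<xi> using decay_pos[of \<xi>] by simp
  then have "A * (exp (- (2 * \<bar>\<xi>\<bar>)) * decay \<xi>) \<le> (A + B) * (exp (- (2 * \<bar>\<xi>\<bar>)) * decay \<xi>)"
    "B * (exp (- (2 * \<bar>\<xi>\<bar>)) * decay \<xi>) \<le> (A + B) * (exp (- (2 * \<bar>\<xi>\<bar>)) * decay \<xi>)" for \<xi>
    using A(1) B(1) by (intro mult_right_mono; simp)+
  then have b: "cmod (v\<^sub>0 \<xi>) \<le> (A + B) * (exp (- (2 * \<bar>\<xi>\<bar>)) * decay \<xi>)"
    "cmod (w\<^sub>0 \<xi>) \<le> (A + B) * (exp (- (2 * \<bar>\<xi>\<bar>)) * decay \<xi>)" for \<xi>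
    using A(2)[of \<xi>] B(2)[of \<xi>] by (auto simp: tent_nonneg intro: order_trans)
  have "0 \<le> A + B" using A(1) B(1) by simp
  then show thesis
    using b by (intro that[of "A + B"] admissible_free_evolution[OF T] continuous_on_of_real continuous_on_tent \<gamma>) auto
qed

text \<open>The factor \<open>cis (- (t * \<xi> ^ 3))\<close> removes the phase of the free
  evolution and leaves the resonance phase. The integrand is nonnegative, and on a square of side
  \<gamma> / 4 around (2 N, - 2 N) it is at least 1 / 16, namely 1 / 2 for the cosine and 1 / 2 for
  each tent. With the factor 1 / (2 \<pi>)^2 this gives 1024 \<pi>^2 in the denominator.\<close>

lemma Re_cubic_term_ge:
  assumes \<xi>: "\<bar>\<xi> - N\<bar> \<le> \<gamma> / 4" and t: "t \<in> {0..T}"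
  shows "\<gamma>\<^sup>2 / (1024 * pi\<^sup>2) \<le> Re (cis (- (t * \<xi> ^ 3)) * cubic_term t \<xi>)"
proof -
  let ?c = "cis (- (t * \<xi> ^ 3))"
  let ?F = "free_evolution T 1 v\<^sub>0 t" and ?G = "free_evolution T \<alpha> w\<^sub>0 t"
  obtain A where F: "admissible T A (free_evolution T 1 v\<^sub>0)" using admissible_tents by metis
  obtain B where G: "admissible T B (free_evolution T \<alpha> w\<^sub>0)" using admissible_tents by metis
  have ge: "1 / 16 * indicator {2 * N - \<gamma> / 8..2 * N - \<gamma> / 8 + \<gamma> / 4} \<eta> * indicator {- 2 * N - \<gamma> / 8..- 2 * N - \<gamma> / 8 + \<gamma> / 4} \<zeta>
      \<le> Re (?c * (?F (\<xi> - \<zeta> - \<eta>) * ?G \<eta> * ?G \<zeta>))" for \<eta> \<zeta>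
  proof -
    define \<kappa> where "\<kappa> = \<xi> - \<zeta> - \<eta>"
    define \<Omega> where "\<Omega> = \<xi> ^ 3 - \<kappa> ^ 3 - \<alpha> * \<eta> ^ 3 - \<alpha> * \<zeta> ^ 3"
    let ?P = "tent N \<gamma> \<kappa> * tent (2 * N) \<gamma> \<eta> * tent (2 * N) \<gamma> \<zeta>"
    have P: "0 \<le> ?P" by (simp add: tent_nonneg)
    have cis4: "cis a * (cis b * of_real x * (cis c * of_real y) * (cis d * of_real z))
        = cis (a + (b + (c + d))) * of_real (x * y * z)" for a b c d x y z :: real
      by (simp add: mult_ac flip: cis_mult)
    have FG: "?F \<kappa> = cis (t * 1 * \<kappa> ^ 3) * v\<^sub>0 \<kappa>" "?G \<eta> = cis (t * \<alpha> * \<eta> ^ 3) * w\<^sub>0 \<eta>"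
        "?G \<zeta> = cis (t * \<alpha> * \<zeta> ^ 3) * w\<^sub>0 \<zeta>"
      by (simp_all only: free_evolution_def clip_eq[OF t])
    have "- (t * \<xi> ^ 3) + (t * 1 * \<kappa> ^ 3 + (t * \<alpha> * \<eta> ^ 3 + t * \<alpha> * \<zeta> ^ 3)) = - (t * \<Omega>)"
      by (simp add: \<Omega>_def algebra_simps)
    then have "?c * (?F \<kappa> * ?G \<eta> * ?G \<zeta>) = cis (- (t * \<Omega>)) * of_real ?P"
      unfolding FG cis4 by (simp only:)
    then have Re: "Re (?c * (?F \<kappa> * ?G \<eta> * ?G \<zeta>)) = cos (t * \<Omega>) * ?P"
      by simp
    have "1 / 2 * ?P \<le> cos (t * \<Omega>) * ?P"
    proof (cases "?P = 0")
      case True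
      show ?thesis unfolding True by simp
    next
      case False
      then have "\<bar>\<Omega>\<bar> \<le> 78 * N\<^sup>2 * \<gamma>"
        unfolding \<Omega>_def \<kappa>_def by (intro resonance_bound \<alpha> \<gamma> N \<xi>) auto
      \<comment> \<open>This is what fixes the width: up to time T the phase stays within [- 1, 1],
        where the cosine is at least 1 / 2.\<close>
      then have "\<bar>t\<bar> * \<bar>\<Omega>\<bar> \<le> T * (78 * N\<^sup>2 * \<gamma>)"
        using t by (intro mult_mono) auto
      then have "\<bar>t * \<Omega>\<bar> \<le> 1" using T\<gamma> by (simp add: abs_mult mult_ac)
      then show ?thesis by (intro mult_right_mono half_le_cos P)
    qed
    moreover have "1 / 8 * indicator {2 * N - \<gamma> / 8..2 * N - \<gamma> / 8 + \<gamma> / 4} \<eta> * indicator {- 2 * N - \<gamma> / 8..- 2 * N - \<gamma> / 8 + \<gamma> / 4} \<zeta> \<le> ?P"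
    proof (cases "\<eta> \<in> {2 * N - \<gamma> / 8..2 * N - \<gamma> / 8 + \<gamma> / 4} \<and> \<zeta> \<in> {- 2 * N - \<gamma> / 8..- 2 * N - \<gamma> / 8 + \<gamma> / 4}")
      case True
      then have b: "2 * N - \<gamma> / 8 \<le> \<eta>" "\<eta> \<le> 2 * N - \<gamma> / 8 + \<gamma> / 4"
        "- 2 * N - \<gamma> / 8 \<le> \<zeta>" "\<zeta> \<le> - 2 * N - \<gamma> / 8 + \<gamma> / 4" by auto
      have *: "1 / 2 \<le> tent N \<gamma> \<kappa>" "1 / 2 \<le> tent (2 * N) \<gamma> \<eta>" "1 / 2 \<le> tent (2 * N) \<gamma> \<zeta>"
        unfolding \<kappa>_def by (rule tent_ge_half[OF \<gamma>(1)], use b \<xi> \<gamma> N in linarith)+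
      have "1 / 2 * (1 / 2) * (1 / 2) \<le> ?P"
        by (intro mult_mono *) (auto simp: tent_nonneg)
      then show ?thesis using True by simp
    next
      case False
      then show ?thesis using P by (auto simp: indicator_def)
    qed
    ultimately show ?thesis using Re unfolding \<kappa>_def[symmetric] by simp
  qed
  have "1 / 16 * (\<gamma> / 4)\<^sup>2 \<le> Re (?c * conv (conv ?F ?G) ?G \<xi>)"
    by (rule Re_conv_conv_ge[OF admissibleD(4)[OF T F] admissibleD(4)[OF T G] admissibleD(4)[OF T G] _ ge]) (use \<gamma> in simp)
  then have "1 / (2 * pi)\<^sup>2 * (1 / 16 * (\<gamma> / 4)\<^sup>2) \<le> 1 / (2 * pi)\<^sup>2 * Re (?c * conv (conv ?F ?G) ?G \<xi>)"
    by (intro mult_left_mono) auto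
  also have "\<dots> = Re (of_real (1 / (2 * pi)\<^sup>2) * (?c * conv (conv ?F ?G) ?G \<xi>))"
    by (simp only: Re_complex_of_real times_complex.sel complex_of_real_def complex.sel mult_zero_left diff_zero)
  also have "of_real (1 / (2 * pi)\<^sup>2) * (?c * conv (conv ?F ?G) ?G \<xi>) = ?c * cubic_term t \<xi>"
    by (simp only: triple_def mult_ac)
  finally show ?thesis by (simp add: power_mult_distrib power_divide)
qed

text \<open>The phase of the Duhamel kernel and that of the test vector combine to
  \<open>cis (- (t * \<xi> ^ 3))\<close>, the two imaginary units cancel, and the derivative
  contributes \<xi> \<ge> N / 2. The integrand thus has a fixed sign on [0,T].\<close>

lemma Re_duhamel_ge:
  assumes \<xi>: "\<bar>\<xi> - N\<bar> \<le> \<gamma> / 4"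
  shows "N / 2 * (T * (\<gamma>\<^sup>2 / (1024 * pi\<^sup>2))) \<le> duhamel T 1 cubic_term T \<xi> \<bullet> (\<i> * cis (T * \<xi> ^ 3))"
proof -
  obtain A where F: "admissible T A (free_evolution T 1 v\<^sub>0)" using admissible_tents by metis
  obtain B where G: "admissible T B (free_evolution T \<alpha> w\<^sub>0)" using admissible_tents by metis
  have cont: "continuous_on S (\<lambda>t. cubic_term t \<xi>)" for S
    by (rule continuous_on_curry_snd[OF admissibleD(2)[OF T admissible_triple[OF T F G G]]])
  let ?D = "\<lambda>t. cis ((T - t) * 1 * \<xi> ^ 3) * (\<i> * of_real \<xi> * cubic_term t \<xi>)"
  have "?D integrable_on {0..T}"
    by (intro integrable_continuous_real continuous_intros cont)
  then have "(?D has_integral duhamel T 1 cubic_term T \<xi>) {0..T}"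
    using T by (simp add: duhamel_def clip_eq integrable_integral)
  from has_integral_linear[OF this bounded_linear_inner_left[of "\<i> * cis (T * \<xi> ^ 3)"]]
  have D: "((\<lambda>t. ?D t \<bullet> (\<i> * cis (T * \<xi> ^ 3))) has_integral duhamel T 1 cubic_term T \<xi> \<bullet> (\<i> * cis (T * \<xi> ^ 3))) {0..T}"
    by (simp add: o_def)
  have "N / 2 * (\<gamma>\<^sup>2 / (1024 * pi\<^sup>2)) \<le> ?D t \<bullet> (\<i> * cis (T * \<xi> ^ 3))" if t: "t \<in> {0..T}" for t
  proof -
    have "N / 2 * (\<gamma>\<^sup>2 / (1024 * pi\<^sup>2)) \<le> \<xi> * Re (cis (- (t * \<xi> ^ 3)) * cubic_term t \<xi>)"
      by (intro mult_mono Re_cubic_term_ge \<xi> t) (use \<xi> \<gamma> N in \<open>auto simp: abs_if split: if_splits\<close>)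
    also have "\<dots> = Re (of_real \<xi> * (cis (- (t * \<xi> ^ 3)) * cubic_term t \<xi>))"
      by simp
    also have "of_real \<xi> * (cis (- (t * \<xi> ^ 3)) * cubic_term t \<xi>) = ?D t * cnj (\<i> * cis (T * \<xi> ^ 3))"
    proof -
      have phase: "cis ((T - t) * 1 * \<xi> ^ 3) * cis (- (T * \<xi> ^ 3)) = cis (- (t * \<xi> ^ 3))"
        unfolding cis_mult by (rule arg_cong[where f = cis]) (simp add: algebra_simps)
      have cnj: "cnj (\<i> * cis (T * \<xi> ^ 3)) = - \<i> * cis (- (T * \<xi> ^ 3))"
        by (simp add: cis_cnj)
      have "a * (\<i> * x * y) * (- \<i> * b) = (\<i> * (- \<i>)) * (x * ((a * b) * y))" for a b x y
        by (simp only: mult_ac)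
      then have "?D t * cnj (\<i> * cis (T * \<xi> ^ 3))
          = (\<i> * (- \<i>)) * (of_real \<xi> * (cis (- (t * \<xi> ^ 3)) * cubic_term t \<xi>))"
        unfolding cnj by (simp only: phase)
      then show ?thesis by simp
    qed
    also have "Re \<dots> = ?D t \<bullet> (\<i> * cis (T * \<xi> ^ 3))"
      by (rule Re_mult_cnj)
    finally show ?thesis .
  qed
  then have "T * (N / 2 * (\<gamma>\<^sup>2 / (1024 * pi\<^sup>2))) \<le> duhamel T 1 cubic_term T \<xi> \<bullet> (\<i> * cis (T * \<xi> ^ 3))"
    using has_integral_le[OF has_integral_const_real[of "N / 2 * (\<gamma>\<^sup>2 / (1024 * pi\<^sup>2))" 0 T] D] T by simp
  then show ?thesis by (simp add: mult_ac)
qed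

text \<open>The test vector carries the phase of the free evolution, so that the pairing has no cancellation.\<close>

lemma duhamel_test_vector:
  assumes s: "s \<le> 0" and in_Hs: "in_Hs s (duhamel T 1 cubic_term T)"
  obtains e where "norm e \<le> sqrt \<gamma>"
    "(3 * N) powr s * (N / 2 * (T * (\<gamma>\<^sup>2 / (1024 * pi\<^sup>2)))) * (\<gamma> / 2) \<le> inner (Hs_of s (duhamel T 1 cubic_term T)) e"
proof -
  let ?I = "{N - \<gamma> / 4..N + \<gamma> / 4}" and ?W = "duhamel T 1 cubic_term T"
  define E where "E = (\<lambda>\<xi>. indicator ?I \<xi> *\<^sub>R (\<i> * cis (T * \<xi> ^ 3)))"
  have E2: "(cmod (E \<xi>))\<^sup>2 = indicator ?I \<xi>" for \<xi>
    by (simp add: E_def norm_mult indicator_def)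
  have ind: "integrable lborel (indicator ?I :: real \<Rightarrow> real)"
    by (rule integrable_indicator_Icc)
  have E: "sq_int E"
    by (rule sq_int_bound[OF _ ind]) (auto simp: E2, simp add: E_def)
  have W: "sq_int (weight s ?W)" using in_Hs by (simp add: in_Hs_def)
  have "(norm (abs_L2 E))\<^sup>2 = (LINT \<xi>|lborel. indicator ?I \<xi>)"
    using norm_abs_L2[OF E] by (simp add: E2)
  also have "\<dots> \<le> (sqrt \<gamma>)\<^sup>2" using \<gamma> by simp
  finally have norm: "norm (abs_L2 E) \<le> sqrt \<gamma>" by (rule power2_le_imp_le) (use \<gamma> in simp)
  let ?m = "(3 * N) powr s * (N / 2 * (T * (\<gamma>\<^sup>2 / (1024 * pi\<^sup>2))))"
  have "?m * indicator ?I \<xi> \<le> weight s ?W \<xi> \<bullet> E \<xi>" for \<xi>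
  proof (cases "\<xi> \<in> ?I")
    case True
    then have \<xi>: "\<bar>\<xi> - N\<bar> \<le> \<gamma> / 4" unfolding atLeastAtMost_iff by linarith
    have "?m \<le> (1 + \<bar>\<xi>\<bar>) powr s * (?W \<xi> \<bullet> (\<i> * cis (T * \<xi> ^ 3)))"
    proof (rule mult_mono[OF _ Re_duhamel_ge[OF \<xi>]])
      \<comment> \<open>Here 1 + \<bar>\<xi>\<bar> \<le> 3 N, and s \<le> 0 reverses the
        inequality.\<close>
      show "(3 * N) powr s \<le> (1 + \<bar>\<xi>\<bar>) powr s"
        using s True \<gamma> N by (intro powr_mono2') auto
    qed (use T N in auto)
    also have "\<dots> = weight s ?W \<xi> \<bullet> E \<xi>"
      using True by (simp add: weight_def E_def scaleR_conv_of_real[symmetric])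
    finally show ?thesis using True by simp
  qed (simp add: E_def)
  then have "(LINT \<xi>|lborel. ?m * indicator ?I \<xi>) \<le> (LINT \<xi>|lborel. weight s ?W \<xi> \<bullet> E \<xi>)"
    by (intro integral_mono integrable_mult_right ind sq_int_inner[OF W E])
  then have "?m * (\<gamma> / 2) \<le> inner (Hs_of s ?W) (abs_L2 E)"
    using \<gamma> by (simp add: Hs_of_def inner_abs_L2[OF W E])
  with norm show thesis by (rule that)
qed

end

section \<open>Unboundedness of the third derivative\<close>

text \<open>T is given first and the width of the tents adapts to it, so that shortening the time
  does not help. The data are Hermitian and therefore serve both choices of X.\<close>

theorem theorem1p3:
  fixes \<alpha> s :: real and X :: "L2 set"
  assumes "0 < \<alpha>" "\<alpha> < 1" and "s < - 1 / 2"
    and "X = UNIV \<or> X = real_valued"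
  shows "\<not> (\<exists>T > 0. \<exists>U S. data_to_solution_map X s \<alpha> T U S \<and> C3_at_within S 0 (X \<times> X))"
proof clarify
  fix T U S assume T: "0 < T" and S: "data_to_solution_map X s \<alpha> T U S" and C3: "C3_at_within S 0 (X \<times> X)"
  have s: "s \<le> 0" using assms(3) by simp
  have "c *\<^sub>R x \<in> X" if "x \<in> X" for c x
  proof -
    show ?thesis using that assms(4) real_valued_scaleR by auto
  qed
  then have XX: "c *\<^sub>R h \<in> X \<times> X" if "h \<in> X \<times> X" for c h
    using that by auto
  \<comment> \<open>C is fixed before the frequency N; this uniformity is what the growth in N
    contradicts.\<close>
  obtain C where C: "0 \<le> C" "\<And>h l L a b c \<delta>\<^sub>0. h \<in> X \<times> X \<Longrightarrow> bounded_linear l \<Longrightarrow> 0 \<le> L \<Longrightarrow>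
      (\<And>x. \<bar>l x\<bar> \<le> L * norm x) \<Longrightarrow> 0 < \<delta>\<^sub>0 \<Longrightarrow>
      (\<And>\<delta>. 0 \<le> \<delta> \<Longrightarrow> \<delta> \<le> \<delta>\<^sub>0 \<Longrightarrow> \<bar>l (S (\<delta> *\<^sub>R h)) - \<delta> * a - \<delta> ^ 3 * b\<bar> \<le> c * \<delta> ^ 5) \<Longrightarrow>
      \<bar>b\<bar> \<le> C * L * norm h ^ 3"
    using C3_at_within_cubic_coefficient[OF C3 XX] by blast
  \<comment> \<open>4096 = 2 * 1024 * 2, from the factor N / 2, the bound for the cubic term and the
    length \<gamma> / 2 of the test interval.\<close>
  define c where "c = 3 powr s * T / (4096 * pi\<^sup>2)"
  have c: "0 < c" using T by (simp add: c_def)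
  have main: "N powr (- 1 - 2 * s) \<le> 6400 * (1 + T) * C / c" if N: "1 \<le> N" for N
  proof -
    \<comment> \<open>Small enough for \<gamma> \<le> 1 / 4 and for the phase condition with
      constant 78, yet only by a fixed multiple of N^-2, since every loss in \<gamma> weakens the
      final exponent.\<close>
    define \<gamma> where "\<gamma> = 1 / (100 * (1 + T) * N\<^sup>2)"
    have \<gamma>: "0 < \<gamma>" "\<gamma> \<le> 1 / 4" "78 * N\<^sup>2 * \<gamma> * T \<le> 1"
    proof -
      have "1 * 1 \<le> (1 + T) * N\<^sup>2" using T N by (intro mult_mono) auto
      then have D: "1 \<le> (1 + T) * N\<^sup>2" by simp
      have \<gamma>_eq: "\<gamma> = 1 / (100 * ((1 + T) * N\<^sup>2))" by (simp only: \<gamma>_def mult.assoc)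
      show "0 < \<gamma>" "\<gamma> \<le> 1 / 4" unfolding \<gamma>_eq using D by (simp_all add: divide_le_eq del: zero_less_mult_iff)
      have "78 * N\<^sup>2 * \<gamma> * T = 78 * (N\<^sup>2 * T) / (100 * ((1 + T) * N\<^sup>2))"
        by (simp add: \<gamma>_eq)
      also have "\<dots> \<le> 1"
        using D T zero_le_power2[of N] by (subst divide_le_eq_1_pos) (auto simp: algebra_simps)
      finally show "78 * N\<^sup>2 * \<gamma> * T \<le> 1" .
    qed
    note ctx = T less_imp_le[OF assms(1)] less_imp_le[OF assms(2)] N \<gamma>
    let ?v = "\<lambda>\<xi>. of_real (tent N \<gamma> \<xi>) :: complex" and ?w = "\<lambda>\<xi>. of_real (tent (2 * N) \<gamma> \<xi>) :: complex"
    let ?W = "duhamel T 1 (triple (free_evolution T 1 ?v) (free_evolution T \<alpha> ?w) (free_evolution T \<alpha> ?w)) T"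
    let ?h = "(Hs_of s ?v, Hs_of s ?w)"
    obtain A where A: "0 \<le> A" "\<And>\<xi>. cmod (?v \<xi>) \<le> A * (exp (- (2 * \<bar>\<xi>\<bar>)) * decay \<xi>)"
        "\<And>\<xi>. cmod (?w \<xi>) \<le> A * (exp (- (2 * \<bar>\<xi>\<bar>)) * decay \<xi>)"
      using admissible_tents[OF ctx] by metis
    have cont: "continuous_on UNIV ?v" "continuous_on UNIV ?w"
      by (intro continuous_on_of_real continuous_on_tent \<gamma>)+
    note E = solution_map_expansion[OF T S assms(4) cont(1) A(2) _ cont(2) A(3) _ A(1)]
    have in_Hs: "in_Hs s ?v" "in_Hs s ?w" "in_Hs s ?W" and hX: "?h \<in> X \<times> X"
      using E(1-5) by simp_all
    obtain e where e: "norm e \<le> sqrt \<gamma>"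
      "(3 * N) powr s * (N / 2 * (T * (\<gamma>\<^sup>2 / (1024 * pi\<^sup>2)))) * (\<gamma> / 2) \<le> inner (Hs_of s ?W) e"
      using duhamel_test_vector[OF ctx s in_Hs(3)] .
    let ?l = "\<lambda>z :: (real \<Rightarrow>\<^sub>C L2) \<times> (real \<Rightarrow>\<^sub>C L2). inner (apply_bcontfun (fst z) T) e"
    have l_le: "\<bar>?l z\<bar> \<le> norm e * norm z" for z
    proof -
      have "\<bar>?l z\<bar> \<le> norm (apply_bcontfun (fst z) T) * norm e" by (rule Cauchy_Schwarz_ineq2)
      also have "\<dots> \<le> norm z * norm e"
        by (intro mult_right_mono order_trans[OF norm_bounded norm_fst_le[of "fst z" "snd z", simplified]]) auto
      finally show ?thesis by (simp add: mult.commute)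
    qed
    have l: "bounded_linear ?l"
      by (rule bounded_linear_intro[where K = "norm e"])
        (use l_le in \<open>auto simp: inner_add_left mult.commute\<close>)
    obtain \<delta>\<^sub>0 a d where "0 < \<delta>\<^sub>0" "\<And>\<delta>. 0 \<le> \<delta> \<Longrightarrow> \<delta> \<le> \<delta>\<^sub>0 \<Longrightarrow>
        \<bar>?l (S (\<delta> *\<^sub>R ?h)) - \<delta> * a - \<delta> ^ 3 * (- inner (Hs_of s ?W) e)\<bar> \<le> d * \<delta> ^ 5"
      using E(6)[of e] by auto
    from C(2)[OF hX l norm_ge_zero l_le this]
    have upper: "inner (Hs_of s ?W) e \<le> C * norm e * norm ?h ^ 3" by simp
    have "norm ?h \<le> norm (Hs_of s ?v) + norm (Hs_of s ?w)" by (rule norm_Pair_le)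
    also have "\<dots> \<le> 2 * N powr s * sqrt \<gamma> + 2 * (2 * N) powr s * sqrt \<gamma>"
      using N \<gamma> by (intro add_mono norm_Hs_of_tent_le s in_Hs) auto
    also have "(2 * N) powr s \<le> N powr s" using N s by (intro powr_mono2') auto
    finally have h: "norm ?h \<le> 4 * N powr s * sqrt \<gamma>" using \<gamma> by (simp add: mult_ac)
    \<comment> \<open>Four factors sqrt \<gamma>, one from e and three from h, give \<gamma>^2
      against \<gamma>^3 in the lower bound. The extra \<gamma> costs N^2, while the derivative
      gains N.\<close>
    have "C * norm e * norm ?h ^ 3 \<le> C * sqrt \<gamma> * (4 * N powr s * sqrt \<gamma>) ^ 3"
      by (intro mult_mono power_mono h e mult_left_mono C) (use C \<gamma> in auto)
    also have "\<dots> = 64 * C * (N powr s) ^ 3 * (sqrt \<gamma> ^ 2) ^ 2"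
    proof -
      have "C * q * (4 * p * q) ^ 3 = 64 * C * p ^ 3 * (q ^ 2) ^ 2" for p q :: real
        by (simp add: power_mult_distrib eval_nat_numeral)
      then show ?thesis .
    qed
    also have "\<dots> = 64 * C * (N powr s) ^ 3 * \<gamma>\<^sup>2" using \<gamma> by simp
    finally have "(3 * N) powr s * (N / 2 * (T * (\<gamma>\<^sup>2 / (1024 * pi\<^sup>2)))) * (\<gamma> / 2) \<le> 64 * C * (N powr s) ^ 3 * \<gamma>\<^sup>2"
      using e(2) upper by linarith
    then have "(c * N powr s * N * \<gamma>) * \<gamma>\<^sup>2 \<le> (64 * C * (N powr s) ^ 3) * \<gamma>\<^sup>2"
      using N by (simp add: c_def powr_mult mult_ac)
    then have "c * N powr s * N * \<gamma> \<le> 64 * C * (N powr s) ^ 3"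
      using \<gamma> by (simp add: mult_le_cancel_right)
    then have "N powr s * (c * N * \<gamma>) \<le> N powr s * (64 * C * (N powr s)\<^sup>2)"
      by (simp add: power2_eq_square power3_eq_cube mult_ac)
    then have "c * N * \<gamma> \<le> 64 * C * (N powr s)\<^sup>2"
      using N by simp
    then have "c * N * \<gamma> * (100 * (1 + T) * N\<^sup>2) \<le> 64 * C * (N powr s)\<^sup>2 * (100 * (1 + T) * N\<^sup>2)"
      using T by (intro mult_right_mono) auto
    also have "64 * C * (N powr s)\<^sup>2 * (100 * (1 + T) * N\<^sup>2) = 6400 * (1 + T) * C * ((N powr s)\<^sup>2 * N\<^sup>2)"
      by simp
    also have "c * N * \<gamma> * (100 * (1 + T) * N\<^sup>2) = c * N * (\<gamma> * (100 * (1 + T) * N\<^sup>2))"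
      by (rule mult.assoc)
    also have "\<gamma> * (100 * (1 + T) * N\<^sup>2) = 1"
      using T N by (simp add: \<gamma>_def)
    finally have "c * N \<le> 6400 * (1 + T) * C * ((N powr s)\<^sup>2 * N\<^sup>2)" by (simp only: mult_1_right)
    \<comment> \<open>At this point N is bounded by a constant times N^(2 s + 2). The quotient has
      exponent - 1 - 2 s, which is positive exactly for s < - 1 / 2.\<close>
    moreover have "N powr (- 1 - 2 * s) * ((N powr s)\<^sup>2 * N\<^sup>2) = N"
    proof -
      have "(N powr s)\<^sup>2 * N\<^sup>2 = N powr (2 * s + 2)"
      proof -
        have "(N powr s)\<^sup>2 = N powr (2 * s)" by (simp add: power2_eq_square flip: powr_add)
        moreover have "N\<^sup>2 = N powr 2" using N by simp
        ultimately show ?thesis by (simp only: powr_add)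
      qed
      then show ?thesis using N by (simp flip: powr_add)
    qed
    ultimately have "(c * N powr (- 1 - 2 * s)) * ((N powr s)\<^sup>2 * N\<^sup>2) \<le> (6400 * (1 + T) * C) * ((N powr s)\<^sup>2 * N\<^sup>2)"
      by (simp add: mult_ac)
    moreover have "0 < (N powr s)\<^sup>2 * N\<^sup>2" using N by simp
    ultimately have "c * N powr (- 1 - 2 * s) \<le> 6400 * (1 + T) * C"
      by (simp only: mult_le_cancel_right_pos)
    then show ?thesis using c by (simp add: le_divide_eq mult.commute)
  qed
  have "0 < - 1 - 2 * s" using assms(3) by simp
  then obtain N where "1 \<le> N" "6400 * (1 + T) * C / c < N powr (- 1 - 2 * s)"
    by (rule powr_unbounded)
  with main[of N] show False by linarith
qed

end
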